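(* Let $n\ge 0$ and let $\mathcal V$ be a simplicial vector space which is at most an $n$-type. Then the double $n$-dual $(\mathcal V^{n*})^{n*}$ is weakly equivalent to $\mathcal V$ via the left induced map of the $n$-dual pairing: the simplicial linear map $$\langle\,,\rangle^l:\mathcal V\longrightarrow(\mathcal V^{n*})^{n*}$$ is a weak equivalence.
   Context: Vector spaces are finite-dimensional over $\mathbb R$; a simplicial vector space is a simplicial object in vector spaces (faces $d_i$, degeneracies $s_j$; for order-preserving $q:[l]\to[k]$ write $q^*:\mathcal V_k\to\mathcal V_l$). $\mathsf{SVec}$ is the category of simplicial vector spaces; $\otimes$ is levelwise. A weak equivalence is a simplicial linear map inducing isomorphisms on all homotopy groups $\pi_i$, $i\ge0$, at all basepoints. Normalized complex: $N(\mathcal V)_m=\bigcap_{i=0}^{m-1}\ker d_i^m$ with differential $(-1)^md_m^m$. $\mathcal V$ is at most an $n$-type if $H_m(N(\mathcal V))=0$ for all $m>n$. $B^n\mathbb R$ is the simplicial vector space (model of $K(\mathbb R,n)$) whose $m$-simplices are the functions $c:\Delta[m]_n\to\mathbb R$ vanishing on degenerate simplices with $\sum_{i=0}^{n+1}(-1)^ic(d_i\sigma)=0$ for all $\sigma\in\Delta[m]_{n+1}$, with the evident simplicial structure. $n$-dual: $\Delta[m]_l$ is the set of order-preserving maps $[l]\to[m]$; $(\mathcal V\otimes\Delta[m])_l=\bigoplus_{u\in\Delta[m]_l}\mathcal V_l^u$ with $d_i(v^u)=(d_iv)^{d_iu}$, $s_i(v^u)=(s_iv)^{s_iu}$. $\mathcal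 V^{n*}$ is the simplicial vector space $\mathcal V^{n*}_m=\mathsf{SVec}(\mathcal V\otimes\Delta[m],B^n\mathbb R)$, with structure maps by precomposition with those between the $\Delta[m]$'s. The $n$-dual pairing $\langle\,,\rangle:\mathcal V^{n*}\otimes\mathcal V\to B^n\mathbb R$ is $\langle f,v\rangle=f_l(v^{E_l})$ for $f\in\mathcal V^{n*}_l$, $v\in\mathcal V_l$, $E_l=\mathrm{id}_{[l]}\in\Delta[l]_l$. Its left induced map $\langle\,,\rangle^l:\mathcal V\to(\mathcal V^{n*})^{n*}$ sends $v\in\mathcal V_k$ to the map $\mathcal V^{n*}\otimes\Delta[k]\to B^n\mathbb R$ given by $f^q\mapsto\langle f,q^*v\rangle$ for $f\in\mathcal V^{n*}_l$, $q\in\Delta[k]_l$. *)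

theory Defs
  imports Complex_Main "HOL-Library.FuncSet" "HOL-Library.Function_Algebras" "HOL-Algebra.Group"
begin

section \<open>Functions into a vector space\<close>

instantiation "fun" :: (type, scaleR) scaleR
begin

definition scaleR_fun :: "real \<Rightarrow> ('a \<Rightarrow> 'b) \<Rightarrow> 'a \<Rightarrow> 'b"
  where "r *\<^sub>R f = (\<lambda>x. r *\<^sub>R f x)"

instance ..

end

lemma scaleR_fun_apply [simp]: "(r *\<^sub>R f) x = r *\<^sub>R f x"
  by (simp add: scaleR_fun_def)

instance "fun" :: (type, real_vector) real_vector
  by standard (simp_all add: fun_eq_iff scaleR_add_right scaleR_add_left)

definition linear_map_on :: "'a::real_vector set \<Rightarrow> 'b::real_vector set \<Rightarrow> ('a \<Rightarrow> 'b) \<Rightarrow> bool" where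
  "linear_map_on S T f \<longleftrightarrow> f \<in> S \<rightarrow> T \<and>
     (\<forall>x\<in>S. \<forall>y\<in>S. f (x + y) = f x + f y) \<and> (\<forall>c. \<forall>x\<in>S. f (c *\<^sub>R x) = c *\<^sub>R f x)"

text \<open>The element \<open>v\<^sup>u\<close> of a direct sum of copies of a vector space.\<close>

definition single :: "'i \<Rightarrow> 'a::zero \<Rightarrow> 'i \<Rightarrow> 'a" where
  "single u v = (\<lambda>w. if w = u then v else 0)"


section \<open>The simplex category\<close>

text \<open>The order-preserving maps \<open>[l] \<rightarrow> [k]\<close>, i.e. the set \<open>\<Delta>[k]\<^sub>l\<close>. A map is encoded as an
  extensional function on \<^term>\<open>{..l}\<close>, so that composition is \<^const>\<open>compose\<close>; the encoding does not
  determine \<open>l\<close> and \<open>k\<close>, which are therefore always passed along.\<close>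

definition ordmaps :: "nat \<Rightarrow> nat \<Rightarrow> (nat \<Rightarrow> nat) set" where
  "ordmaps l k = {u \<in> {..l} \<rightarrow>\<^sub>E {..k}. mono_on {..l} u}"

definition ordid :: "nat \<Rightarrow> nat \<Rightarrow> nat" where
  "ordid k = (\<lambda>j\<in>{..k}. j)"

text \<open>\<open>coface m i : [m - 1] \<rightarrow> [m]\<close>, for \<open>m \<ge> 1\<close>, omits \<open>i\<close>; \<open>codegeneracy m j : [m + 1] \<rightarrow> [m]\<close> repeats \<open>j\<close>.\<close>

definition coface :: "nat \<Rightarrow> nat \<Rightarrow> nat \<Rightarrow> nat" where
  "coface m i = (\<lambda>j\<in>{..m - 1}. if j < i then j else Suc j)"

definition codegeneracy :: "nat \<Rightarrow> nat \<Rightarrow> nat \<Rightarrow> nat" where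
  "codegeneracy m j = (\<lambda>k\<in>{..Suc m}. if k \<le> j then k else k - 1)"

definition degenerate :: "nat \<Rightarrow> nat \<Rightarrow> (nat \<Rightarrow> nat) \<Rightarrow> bool" where
  "degenerate m n \<sigma> \<longleftrightarrow>
     (\<exists>k j. n = Suc k \<and> j \<le> k \<and> (\<exists>\<tau>\<in>ordmaps k m. \<sigma> = compose {..n} \<tau> (codegeneracy k j)))"


section \<open>Simplicial vector spaces\<close>

text \<open>A simplicial vector space is a contravariant functor from the simplex category to
  finite-dimensional real vector spaces. All levels are subspaces of one (arbitrary, possibly
  infinite-dimensional) real vector space; this is no restriction, since a sequence of vector spaces
  embeds into its direct sum. \<open>pull V k l q\<close> is \<open>q\<^sup>* : V\<^sub>k \<rightarrow> V\<^sub>l\<close> for \<open>q : [l] \<rightarrow> [k]\<close>; its values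
  outside of \<open>V\<^sub>k\<close> are irrelevant.\<close>

record 'a svec =
  lev :: "nat \<Rightarrow> 'a set"
  pull :: "nat \<Rightarrow> nat \<Rightarrow> (nat \<Rightarrow> nat) \<Rightarrow> 'a \<Rightarrow> 'a"

locale simplicial_vector_space =
  fixes V :: "'a::real_vector svec"
  assumes finite_dim: "\<exists>B. finite B \<and> lev V k = span B"
    and pull_linear: "q \<in> ordmaps l k \<Longrightarrow> linear_map_on (lev V k) (lev V l) (pull V k l q)"
    and pull_id: "v \<in> lev V k \<Longrightarrow> pull V k k (ordid k) v = v"
    and pull_comp: "p \<in> ordmaps j l \<Longrightarrow> q \<in> ordmaps l k \<Longrightarrow> v \<in> lev V k \<Longrightarrow>
          pull V k j (compose {..j} q p) v = pull V l j p (pull V k l q v)"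

definition face :: "'a svec \<Rightarrow> nat \<Rightarrow> nat \<Rightarrow> 'a \<Rightarrow> 'a" where
  "face V m i = pull V m (m - 1) (coface m i)"

definition simplicial_linear_map ::
    "'a::real_vector svec \<Rightarrow> 'b::real_vector svec \<Rightarrow> (nat \<Rightarrow> 'a \<Rightarrow> 'b) \<Rightarrow> bool" where
  "simplicial_linear_map V W f \<longleftrightarrow>
     (\<forall>k. linear_map_on (lev V k) (lev W k) (f k)) \<and>
     (\<forall>k l. \<forall>q\<in>ordmaps l k. \<forall>v\<in>lev V k. f l (pull V k l q v) = pull W k l q (f k v))"


section \<open>Homology of the normalized complex\<close>

definition normalized :: "'a::real_vector svec \<Rightarrow> nat \<Rightarrow> 'a set" where
  "normalized V m = {v \<in> lev V m. \<forall>i<m. face V m i v = 0}"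

definition differential :: "'a::real_vector svec \<Rightarrow> nat \<Rightarrow> 'a \<Rightarrow> 'a" where
  "differential V m v = (- 1) ^ m *\<^sub>R face V m m v"

definition cycles :: "'a::real_vector svec \<Rightarrow> nat \<Rightarrow> 'a set" where
  "cycles V m = {v \<in> normalized V m. m > 0 \<longrightarrow> differential V m v = 0}"

definition boundaries :: "'a::real_vector svec \<Rightarrow> nat \<Rightarrow> 'a set" where
  "boundaries V m = differential V (Suc m) ` normalized V (Suc m)"

definition homology :: "'a::real_vector svec \<Rightarrow> nat \<Rightarrow> 'a set set" where
  "homology V m = cycles V m // {(y, z). y \<in> cycles V m \<and> z \<in> cycles V m \<and> y - z \<in> boundaries V m}"

text \<open>The zero element of the quotient \<^term>\<open>homology V m\<close> is the coset \<^term>\<open>boundaries V m\<close>.\<close>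

definition at_most_type :: "nat \<Rightarrow> 'a::real_vector svec \<Rightarrow> bool" where
  "at_most_type n V \<longleftrightarrow> (\<forall>m>n. homology V m = {boundaries V m})"


section \<open>Homotopy groups and weak equivalences\<close>

text \<open>The combinatorial homotopy groups of a Kan complex; the underlying simplicial set of a simplicial
  vector space is always Kan. \<^term>\<open>basepoint V i x\<close> is the degenerate \<open>i\<close>-simplex on the vertex \<open>x\<close>.\<close>

definition basepoint :: "'a svec \<Rightarrow> nat \<Rightarrow> 'a \<Rightarrow> 'a" where
  "basepoint V i x = pull V 0 i (\<lambda>j\<in>{..i}. 0) x"

definition spheres :: "'a svec \<Rightarrow> nat \<Rightarrow> 'a \<Rightarrow> 'a set" where
  "spheres V i x = {a \<in> lev V i. i > 0 \<longrightarrow> (\<forall>j\<le>i. face V i j a = basepoint V (i - 1) x)}"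

definition homotopic :: "'a svec \<Rightarrow> nat \<Rightarrow> 'a \<Rightarrow> ('a \<times> 'a) set" where
  "homotopic V i x = {(a, b). a \<in> spheres V i x \<and> b \<in> spheres V i x \<and>
     (\<exists>h\<in>lev V (Suc i). (\<forall>j<i. face V (Suc i) j h = basepoint V i x) \<and>
        face V (Suc i) i h = a \<and> face V (Suc i) (Suc i) h = b)}"

text \<open>For \<open>i = 0\<close> only the carrier, the set of path components, is meaningful. For \<open>i \<ge> 1\<close> the product
  of the classes of \<open>a\<close> and \<open>b\<close> is the class of \<open>d\<^sub>i w\<close>, where \<open>w\<close> is an \<open>(i + 1)\<close>-simplex with
  \<open>d\<^sub>i\<^sub>-\<^sub>1 w = a\<close>, \<open>d\<^sub>i\<^sub>+\<^sub>1 w = b\<close> and all lower faces at the base point.\<close>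

definition homotopy_group :: "'a svec \<Rightarrow> nat \<Rightarrow> 'a \<Rightarrow> 'a set monoid" where
  "homotopy_group V i x =
     \<lparr> carrier = spheres V i x // homotopic V i x,
       mult = (\<lambda>A B. {c. \<exists>a\<in>A. \<exists>b\<in>B. \<exists>w\<in>lev V (Suc i).
          (\<forall>j. Suc j < i \<longrightarrow> face V (Suc i) j w = basepoint V i x) \<and>
          face V (Suc i) (i - 1) w = a \<and> face V (Suc i) (Suc i) w = b \<and>
          (face V (Suc i) i w, c) \<in> homotopic V i x}),
       one = homotopic V i x `` {basepoint V i x} \<rparr>"

definition homotopy_map :: "'b svec \<Rightarrow> (nat \<Rightarrow> 'a \<Rightarrow> 'b) \<Rightarrow> nat \<Rightarrow> 'a \<Rightarrow> 'a set \<Rightarrow> 'b set" where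
  "homotopy_map W f i x = (\<lambda>A. homotopic W i (f 0 x) `` (f i ` A))"

definition weak_equivalence ::
    "'a::real_vector svec \<Rightarrow> 'b::real_vector svec \<Rightarrow> (nat \<Rightarrow> 'a \<Rightarrow> 'b) \<Rightarrow> bool" where
  "weak_equivalence V W f \<longleftrightarrow>
     simplicial_vector_space V \<and> simplicial_vector_space W \<and> simplicial_linear_map V W f \<and>
     (\<forall>x\<in>lev V 0.
        bij_betw (homotopy_map W f 0 x)
          (carrier (homotopy_group V 0 x)) (carrier (homotopy_group W 0 (f 0 x))) \<and>
        (\<forall>i\<ge>1. homotopy_map W f i x \<in> iso (homotopy_group V i x) (homotopy_group W i (f 0 x))))"


section \<open>Tensoring with a simplex, Eilenberg--MacLane objects and duals\<close>

text \<open>\<open>V \<otimes> \<Delta>[m]\<close>: an element of level \<open>k\<close> is a family in \<open>V\<^sub>k\<close> indexed by \<open>\<Delta>[m]\<^sub>k\<close>, extended by \<open>0\<close>.\<close>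

definition tensor_simplex :: "'a::real_vector svec \<Rightarrow> nat \<Rightarrow> ((nat \<Rightarrow> nat) \<Rightarrow> 'a) svec" where
  "tensor_simplex V m =
     \<lparr> lev = (\<lambda>k. {x. (\<forall>u\<in>ordmaps k m. x u \<in> lev V k) \<and> (\<forall>u. u \<notin> ordmaps k m \<longrightarrow> x u = 0)}),
       pull = (\<lambda>k l q x. \<Sum>u\<in>ordmaps k m. single (compose {..l} u q) (pull V k l q (x u))) \<rparr>"

text \<open>Level \<open>j\<close> of the map \<open>V \<otimes> \<Delta>[l] \<rightarrow> V \<otimes> \<Delta>[m]\<close> induced by \<open>q : [l] \<rightarrow> [m]\<close>.\<close>

definition tensor_map ::
    "nat \<Rightarrow> (nat \<Rightarrow> nat) \<Rightarrow> nat \<Rightarrow> ((nat \<Rightarrow> nat) \<Rightarrow> 'a::real_vector) \<Rightarrow> (nat \<Rightarrow> nat) \<Rightarrow> 'a" where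
  "tensor_map l q j x = (\<Sum>u\<in>ordmaps j l. single (compose {..j} q u) (x u))"

text \<open>\<open>B\<^sup>n\<real>\<close>: an \<open>m\<close>-simplex is a normalized \<open>n\<close>-cocycle on \<open>\<Delta>[m]\<close>, extended by \<open>0\<close>.\<close>

definition EM :: "nat \<Rightarrow> ((nat \<Rightarrow> nat) \<Rightarrow> real) svec" where
  "EM n =
     \<lparr> lev = (\<lambda>m. {c. (\<forall>\<sigma>. \<sigma> \<notin> ordmaps n m \<longrightarrow> c \<sigma> = 0) \<and>
          (\<forall>\<sigma>\<in>ordmaps n m. degenerate m n \<sigma> \<longrightarrow> c \<sigma> = 0) \<and>
          (\<forall>\<sigma>\<in>ordmaps (Suc n) m. (\<Sum>i\<le>Suc n. (- 1) ^ i * c (compose {..n} \<sigma> (coface (Suc n) i))) = 0)}),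
       pull = (\<lambda>m l q c. \<lambda>\<sigma>. if \<sigma> \<in> ordmaps n l then c (compose {..n} q \<sigma>) else 0) \<rparr>"

type_synonym 'a dual = "nat \<Rightarrow> ((nat \<Rightarrow> nat) \<Rightarrow> 'a) \<Rightarrow> (nat \<Rightarrow> nat) \<Rightarrow> real"

text \<open>The \<open>n\<close>-dual. Simplicial linear maps are extended by \<open>0\<close> outside of their domains, so that
  extensionally equal maps are equal and the maps still form a vector space.\<close>

definition ndual :: "nat \<Rightarrow> 'a::real_vector svec \<Rightarrow> 'a dual svec" where
  "ndual n V =
     \<lparr> lev = (\<lambda>m. {f. simplicial_linear_map (tensor_simplex V m) (EM n) f \<and>
          (\<forall>j x. x \<notin> lev (tensor_simplex V m) j \<longrightarrow> f j x = 0)}),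
       pull = (\<lambda>m l q f. \<lambda>j x.
          if x \<in> lev (tensor_simplex V l) j then f j (tensor_map l q j x) else 0) \<rparr>"

definition npairing :: "nat \<Rightarrow> 'a::real_vector dual \<Rightarrow> 'a \<Rightarrow> (nat \<Rightarrow> nat) \<Rightarrow> real" where
  "npairing l f v = f l (single (ordid l) v)"

definition left_induced :: "nat \<Rightarrow> 'a::real_vector svec \<Rightarrow> nat \<Rightarrow> 'a \<Rightarrow> 'a dual dual" where
  "left_induced n V k v = (\<lambda>l x.
     if x \<in> lev (tensor_simplex (ndual n V) k) l
     then \<Sum>q\<in>ordmaps l k. npairing l (x q) (pull V k l q v) else 0)"

lemma finite_ordmaps: "finite (ordmaps l k)"
  by (rule finite_subset[of _ "{..l} \<rightarrow>\<^sub>E {..k}"]) (auto simp: ordmaps_def finite_PiE)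

lemma single_zero [simp]: "single u (0::'a::zero) = (\<lambda>_. 0)"
  by (simp add: single_def fun_eq_iff)

lemma sum_ordmaps_single:
  assumes "u \<in> ordmaps l k" and "\<And>w. F w 0 = 0"
  shows "(\<Sum>w\<in>ordmaps l k. F w (single u v w)) = F u v"
proof -
  have "(\<Sum>w\<in>ordmaps l k. F w (single u v w)) = (\<Sum>w\<in>ordmaps l k. if w = u then F u v else 0)"
    by (rule sum.cong) (simp_all add: single_def assms(2))
  then show ?thesis
    using assms(1) by (simp add: finite_ordmaps)
qed

text \<open>The structure maps of the tensor product and the left induced map on the generators \<open>v\<^sup>u\<close>.\<close>

lemma (in simplicial_vector_space) pull_zero:
  assumes "q \<in> ordmaps l k"
  shows "pull V k l q 0 = 0"
proof -
  obtain B where "lev V k = span B"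
    using finite_dim[of k] by (elim exE conjE)
  then have zero: "0 \<in> lev V k"
    by (simp only: span_zero)
  have linear: "\<forall>c. \<forall>x\<in>lev V k. pull V k l q (c *\<^sub>R x) = c *\<^sub>R pull V k l q x"
    using pull_linear[OF assms] unfolding linear_map_on_def by (elim conjE)
  show ?thesis
    using linear[rule_format, OF zero, of 0] by (simp only: scaleR_zero_left)
qed

lemma (in simplicial_vector_space) tensor_pull_single:
  assumes "q \<in> ordmaps l k" and "u \<in> ordmaps k m"
  shows "pull (tensor_simplex V m) k l q (single u v) = single (compose {..l} u q) (pull V k l q v)"
  using sum_ordmaps_single[OF assms(2), of "\<lambda>w y. single (compose {..l} w q) (pull V k l q y)" v]
  by (simp add: tensor_simplex_def pull_zero[OF assms(1)] zero_fun_def)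

lemma zero_in_ndual: "0 \<in> lev (ndual n V) l"
proof -
  have "simplicial_linear_map (tensor_simplex V l) (EM n) (\<lambda>_ _ _. 0)"
    unfolding simplicial_linear_map_def linear_map_on_def
    apply (intro conjI allI ballI funcsetI)
       apply (simp_all only: EM_def svec.simps mem_Collect_eq)
       apply (simp_all add: fun_eq_iff)
    done
  then show ?thesis
    unfolding ndual_def zero_fun_def by simp
qed

lemma left_induced_single:
  assumes "f \<in> lev (ndual n V) l" and "q \<in> ordmaps l k"
  shows "left_induced n V k v l (single q f) = npairing l f (pull V k l q v)"
proof -
  let ?F = "\<lambda>p g. npairing l g (pull V k l p v)"
  have member: "single q f \<in> lev (tensor_simplex (ndual n V) k) l"
    unfolding tensor_simplex_def svec.simps mem_Collect_eq
    using assms zero_in_ndual[of n V l] by (metis single_def)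
  have "?F p 0 = 0" for p
    by (rule ext) (simp only: npairing_def zero_fun_apply)
  from sum_ordmaps_single[where F = ?F and v = f, OF assms(2) this]
  show ?thesis
    unfolding left_induced_def if_P[OF member] .
qed

end

theory Submission
  imports Defs
begin

text \<open>A simplicial map \<open>W \<rightarrow> B\<^sup>n\<real>\<close> is the same thing as a normalized \<open>n\<close>-cocycle on \<open>W\<close>. So an
  \<open>i\<close>-simplex \<open>f\<close> of the dual of \<open>V\<close> is a cocycle on \<open>V \<otimes> \<Delta>[i]\<close>, the faces of \<open>f\<close> are its restrictions
  to the faces of \<open>\<Delta>[i]\<close>, and a cycle of the dual is a cocycle on \<open>V \<otimes> \<Delta>[i]\<close> that vanishes on
  \<open>V \<otimes> \<partial>\<Delta>[i]\<close>. Such a cocycle can be evaluated on the shuffle product \<open>EZ i j v\<close> of a cycle \<open>v\<close> of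
  degree \<open>j = n - i\<close> with the top simplex of \<open>\<Delta>[i]\<close>. This gives a pairing between \<open>H\<^sub>i\<close> of the dual and
  \<open>H\<^sub>j(V)\<close>, and the point is that the pairing is perfect.

  Perfectness rests on the fact that the shuffle product is an isomorphism from \<open>H\<^sub>j(V)\<close> to
  \<open>H\<^sub>i\<^sub>+\<^sub>j(V \<otimes> \<Delta>[i], V \<otimes> \<partial>\<Delta>[i])\<close> (lemmas \<open>EZ_surjective\<close> and \<open>EZ_injective\<close>). It is proved by
  induction on \<open>i\<close>: the pair consisting of \<open>\<Delta>[i]\<close> and the horn of all faces through the last vertex is
  contractible (\<open>horn_acyclic\<close>), so the connecting map to the last face \<open>\<Delta>[i - 1]\<close> is an isomorphism, and by
  the Leibniz rule \<open>bd_EZ\<close> it takes shuffle products to shuffle products.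

  Injectivity of the shuffle product yields that a cycle of \<open>V\<close> which is orthogonal to all cycles of the dual
  is a boundary: a linear functional separates its shuffle product from the relative boundaries. Surjectivity
  yields that a cycle \<open>f\<close> of the dual which is orthogonal to all cycles of \<open>V\<close> is a boundary: regard \<open>f\<close> as a
  cocycle on the last face of \<open>\<Delta>[i + 1]\<close>; orthogonality is what is required to extend it by zero over the
  horn to a cocycle on \<open>\<Delta>[i + 1]\<close>. For \<open>i > n\<close> orthogonality is a void condition, so the dual has no homology
  above \<open>n\<close>.

  Under the left induced map the pairing of \<open>V\<close> with its dual becomes, up to a global sign, the pairing of the
  dual with the double dual (\<open>left_induced_EZ\<close>); the reason is that the complement of a shuffle is a shuffle.
  Hence the left induced map is injective on \<open>H\<^sub>j\<close> for \<open>j \<le> n\<close>, and surjective because a functional on the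
  finite-dimensional homology of the dual is given by pairing with a cycle of \<open>V\<close>. Above \<open>n\<close> both sides have
  no homology, the left one by assumption. Finally, a simplicial linear map that is bijective on homology is
  bijective on all homotopy groups at all base points, by translation to the base point \<open>0\<close>.\<close>

section \<open>Linear algebra on subspaces\<close>

lemma linear_map_onD:
  assumes "linear_map_on S T f"
  shows linear_map_on_mem: "x \<in> S \<Longrightarrow> f x \<in> T"
    and linear_map_on_add: "x \<in> S \<Longrightarrow> y \<in> S \<Longrightarrow> f (x + y) = f x + f y"
    and linear_map_on_scale: "x \<in> S \<Longrightarrow> f (c *\<^sub>R x) = c *\<^sub>R f x"
  using assms unfolding linear_map_on_def by auto

lemma linear_map_on_zero:
  assumes "linear_map_on S T f" "subspace S"
  shows "f 0 = 0"
  using linear_map_on_scale[OF assms(1) subspace_0[OF assms(2)], of 0] by simp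

lemma linear_map_on_diff:
  assumes "linear_map_on S T f" "subspace S" "x \<in> S" "y \<in> S"
  shows "f (x - y) = f x - f y"
  using linear_map_on_add[OF assms(1), of "x - y" y] assms subspace_diff[OF assms(2)] by auto

lemma linear_map_on_neg:
  assumes "linear_map_on S T f" "subspace S" "x \<in> S"
  shows "f (- x) = - f x"
  using linear_map_on_diff[OF assms(1,2) subspace_0[OF assms(2)] assms(3)] linear_map_on_zero[OF assms(1,2)] by simp

lemma linear_map_on_sum:
  assumes "linear_map_on S T f" "subspace S" "\<And>a. a \<in> A \<Longrightarrow> g a \<in> S"
  shows "f (\<Sum>a\<in>A. g a) = (\<Sum>a\<in>A. f (g a))"
  using assms(3)
proof (induction A rule: infinite_finite_induct)
  case (insert a A)
  then show ?case
    using linear_map_on_add[OF assms(1)] subspace_sum[OF assms(2), of A g] by simp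
qed (simp_all add: linear_map_on_zero[OF assms(1,2)])

lemma linear_map_on_span_subset:
  assumes f: "linear_map_on S T f" and S: "subspace S" and U: "subspace U"
    and B: "B \<subseteq> S" "\<And>b. b \<in> B \<Longrightarrow> f b \<in> U" and x: "x \<in> span B"
  shows "f x \<in> U"
proof -
  have "x \<in> S \<and> f x \<in> U"
    using x
  proof (induction rule: span_induct_alt)
    case base
    then show ?case using linear_map_on_zero[OF f S] subspace_0[OF S] subspace_0[OF U] by auto
  next
    case (step c b y)
    then have "b \<in> S" using B by auto
    with step show ?case
      using linear_map_on_add[OF f] linear_map_on_scale[OF f] B(2)
        subspace_add[OF S] subspace_scale[OF S] subspace_add[OF U] subspace_scale[OF U] by auto
  qed
  then show ?thesis by simp
qed

lemma linear_map_on_sum_fun: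
  assumes "subspace T" "\<And>a. a \<in> A \<Longrightarrow> linear_map_on S T (f a)"
  shows "linear_map_on S T (\<lambda>x. \<Sum>a\<in>A. f a x)"
  using assms unfolding linear_map_on_def
  by (auto simp: sum.distrib scaleR_sum_right Pi_iff intro!: subspace_sum sum.cong)

lemma linear_map_on_scale_fun:
  assumes "subspace T" "linear_map_on S T f"
  shows "linear_map_on S T (\<lambda>x. c *\<^sub>R f x)"
  using assms unfolding linear_map_on_def
  by (auto simp: scaleR_add_right intro!: subspace_scale)

lemma linear_map_on_comp:
  assumes "linear_map_on S T f" "linear_map_on T U g"
  shows "linear_map_on S U (\<lambda>x. g (f x))"
  using assms unfolding linear_map_on_def by (auto simp: Pi_iff)

lemma linear_map_on_subset:
  assumes "linear_map_on S T f" "S' \<subseteq> S" "\<And>x. x \<in> S' \<Longrightarrow> f x \<in> T'"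
  shows "linear_map_on S' T' f"
  using assms unfolding linear_map_on_def by (auto simp: subset_iff)

lemma linear_map_on_minus_fun:
  assumes "linear_map_on S X F" "linear_map_on S Y G"
  shows "linear_map_on S UNIV (\<lambda>x. F x - G x)"
  using assms by (auto simp: linear_map_on_def algebra_simps)

lemma id_linear: "linear_map_on S S (\<lambda>v. v)"
  by (auto simp: linear_map_on_def)

lemma subspace_sum3:
  assumes A: "subspace A" and B: "subspace B" and C: "subspace C"
  shows "subspace {a + b + c |a b c. a \<in> A \<and> b \<in> B \<and> c \<in> C}" (is "subspace ?S")
  unfolding subspace_def
proof (intro conjI ballI allI)
  show "0 \<in> ?S"
    using subspace_0[OF A] subspace_0[OF B] subspace_0[OF C] by (metis (mono_tags, lifting) add_0 mem_Collect_eq)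
next
  fix x y assume "x \<in> ?S" "y \<in> ?S"
  then obtain a b c a' b' c' where *: "x = a + b + c" "y = a' + b' + c'"
    "a \<in> A" "b \<in> B" "c \<in> C" "a' \<in> A" "b' \<in> B" "c' \<in> C" by blast
  have "x + y = (a + a') + (b + b') + (c + c')" using * by simp
  then show "x + y \<in> ?S"
    using subspace_add[OF A *(3,6)] subspace_add[OF B *(4,7)] subspace_add[OF C *(5,8)] by blast
next
  fix r x assume "x \<in> ?S"
  then obtain a b c where *: "x = a + b + c" "a \<in> A" "b \<in> B" "c \<in> C" by blast
  have "r *\<^sub>R x = r *\<^sub>R a + r *\<^sub>R b + r *\<^sub>R c" using * by (simp add: scaleR_add_right)
  then show "r *\<^sub>R x \<in> ?S"
    using subspace_scale[OF A *(2)] subspace_scale[OF B *(3)] subspace_scale[OF C *(4)] by blast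
qed

lemma subspace_linear_map_on_image:
  assumes f: "linear_map_on S X f" and S: "subspace S"
  shows "subspace (f ` S)"
  unfolding subspace_def
  using linear_map_on_zero[OF f S, symmetric] linear_map_on_add[OF f, symmetric] linear_map_on_scale[OF f, symmetric]
    subspace_0[OF S] subspace_add[OF S] subspace_scale[OF S]
  by auto

lemma linear_map_on_extend:
  fixes \<theta> :: "'b::real_vector \<Rightarrow> real"
  assumes U: "subspace U" and \<theta>: "linear_map_on U UNIV \<theta>"
  shows "\<exists>g. linear g \<and> (\<forall>x\<in>U. g x = \<theta> x)"
proof -
  obtain B where B: "B \<subseteq> U" "independent B" "U \<subseteq> span B"
    using maximal_independent_subset by blast
  obtain g where g: "linear g" "\<forall>x\<in>B. g x = \<theta> x"
    using linear_independent_extend[OF B(2)] by blast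
  have "linear_map_on U UNIV (\<lambda>x. g x - \<theta> x)"
    unfolding linear_map_on_def
    using linear_map_on_add[OF \<theta>] linear_map_on_scale[OF \<theta>] g(1)
    by (auto simp: linear_add linear_scale algebra_simps)
  then have "g x - \<theta> x \<in> {0}" if "x \<in> U" for x
    by (rule linear_map_on_span_subset[OF _ U subspace_single_0 B(1)]) (use g B that in auto)
  then show ?thesis using g(1) by (metis right_minus_eq singletonD)
qed

text \<open>On the subspace of all \<open>x\<close> that agree with some \<open>\<delta> c\<close> modulo \<open>T\<close> the value of the extension is forced to
  be \<open>\<phi> c\<close>, and \<open>compat\<close> says that this is well defined. Below, \<open>\<phi>\<close> is a cocycle on a face of a simplex
  that is to be extended by zero over the other faces.\<close>

lemma functional_extension:
  fixes \<phi> :: "'b::real_vector \<Rightarrow> real" and \<delta> :: "'b \<Rightarrow> 'c::real_vector"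
  assumes C: "subspace C" and T: "subspace T"
    and \<delta>: "linear_map_on C UNIV \<delta>" and \<phi>: "linear_map_on C UNIV \<phi>"
    and compat: "\<And>c. c \<in> C \<Longrightarrow> \<delta> c \<in> T \<Longrightarrow> \<phi> c = 0"
  shows "\<exists>g. linear g \<and> (\<forall>x\<in>T. g x = (0::real)) \<and> (\<forall>c\<in>C. g (\<delta> c) = \<phi> c)"
proof -
  define U where "U = {x. \<exists>c\<in>C. x - \<delta> c \<in> T}"
  define \<theta> where "\<theta> x = \<phi> (SOME c. c \<in> C \<and> x - \<delta> c \<in> T)" for x
  have \<theta>: "\<theta> x = \<phi> c" if c: "c \<in> C" "x - \<delta> c \<in> T" for x c
  proof -
    define c' where "c' = (SOME c. c \<in> C \<and> x - \<delta> c \<in> T)"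
    have c': "c' \<in> C" "x - \<delta> c' \<in> T"
      unfolding c'_def using someI[of "\<lambda>c. c \<in> C \<and> x - \<delta> c \<in> T" c] c by auto
    have "\<delta> (c' - c) = (x - \<delta> c) - (x - \<delta> c')"
      using linear_map_on_diff[OF \<delta> C c'(1) c(1)] by simp
    then have "\<phi> (c' - c) = 0"
      using compat[of "c' - c"] subspace_diff[OF C c'(1) c(1)] subspace_diff[OF T c(2) c'(2)] by simp
    then show ?thesis
      using linear_map_on_diff[OF \<phi> C c'(1) c(1)] by (simp add: \<theta>_def c'_def)
  qed
  have step: "c + a *\<^sub>R d \<in> C" "x + a *\<^sub>R y - \<delta> (c + a *\<^sub>R d) \<in> T" "\<phi> (c + a *\<^sub>R d) = \<phi> c + a * \<phi> d"
    if "c \<in> C" "x - \<delta> c \<in> T" "d \<in> C" "y - \<delta> d \<in> T" for x y c d a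
  proof -
    show mem: "c + a *\<^sub>R d \<in> C" using that C by (simp add: subspace_add subspace_scale)
    have eq: "x + a *\<^sub>R y - \<delta> (c + a *\<^sub>R d) = (x - \<delta> c) + a *\<^sub>R (y - \<delta> d)"
      using linear_map_on_add[OF \<delta> that(1), of "a *\<^sub>R d"] linear_map_on_scale[OF \<delta> that(3), of a] that(3)
        subspace_scale[OF C] by (simp add: algebra_simps)
    show "x + a *\<^sub>R y - \<delta> (c + a *\<^sub>R d) \<in> T"
      unfolding eq using that T by (intro subspace_add subspace_scale)
    show "\<phi> (c + a *\<^sub>R d) = \<phi> c + a * \<phi> d"
      using linear_map_on_add[OF \<phi> that(1), of "a *\<^sub>R d"] linear_map_on_scale[OF \<phi> that(3), of a] that(3)
        subspace_scale[OF C] by simp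
  qed
  have comb: "x + a *\<^sub>R y \<in> U \<and> \<theta> (x + a *\<^sub>R y) = \<theta> x + a * \<theta> y" if xy: "x \<in> U" "y \<in> U" for x y a
  proof -
    obtain c d where cd: "c \<in> C" "x - \<delta> c \<in> T" "d \<in> C" "y - \<delta> d \<in> T" using xy by (auto simp: U_def)
    note s = step[OF cd, of a]
    show ?thesis using s(1,2) \<theta>[OF s(1,2)] s(3) \<theta>[OF cd(1,2)] \<theta>[OF cd(3,4)] by (auto simp: U_def)
  qed
  have zero: "0 \<in> U" "\<theta> 0 = 0"
    using \<theta>[of 0 0] subspace_0[OF C] subspace_0[OF T] linear_map_on_zero[OF \<delta> C] linear_map_on_zero[OF \<phi> C]
    by (auto simp: U_def intro: bexI[of _ 0])
  have U: "subspace U"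
    unfolding subspace_def using zero comb[of _ _ 1] comb[of 0] by auto
  have "linear_map_on U UNIV \<theta>"
    unfolding linear_map_on_def using comb[of _ _ 1] comb[of 0] zero by auto
  then obtain g where g: "linear g" "\<forall>x\<in>U. g x = \<theta> x"
    using linear_map_on_extend[OF U] by blast
  have "x \<in> U \<and> \<theta> x = 0" if "x \<in> T" for x
    using \<theta>[of 0 x] that subspace_0[OF C] linear_map_on_zero[OF \<delta> C] linear_map_on_zero[OF \<phi> C]
    by (auto simp: U_def intro: bexI[of _ 0])
  moreover have "\<delta> c \<in> U \<and> \<theta> (\<delta> c) = \<phi> c" if "c \<in> C" for c
    using \<theta>[OF that, of "\<delta> c"] subspace_0[OF T] that by (auto simp: U_def intro: bexI[of _ c])
  ultimately show ?thesis using g by metis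
qed

lemma separating_functional:
  fixes x :: "'b::real_vector"
  assumes T: "subspace T" and x: "x \<notin> T"
  shows "\<exists>g. linear g \<and> (\<forall>y\<in>T. g y = (0::real)) \<and> g x = 1"
proof -
  have "\<exists>g. linear g \<and> (\<forall>y\<in>T. g y = (0::real)) \<and> (\<forall>c\<in>UNIV. g (c *\<^sub>R x) = c)"
  proof (rule functional_extension[OF subspace_UNIV T])
    show "linear_map_on UNIV UNIV (\<lambda>c. c *\<^sub>R x)" "linear_map_on UNIV UNIV (\<lambda>c::real. c)"
      by (auto simp: linear_map_on_def scaleR_add_left)
    show "c = 0" if "c *\<^sub>R x \<in> T" for c
      using subspace_scale[OF T that, of "inverse c"] x by (cases "c = 0") auto
  qed
  then obtain g where "linear g" "\<forall>y\<in>T. g y = 0" "\<forall>c. g (c *\<^sub>R x) = c" by auto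
  then show ?thesis by (metis scaleR_one)
qed

text \<open>Induction on \<open>B\<close>: on the kernel of \<open>e b\<close> the functional \<open>\<mu>\<close> is a combination of the remaining ones, and the
  difference of \<open>\<mu>\<close> and this combination is a multiple of \<open>e b\<close>.\<close>

lemma functional_in_span_of_functionals:
  fixes e :: "'i \<Rightarrow> 'b::real_vector \<Rightarrow> real"
  assumes "finite B" "subspace S" "linear_map_on S UNIV \<mu>"
    and "\<And>b. b \<in> B \<Longrightarrow> linear_map_on S UNIV (e b)"
    and "\<And>x. x \<in> S \<Longrightarrow> \<forall>b\<in>B. e b x = 0 \<Longrightarrow> \<mu> x = 0"
  shows "\<exists>c. \<forall>x\<in>S. \<mu> x = (\<Sum>b\<in>B. c b * e b x)"
  using assms
proof (induction B arbitrary: S \<mu> rule: finite_induct)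
  case empty
  then show ?case by auto
next
  case (insert b B)
  note S = insert.prems(1) and \<mu> = insert.prems(2) and e = insert.prems(3)
  let ?K = "{x \<in> S. e b x = 0}"
  have eb: "linear_map_on S UNIV (e b)" using e by simp
  have K: "subspace ?K"
    unfolding subspace_def
    using S linear_map_on_add[OF eb] linear_map_on_scale[OF eb] linear_map_on_zero[OF eb S]
    by (auto simp: subspace_def)
  have restr: "linear_map_on ?K UNIV f" if "linear_map_on S UNIV f" for f :: "'b \<Rightarrow> real"
    using that by (auto simp: linear_map_on_def)
  obtain c where c: "\<forall>x\<in>?K. \<mu> x = (\<Sum>b\<in>B. c b * e b x)"
    using insert.IH[OF K restr[OF \<mu>]] restr e insert.prems(4) by auto
  define \<nu> where "\<nu> x = \<mu> x - (\<Sum>b\<in>B. c b * e b x)" for x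
  have \<nu>: "linear_map_on S UNIV \<nu>"
    unfolding linear_map_on_def \<nu>_def
    using linear_map_on_add[OF \<mu>] linear_map_on_scale[OF \<mu>] linear_map_on_add[OF e] linear_map_on_scale[OF e]
    by (auto simp: algebra_simps sum.distrib sum_distrib_left)
  have "\<exists>a. \<forall>x\<in>S. \<nu> x = a * e b x"
  proof (cases "\<forall>x\<in>S. e b x = 0")
    case True
    then show ?thesis using c by (auto simp: \<nu>_def)
  next
    case False
    then obtain s where s: "s \<in> S" "e b s \<noteq> 0" by auto
    have "\<nu> x = (\<nu> s / e b s) * e b x" if "x \<in> S" for x
    proof -
      let ?y = "(e b x / e b s) *\<^sub>R s"
      have y: "?y \<in> S" using S s by (simp add: subspace_scale)
      have "e b (x - ?y) = 0"
        using linear_map_on_diff[OF eb S that y] linear_map_on_scale[OF eb s(1)] s(2) by simp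
      then have "\<nu> (x - ?y) = 0"
        using c subspace_diff[OF S that y] by (simp add: \<nu>_def)
      then show ?thesis
        using linear_map_on_diff[OF \<nu> S that y] linear_map_on_scale[OF \<nu> s(1)] by simp
    qed
    then show ?thesis by blast
  qed
  then obtain a where a: "\<forall>x\<in>S. \<nu> x = a * e b x" by blast
  have "(\<Sum>b'\<in>B. (c(b := a)) b' * e b' x) = (\<Sum>b\<in>B. c b * e b x)" for x
    using insert.hyps by (intro sum.cong) auto
  then have "\<forall>x\<in>S. \<mu> x = (\<Sum>b'\<in>insert b B. (c(b := a)) b' * e b' x)"
    using a insert.hyps by (auto simp: \<nu>_def diff_eq_eq)
  then show ?case by blast
qed

lemma finite_basis_of_subspace:
  fixes S :: "'b::real_vector set"
  assumes S: "subspace S" "S \<subseteq> span B" and "finite B"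
  shows "\<exists>B'. finite B' \<and> S = span B'"
proof -
  obtain B' where B': "B' \<subseteq> S" "independent B'" "S \<subseteq> span B'"
    using maximal_independent_subset by blast
  then have "finite B'" using independent_span_bound[OF assms(3), of B'] S(2) by auto
  moreover have "S = span B'" using B' span_minimal[OF B'(1) S(1)] by auto
  ultimately show ?thesis by blast
qed

text \<open>Levels of the dual are shown to be finite-dimensional by means of finitely many coordinates \<open>\<Phi> x i\<close>. Each
  coordinate cuts down the dimension of the common kernel by at most one.\<close>

lemma finite_basis_of_embedding:
  fixes \<Phi> :: "'b::real_vector \<Rightarrow> 'i \<Rightarrow> real"
  assumes S: "subspace S" and \<Phi>: "linear_map_on S UNIV \<Phi>" and "finite I"
    and supp: "\<And>x i. x \<in> S \<Longrightarrow> i \<notin> I \<Longrightarrow> \<Phi> x i = 0"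
    and inj: "\<And>x. x \<in> S \<Longrightarrow> \<Phi> x = 0 \<Longrightarrow> x = 0"
  shows "\<exists>B. finite B \<and> S = span B"
proof -
  define E where "E i = (\<lambda>x. \<Phi> x i)" for i
  have E: "linear_map_on S UNIV (E i)" for i
    using \<Phi> by (auto simp: linear_map_on_def E_def)
  have "\<exists>B. finite B \<and> S' = span B"
    if "finite J" "subspace S'" "S' \<subseteq> S" "\<forall>x\<in>S'. (\<forall>i\<in>J. E i x = 0) \<longrightarrow> x = 0" for J S'
    using that
  proof (induction J arbitrary: S' rule: finite_induct)
    case empty
    then have "S' = {0}" using subspace_0 by auto
    then have "S' = span {}" by simp
    then show ?case by blast
  next
    case (insert j J)
    let ?K = "{x \<in> S'. E j x = 0}"
    have K: "subspace ?K"
      unfolding subspace_def using insert.prems(1,2)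
        linear_map_on_add[OF E[of j]] linear_map_on_scale[OF E[of j]] linear_map_on_zero[OF E[of j] S]
      by (auto simp: subspace_def subset_iff)
    have "\<exists>B. finite B \<and> ?K = span B"
      by (rule insert.IH[OF K]) (use insert.prems(2,3) in auto)
    then obtain B where B: "finite B" "?K = span B" by blast
    show ?case
    proof (cases "\<forall>x\<in>S'. E j x = 0")
      case True
      then have "?K = S'" by auto
      then show ?thesis using B by auto
    next
      case False
      then obtain s where s: "s \<in> S'" "E j s \<noteq> 0" by auto
      have "S' = span (insert s B)"
      proof
        show "span (insert s B) \<subseteq> S'"
          using s B(2) span_superset[of B] insert.prems(1) by (intro span_minimal) auto
        show "S' \<subseteq> span (insert s B)"
        proof
          fix x assume x: "x \<in> S'"
          let ?y = "(E j x / E j s) *\<^sub>R s"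
          have y: "?y \<in> S'" using insert.prems(1) s by (simp add: subspace_scale)
          have "E j (x - ?y) = 0"
            using linear_map_on_diff[OF E S subsetD[OF insert.prems(2) x] subsetD[OF insert.prems(2) y]]
              linear_map_on_scale[OF E subsetD[OF insert.prems(2) s(1)]] s(2) by simp
          then have "x - ?y \<in> span B" using B(2) subspace_diff[OF insert.prems(1) x y] by blast
          then show "x \<in> span (insert s B)" by (auto simp: span_insert)
        qed
      qed
      then show ?thesis using B(1) by blast
    qed
  qed
  note main = this[OF assms(3) S order_refl]
  show ?thesis
  proof (rule main, intro ballI impI)
    fix x assume x: "x \<in> S" "\<forall>i\<in>I. E i x = 0"
    have "\<Phi> x = 0"
    proof
      show "\<Phi> x i = 0 i" for i
        using x supp[OF x(1)] by (cases "i \<in> I") (auto simp: E_def)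
    qed
    with x show "x = 0" using inj by simp
  qed
qed

section \<open>Cofaces, codegeneracies and simplicial identities\<close>

lemma ordmaps_apply: "u \<in> ordmaps l k \<Longrightarrow> x \<le> l \<Longrightarrow> u x \<le> k"
  by (auto simp: ordmaps_def PiE_iff)

lemma ordmaps_mono: "u \<in> ordmaps l k \<Longrightarrow> x \<le> y \<Longrightarrow> y \<le> l \<Longrightarrow> u x \<le> u y"
  by (auto simp: ordmaps_def mono_on_def)

lemma ordmaps_undefined: "u \<in> ordmaps l k \<Longrightarrow> \<not> x \<le> l \<Longrightarrow> u x = undefined"
  by (auto simp: ordmaps_def PiE_def extensional_def)

lemma ordmapsI:
  assumes "\<And>x. x \<le> l \<Longrightarrow> u x \<le> k" "\<And>x y. x \<le> y \<Longrightarrow> y \<le> l \<Longrightarrow> u x \<le> u y"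
    "\<And>x. \<not> x \<le> l \<Longrightarrow> u x = undefined"
  shows "u \<in> ordmaps l k"
  using assms by (auto simp: ordmaps_def PiE_def extensional_def mono_on_def)

lemma ordmaps_eqI:
  assumes "u \<in> ordmaps l k" "w \<in> ordmaps l k'" "\<And>x. x \<le> l \<Longrightarrow> u x = w x"
  shows "u = w"
proof
  show "u x = w x" for x
    using assms by (cases "x \<le> l") (auto simp: ordmaps_undefined)
qed

lemma compose_apply: "compose {..j} q p x = (if x \<le> j then q (p x) else undefined)"
  by (simp add: compose_def)

lemma compose_ordmaps:
  assumes "p \<in> ordmaps j l" "q \<in> ordmaps l k"
  shows "compose {..j} q p \<in> ordmaps j k"
  using assms by (intro ordmapsI) (auto simp: compose_apply ordmaps_apply ordmaps_mono)

lemma compose_ordmaps_assoc: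
  assumes "p \<in> ordmaps j l"
  shows "compose {..j} (compose {..l} u q) p = compose {..j} u (compose {..j} q p)"
  using assms by (auto simp: fun_eq_iff compose_apply ordmaps_apply)

lemma ordid_ordmaps: "ordid k \<in> ordmaps k k"
  by (intro ordmapsI) (auto simp: ordid_def)

lemma compose_ordid_left: "u \<in> ordmaps l k \<Longrightarrow> compose {..l} (ordid k) u = u"
  by (auto simp: fun_eq_iff compose_apply ordid_def ordmaps_apply ordmaps_undefined)

lemma compose_ordid_right: "u \<in> ordmaps l k \<Longrightarrow> compose {..l} u (ordid l) = u"
  by (auto simp: fun_eq_iff compose_apply ordid_def ordmaps_undefined)

lemma coface_apply: "coface (Suc m) i x = (if x \<le> m then if x < i then x else Suc x else undefined)"
  by (simp add: coface_def)

lemma codegeneracy_apply: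
  "codegeneracy m j x = (if x \<le> Suc m then if x \<le> j then x else x - 1 else undefined)"
  by (simp add: codegeneracy_def)

lemma coface_ordmaps: "coface (Suc m) i \<in> ordmaps m (Suc m)"
  by (intro ordmapsI) (auto simp: coface_apply)

lemma codegeneracy_ordmaps: "j \<le> m \<Longrightarrow> codegeneracy m j \<in> ordmaps (Suc m) m"
  by (intro ordmapsI) (auto simp: codegeneracy_apply)

lemma const_ordmaps: "(\<lambda>j\<in>{..i}. 0) \<in> ordmaps i k"
  by (intro ordmapsI) auto

lemma ordmaps_0_const: "u \<in> ordmaps l 0 \<Longrightarrow> u = (\<lambda>j\<in>{..l}. 0)"
  by (rule ordmaps_eqI[OF _ const_ordmaps[of l 0]]) (auto dest: ordmaps_apply)

lemma coface_coface:
  assumes "i < j"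
  shows "compose {..m} (coface (Suc (Suc m)) j) (coface (Suc m) i) =
    compose {..m} (coface (Suc (Suc m)) i) (coface (Suc m) (j - 1))"
  using assms by (auto simp: fun_eq_iff compose_apply coface_apply)

lemma codegeneracy_coface_less:
  assumes "i < j" "j \<le> Suc m"
  shows "compose {..Suc m} (codegeneracy (Suc m) j) (coface (Suc (Suc m)) i) =
    compose {..Suc m} (coface (Suc m) i) (codegeneracy m (j - 1))"
  using assms by (auto simp: fun_eq_iff compose_apply coface_apply codegeneracy_apply)

lemma codegeneracy_coface_id:
  assumes "i = j \<or> i = Suc j"
  shows "compose {..m} (codegeneracy m j) (coface (Suc m) i) = ordid m"
  using assms by (auto simp: fun_eq_iff compose_apply coface_apply codegeneracy_apply ordid_def)

lemma codegeneracy_coface_greater: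
  assumes "Suc j < i" "i \<le> Suc (Suc m)"
  shows "compose {..Suc m} (codegeneracy (Suc m) j) (coface (Suc (Suc m)) i) =
    compose {..Suc m} (coface (Suc m) (i - 1)) (codegeneracy m j)"
  using assms by (auto simp: fun_eq_iff compose_apply coface_apply codegeneracy_apply)

lemma codegeneracy_codegeneracy:
  assumes "t \<le> j" "j \<le> m"
  shows "compose {..Suc (Suc m)} (codegeneracy m j) (codegeneracy (Suc m) t) =
    compose {..Suc (Suc m)} (codegeneracy m t) (codegeneracy (Suc m) (Suc j))"
  using assms by (auto simp: fun_eq_iff compose_apply codegeneracy_apply)

definition degeneracy :: "'a svec \<Rightarrow> nat \<Rightarrow> nat \<Rightarrow> 'a \<Rightarrow> 'a" where
  "degeneracy V m j = pull V m (Suc m) (codegeneracy m j)"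

definition alternating_bd :: "'a::real_vector svec \<Rightarrow> nat \<Rightarrow> 'a \<Rightarrow> 'a" where
  "alternating_bd V m x = (\<Sum>i\<le>m. (- 1) ^ i *\<^sub>R face V m i x)"

definition degen :: "'a::real_vector svec \<Rightarrow> nat \<Rightarrow> 'a set" where
  "degen V m = span {degeneracy V k j y |k j y. m = Suc k \<and> j \<le> k \<and> y \<in> lev V k}"

lemma subspace_degen: "subspace (degen V m)"
  by (simp add: degen_def)

lemma degeneracy_in_degen: "j \<le> k \<Longrightarrow> y \<in> lev V k \<Longrightarrow> degeneracy V k j y \<in> degen V (Suc k)"
  unfolding degen_def by (rule span_base) blast

lemma degen_0: "degen V 0 = {0}"
  by (simp add: degen_def)

context simplicial_vector_space
begin

lemma subspace_lev: "subspace (lev V k)"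
  using finite_dim[of k] by auto

lemma pull_mem: "q \<in> ordmaps l k \<Longrightarrow> v \<in> lev V k \<Longrightarrow> pull V k l q v \<in> lev V l"
  using linear_map_on_mem[OF pull_linear] .

lemma face_linear: "linear_map_on (lev V (Suc m)) (lev V m) (face V (Suc m) i)"
  using pull_linear[OF coface_ordmaps] by (simp add: face_def)

lemma degeneracy_linear: "j \<le> m \<Longrightarrow> linear_map_on (lev V m) (lev V (Suc m)) (degeneracy V m j)"
  using pull_linear[OF codegeneracy_ordmaps] by (simp add: degeneracy_def)

lemmas face_mem = linear_map_on_mem[OF face_linear]
lemmas degeneracy_mem = linear_map_on_mem[OF degeneracy_linear]
lemmas face_diff = linear_map_on_diff[OF face_linear subspace_lev]
lemmas face_add = linear_map_on_add[OF face_linear]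
lemmas face_zero = linear_map_on_zero[OF face_linear subspace_lev]
lemmas degeneracy_zero = linear_map_on_zero[OF degeneracy_linear subspace_lev]

lemma face_face:
  assumes "i < j" "v \<in> lev V (Suc (Suc m))"
  shows "face V (Suc m) i (face V (Suc (Suc m)) j v) = face V (Suc m) (j - 1) (face V (Suc (Suc m)) i v)"
  using pull_comp[OF coface_ordmaps coface_ordmaps assms(2), of j i, symmetric]
    pull_comp[OF coface_ordmaps coface_ordmaps assms(2), of i "j - 1", symmetric] coface_coface[OF assms(1), of m]
  by (simp add: face_def)

lemma face_degeneracy_less:
  assumes "i < j" "j \<le> Suc m" "v \<in> lev V (Suc m)"
  shows "face V (Suc (Suc m)) i (degeneracy V (Suc m) j v) = degeneracy V m (j - 1) (face V (Suc m) i v)"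
proof -
  have "j - 1 \<le> m" using assms by auto
  then show ?thesis
    using pull_comp[OF coface_ordmaps codegeneracy_ordmaps[OF assms(2)] assms(3), of i, symmetric]
      pull_comp[OF codegeneracy_ordmaps coface_ordmaps assms(3), of "j - 1" i, symmetric]
      codegeneracy_coface_less[OF assms(1,2)]
    by (simp add: face_def degeneracy_def)
qed

lemma face_degeneracy_id:
  assumes "i = j \<or> i = Suc j" "j \<le> m" "v \<in> lev V m"
  shows "face V (Suc m) i (degeneracy V m j v) = v"
  using pull_comp[OF coface_ordmaps codegeneracy_ordmaps[OF assms(2)] assms(3), of i, symmetric]
    codegeneracy_coface_id[OF assms(1), of m] pull_id[OF assms(3)]
  by (simp add: face_def degeneracy_def)

lemma face_degeneracy_greater:
  assumes "Suc j < i" "i \<le> Suc (Suc m)" "v \<in> lev V (Suc m)"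
  shows "face V (Suc (Suc m)) i (degeneracy V (Suc m) j v) = degeneracy V m j (face V (Suc m) (i - 1) v)"
proof -
  have "j \<le> Suc m" "j \<le> m" using assms by auto
  then show ?thesis
    using pull_comp[OF coface_ordmaps codegeneracy_ordmaps assms(3), of j i, symmetric]
      pull_comp[OF codegeneracy_ordmaps coface_ordmaps assms(3), of j "i - 1", symmetric]
      codegeneracy_coface_greater[OF assms(1,2)]
    by (simp add: face_def degeneracy_def)
qed

lemma degeneracy_degeneracy:
  assumes "t \<le> j" "j \<le> m" "v \<in> lev V m"
  shows "degeneracy V (Suc m) t (degeneracy V m j v) = degeneracy V (Suc m) (Suc j) (degeneracy V m t v)"
proof -
  have "t \<le> m" "t \<le> Suc m" "Suc j \<le> Suc m" using assms by auto
  then show ?thesis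
    using pull_comp[OF codegeneracy_ordmaps codegeneracy_ordmaps[OF assms(2)] assms(3), of t, symmetric]
      pull_comp[OF codegeneracy_ordmaps codegeneracy_ordmaps assms(3), of "Suc j" t, symmetric]
      codegeneracy_codegeneracy[OF assms(1,2)]
    by (simp add: degeneracy_def)
qed

lemma alternating_bd_linear:
  "linear_map_on (lev V (Suc m)) (lev V m) (alternating_bd V (Suc m))"
  unfolding alternating_bd_def
  by (intro linear_map_on_sum_fun linear_map_on_scale_fun subspace_lev face_linear)

lemma alternating_bd_alternating_bd:
  assumes v: "v \<in> lev V (Suc (Suc m))"
  shows "alternating_bd V (Suc m) (alternating_bd V (Suc (Suc m)) v) = 0"
proof -
  let ?F = "\<lambda>i j. (- 1) ^ (i + j) *\<^sub>R face V (Suc m) i (face V (Suc (Suc m)) j v)"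
  let ?A = "{(i, j). i \<le> Suc m \<and> j \<le> Suc (Suc m) \<and> i < j}"
  let ?B = "{(i, j). i \<le> Suc m \<and> j \<le> Suc (Suc m) \<and> j \<le> i}"
  have fin: "finite ?A" "finite ?B"
    by (rule finite_subset[of _ "{..Suc m} \<times> {..Suc (Suc m)}"]; auto)+
  have "alternating_bd V (Suc m) (alternating_bd V (Suc (Suc m)) v) =
      (\<Sum>i\<le>Suc m. \<Sum>j\<le>Suc (Suc m). ?F i j)"
    unfolding alternating_bd_def[of V "Suc m"]
  proof (rule sum.cong[OF refl])
    fix i
    have "face V (Suc m) i (alternating_bd V (Suc (Suc m)) v) =
        (\<Sum>j\<le>Suc (Suc m). (- 1) ^ j *\<^sub>R face V (Suc m) i (face V (Suc (Suc m)) j v))"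
      unfolding alternating_bd_def
      using face_mem[OF v] linear_map_on_scale[OF face_linear face_mem[OF v]]
      by (subst linear_map_on_sum[OF face_linear subspace_lev]) (auto intro: subspace_scale[OF subspace_lev])
    then show "(- 1) ^ i *\<^sub>R face V (Suc m) i (alternating_bd V (Suc (Suc m)) v) = (\<Sum>j\<le>Suc (Suc m). ?F i j)"
      by (simp add: scaleR_sum_right power_add del: sum.atMost_Suc)
  qed
  also have "\<dots> = (\<Sum>(i, j)\<in>{..Suc m} \<times> {..Suc (Suc m)}. ?F i j)"
    by (rule sum.cartesian_product)
  also have "{..Suc m} \<times> {..Suc (Suc m)} = ?A \<union> ?B"
    by auto
  also have "(\<Sum>(i, j)\<in>?A \<union> ?B. ?F i j) = (\<Sum>(i, j)\<in>?A. ?F i j) + (\<Sum>(i, j)\<in>?B. ?F i j)"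
    by (rule sum.union_disjoint[OF fin]) auto
  also have "(\<Sum>(i, j)\<in>?A. ?F i j) = (\<Sum>(i, j)\<in>?B. - ?F i j)"
  proof (rule sum.reindex_bij_witness[where j = "\<lambda>(i, j). (j - 1, i)" and i = "\<lambda>(i, j). (j, Suc i)"])
    fix a assume "a \<in> ?A"
    then obtain i j where a: "a = (i, j)" "i < j" "j \<le> Suc (Suc m)" by auto
    have "(- 1) ^ (i + j) = - ((- 1) ^ (j - 1 + i) :: real)"
      using a(2) by (cases j) (auto simp: add.commute)
    then show "(case case a of (i, j) \<Rightarrow> (j - 1, i) of (i, j) \<Rightarrow> - ?F i j) = (case a of (i, j) \<Rightarrow> ?F i j)"
      using face_face[OF a(2) v] a by simp
  qed auto
  finally show ?thesis by (simp add: case_prod_unfold sum_negf)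
qed

lemma degen_subset: "degen V m \<subseteq> lev V m"
  unfolding degen_def using degeneracy_mem by (intro span_minimal subspace_lev) auto

lemma alternating_bd_degeneracy:
  assumes y: "y \<in> lev V k" and j: "j \<le> k"
  shows "alternating_bd V (Suc k) (degeneracy V k j y) \<in> degen V k"
proof -
  let ?f = "\<lambda>i. (- 1) ^ i *\<^sub>R face V (Suc k) i (degeneracy V k j y)"
  have "(\<Sum>i\<in>{j, Suc j}. ?f i) = 0"
    using face_degeneracy_id[OF _ j y] by simp
  moreover have "{..Suc k} = ({..Suc k} - {j, Suc j}) \<union> {j, Suc j}" using j by auto
  then have "alternating_bd V (Suc k) (degeneracy V k j y) = (\<Sum>i\<in>{..Suc k} - {j, Suc j}. ?f i) + (\<Sum>i\<in>{j, Suc j}. ?f i)"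
    unfolding alternating_bd_def using sum.union_disjoint[of "{..Suc k} - {j, Suc j}" "{j, Suc j}" ?f] by auto
  moreover have "?f i \<in> degen V k" if i: "i \<in> {..Suc k} - {j, Suc j}" for i
  proof -
    obtain k' where k': "k = Suc k'" using i j by (cases k) auto
    have "face V (Suc k) i (degeneracy V k j y) \<in> degen V k"
    proof (cases "i < j")
      case True
      then show ?thesis
        using face_degeneracy_less[of i j k' y] degeneracy_in_degen[of "j - 1" k' "face V k i y" V] face_mem j y k'
        by auto
    next
      case False
      then show ?thesis
        using face_degeneracy_greater[of j i k' y] degeneracy_in_degen[of j k' "face V k (i - 1) y" V] face_mem j y k' i
        by auto
    qed
    then show ?thesis by (rule subspace_scale[OF subspace_degen])
  qed
  ultimately show ?thesis by (auto intro: subspace_sum[OF subspace_degen])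
qed

lemma alternating_bd_degen:
  assumes "x \<in> degen V (Suc m)"
  shows "alternating_bd V (Suc m) x \<in> degen V m"
  by (rule linear_map_on_span_subset[OF alternating_bd_linear subspace_lev subspace_degen _ _
        assms[unfolded degen_def]])
    (auto intro: degeneracy_mem alternating_bd_degeneracy)

text \<open>Replacing \<open>z\<close> by \<open>z - s\<^sub>r d\<^sub>r z\<close> kills the \<open>r\<close>-th face and keeps the lower faces zero; this is done for
  \<open>r = 0, 1, \<dots>, m - 1\<close>.\<close>

lemma normalized_complement:
  assumes x: "x \<in> lev V m"
  shows "\<exists>z\<in>normalized V m. x - z \<in> degen V m"
proof -
  have "\<exists>z\<in>lev V m. (\<forall>i<r. face V m i z = 0) \<and> x - z \<in> degen V m" if "r \<le> m" for r
    using that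
  proof (induction r)
    case 0
    have "x - x \<in> degen V m" using subspace_0[OF subspace_degen, of V m] by simp
    then show ?case using x by blast
  next
    case (Suc r)
    then obtain k where k: "m = Suc k" by (cases m) auto
    obtain z where z: "z \<in> lev V m" "\<forall>i<r. face V m i z = 0" "x - z \<in> degen V m"
      using Suc by auto
    define w where "w = degeneracy V k r (face V m r z)"
    have r: "r \<le> k" using Suc.prems k by simp
    have fz: "face V m r z \<in> lev V k" using face_mem z(1) k by simp
    have w: "w \<in> lev V m" "w \<in> degen V m"
      using k unfolding w_def using degeneracy_mem[OF r fz] degeneracy_in_degen[OF r fz] by auto
    have "face V m i (z - w) = 0" if "i < Suc r" for i
    proof (cases "i = r")
      case True
      then show ?thesis
        using face_diff[of z k w i] z(1) w(1) k face_degeneracy_id[OF _ r fz, of i] by (simp add: w_def)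
    next
      case False
      then have i: "i < r" using that by simp
      then obtain k' where k': "k = Suc k'" using r by (cases k) auto
      have "face V m i w = degeneracy V k' (r - 1) (face V k i (face V m r z))"
        unfolding w_def k k' using face_degeneracy_less[of i r k' "face V m r z"] i r fz k k' by simp
      also have "face V k i (face V m r z) = face V k (r - 1) (face V m i z)"
        using face_face[OF i, of z k'] z(1) k k' by simp
      also have "\<dots> = 0" using z(2) i face_zero k' by simp
      finally have "face V m i w = 0" using degeneracy_zero[of "r - 1" k'] r k' by simp
      then show ?thesis using face_diff[of z k w i] z(1,2) w(1) k i by simp
    qed
    moreover have "x - (z - w) \<in> degen V m"
      using subspace_add[OF subspace_degen z(3) w(2)] by (simp add: algebra_simps)
    ultimately show ?case using subspace_diff[OF subspace_lev z(1) w(1)] by blast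
  qed
  from this[of m] show ?thesis by (auto simp: normalized_def)
qed

text \<open>If \<open>x\<close> is a sum of terms \<open>s\<^sub>j y\<^sub>j\<close> with \<open>j \<ge> r\<close>, then \<open>d\<^sub>r x = 0\<close> expresses \<open>y\<^sub>r\<close> through the terms
  \<open>s\<^sub>j\<^sub>-\<^sub>1 d\<^sub>r y\<^sub>j\<close> with \<open>j > r\<close>, and \<open>s\<^sub>r s\<^sub>j\<^sub>-\<^sub>1 = s\<^sub>j s\<^sub>r\<close> turns \<open>x\<close> into a sum of such terms with
  \<open>j > r\<close>. At \<open>r = m\<close> nothing is left.\<close>

lemma normalized_degen_zero:
  assumes x: "x \<in> normalized V m" "x \<in> degen V m"
  shows "x = 0"
proof (cases m)
  case 0
  then show ?thesis using x degen_0 by auto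
next
  case (Suc k)
  have xm: "x \<in> lev V (Suc k)" "\<And>i. i \<le> k \<Longrightarrow> face V (Suc k) i x = 0"
    using x(1) Suc by (auto simp: normalized_def)
  have "\<exists>y. (\<forall>j. y j \<in> lev V k) \<and> x = (\<Sum>j\<in>{r..k}. degeneracy V k j (y j))" if "r \<le> Suc k" for r
    using that
  proof (induction r)
    case 0
    define S where "S = {w. \<exists>y. (\<forall>j. y j \<in> lev V k) \<and> w = (\<Sum>j\<in>{0..k}. degeneracy V k j (y j))}"
    have "subspace S"
      unfolding subspace_def
    proof (intro conjI ballI allI)
      show "0 \<in> S" unfolding S_def
        by (auto intro!: exI[of _ "\<lambda>_. 0"] simp: subspace_0[OF subspace_lev] degeneracy_zero)
    next
      fix a b assume "a \<in> S" "b \<in> S"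
      then obtain y z where "\<forall>j. y j \<in> lev V k" "a = (\<Sum>j\<in>{0..k}. degeneracy V k j (y j))"
        "\<forall>j. z j \<in> lev V k" "b = (\<Sum>j\<in>{0..k}. degeneracy V k j (z j))" by (auto simp: S_def)
      then show "a + b \<in> S" unfolding S_def
        by (auto intro!: exI[of _ "\<lambda>j. y j + z j"] subspace_add[OF subspace_lev] sum.cong
            simp: sum.distrib[symmetric] linear_map_on_add[OF degeneracy_linear])
    next
      fix c a assume "a \<in> S"
      then obtain y where "\<forall>j. y j \<in> lev V k" "a = (\<Sum>j\<in>{0..k}. degeneracy V k j (y j))"
        by (auto simp: S_def)
      then show "c *\<^sub>R a \<in> S" unfolding S_def
        by (auto intro!: exI[of _ "\<lambda>j. c *\<^sub>R y j"] subspace_scale[OF subspace_lev] sum.cong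
            simp: scaleR_sum_right linear_map_on_scale[OF degeneracy_linear])
    qed
    moreover have "degeneracy V k j y \<in> S" if "j \<le> k" "y \<in> lev V k" for j y
    proof -
      have "degeneracy V k j y = (\<Sum>i\<in>{0..k}. if i = j then degeneracy V k j y else 0)"
        using that by simp
      also have "\<dots> = (\<Sum>i\<in>{0..k}. degeneracy V k i (if i = j then y else 0))"
        using degeneracy_zero by (intro sum.cong) auto
      finally show ?thesis unfolding S_def
        using that subspace_0[OF subspace_lev] by (auto intro!: exI[of _ "\<lambda>i. if i = j then y else 0"])
    qed
    ultimately have "degen V m \<subseteq> S"
      unfolding degen_def using Suc by (intro span_minimal) auto
    then show ?case using x(2) by (auto simp: S_def)
  next
    case (Suc r)
    then have r: "r \<le> k" by simp
    obtain y where y: "\<forall>j. y j \<in> lev V k" "x = (\<Sum>j\<in>{r..k}. degeneracy V k j (y j))"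
      using Suc by auto
    define z where "z j = degeneracy V (k - 1) r (face V k r (y j))" for j
    have z: "z j \<in> lev V k \<and> face V (Suc k) r (degeneracy V k j (y j)) = degeneracy V (k - 1) (j - 1) (face V k r (y j)) \<and>
        degeneracy V k r (degeneracy V (k - 1) (j - 1) (face V k r (y j))) = degeneracy V k j (z j)"
      if j: "j \<in> {Suc r..k}" for j
    proof -
      obtain k' where k': "k = Suc k'" using j by (cases k) auto
      have f: "face V k r (y j) \<in> lev V k'" using face_mem y(1) k' by simp
      show ?thesis
        using face_degeneracy_less[of r j k' "y j"] degeneracy_degeneracy[OF _ _ f, of r "j - 1"]
          degeneracy_mem[OF _ f, of r] y(1) j k' by (auto simp: z_def)
    qed
    have split: "{r..k} = insert r {Suc r..k}" using r by auto
    have x': "x = degeneracy V k r (y r) + (\<Sum>j\<in>{Suc r..k}. degeneracy V k j (y j))"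
      unfolding y(2) split by simp
    have d: "degeneracy V k j (y j) \<in> lev V (Suc k)" if "j \<le> k" for j
      using degeneracy_mem[OF that] y(1) by auto
    have s: "(\<Sum>j\<in>{Suc r..k}. degeneracy V k j (y j)) \<in> lev V (Suc k)"
      by (rule subspace_sum[OF subspace_lev]) (use d in auto)
    have fs: "face V (Suc k) r (\<Sum>j\<in>{Suc r..k}. degeneracy V k j (y j)) =
        (\<Sum>j\<in>{Suc r..k}. face V (Suc k) r (degeneracy V k j (y j)))"
      by (rule linear_map_on_sum[OF face_linear subspace_lev]) (use d in auto)
    have "0 = face V (Suc k) r x" using xm(2) r by simp
    also have "\<dots> = y r + (\<Sum>j\<in>{Suc r..k}. face V (Suc k) r (degeneracy V k j (y j)))"
      unfolding x' using face_add[OF d[OF r] s] fs face_degeneracy_id[of r r k "y r"] r y(1) by simp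
    also have "\<dots> = y r + (\<Sum>j\<in>{Suc r..k}. degeneracy V (k - 1) (j - 1) (face V k r (y j)))"
      using z by auto
    finally have yr: "y r = - (\<Sum>j\<in>{Suc r..k}. degeneracy V (k - 1) (j - 1) (face V k r (y j)))"
      by (simp add: eq_neg_iff_add_eq_0)
    have mem: "degeneracy V (k - 1) (j - 1) (face V k r (y j)) \<in> lev V k" if "j \<in> {Suc r..k}" for j
      using z[OF that] face_mem[OF d] that by (metis atLeastAtMost_iff)
    have "degeneracy V k r (y r) = - (\<Sum>j\<in>{Suc r..k}. degeneracy V k r (degeneracy V (k - 1) (j - 1) (face V k r (y j))))"
    proof -
      have "(\<Sum>j\<in>{Suc r..k}. degeneracy V (k - 1) (j - 1) (face V k r (y j))) \<in> lev V k"
        by (rule subspace_sum[OF subspace_lev mem])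
      moreover have "degeneracy V k r (\<Sum>j\<in>{Suc r..k}. degeneracy V (k - 1) (j - 1) (face V k r (y j))) =
          (\<Sum>j\<in>{Suc r..k}. degeneracy V k r (degeneracy V (k - 1) (j - 1) (face V k r (y j))))"
        by (rule linear_map_on_sum[OF degeneracy_linear[OF r] subspace_lev mem])
      ultimately show ?thesis
        unfolding yr using linear_map_on_neg[OF degeneracy_linear[OF r] subspace_lev] by simp
    qed
    also have "\<dots> = - (\<Sum>j\<in>{Suc r..k}. degeneracy V k j (z j))"
      using z by simp
    finally have "x = (\<Sum>j\<in>{Suc r..k}. degeneracy V k j (y j) - degeneracy V k j (z j))"
      unfolding x' by (simp add: sum_subtractf)
    also have "\<dots> = (\<Sum>j\<in>{Suc r..k}. degeneracy V k j (if j \<in> {Suc r..k} then y j - z j else 0))"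
      using linear_map_on_diff[OF degeneracy_linear subspace_lev] y(1) z by (intro sum.cong) auto
    finally show ?case
      using y(1) z subspace_diff[OF subspace_lev] subspace_0[OF subspace_lev]
      by (intro exI[of _ "\<lambda>j. if j \<in> {Suc r..k} then y j - z j else 0"]) auto
  qed
  from this[of "Suc k"] show ?thesis by auto
qed

lemma normalized_subset: "normalized V m \<subseteq> lev V m"
  by (auto simp: normalized_def)

lemma cycles_subset: "cycles V m \<subseteq> normalized V m"
  by (auto simp: cycles_def)

lemma alternating_bd_normalized:
  assumes "v \<in> normalized V m"
  shows "alternating_bd V m v = differential V m v"
proof -
  have "alternating_bd V m v = (\<Sum>i\<le>m. if i = m then differential V m v else 0)"
    unfolding alternating_bd_def differential_def
    using assms by (intro sum.cong) (auto simp: normalized_def)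
  then show ?thesis by simp
qed

lemma subspace_normalized: "subspace (normalized V m)"
proof (cases m)
  case 0
  then show ?thesis using subspace_lev[of 0] by (simp add: normalized_def)
next
  case (Suc k)
  show ?thesis
    unfolding subspace_def normalized_def Suc
    using subspace_0[OF subspace_lev] subspace_add[OF subspace_lev] subspace_scale[OF subspace_lev]
      face_zero face_add linear_map_on_scale[OF face_linear]
    by auto
qed

lemma differential_linear:
  "linear_map_on (normalized V (Suc m)) (normalized V m) (differential V (Suc m))"
proof (rule linear_map_on_subset)
  show "linear_map_on (lev V (Suc m)) (lev V m) (differential V (Suc m))"
    unfolding differential_def by (intro linear_map_on_scale_fun subspace_lev face_linear)
  show "normalized V (Suc m) \<subseteq> lev V (Suc m)" by (rule normalized_subset)
  fix v assume v: "v \<in> normalized V (Suc m)"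
  then have vl: "v \<in> lev V (Suc m)" by (simp add: normalized_def)
  have "face V m i (face V (Suc m) (Suc m) v) = 0" if im: "i < m" for i
  proof -
    obtain k where "m = Suc k" using im by (cases m) auto
    then show ?thesis
      using face_face[of i "Suc m" v k] im v vl face_zero[of k m] by (auto simp: normalized_def)
  qed
  then have "face V (Suc m) (Suc m) v \<in> normalized V m"
    using face_mem[OF vl] by (simp add: normalized_def)
  then show "differential V (Suc m) v \<in> normalized V m"
    unfolding differential_def by (rule subspace_scale[OF subspace_normalized])
qed

lemma subspace_boundaries: "subspace (boundaries V m)"
  unfolding subspace_def boundaries_def
proof (intro conjI ballI allI)
  show "0 \<in> differential V (Suc m) ` normalized V (Suc m)"
    using linear_map_on_zero[OF differential_linear subspace_normalized] subspace_0[OF subspace_normalized]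
    by (metis imageI)
next
  fix a b assume "a \<in> differential V (Suc m) ` normalized V (Suc m)" "b \<in> differential V (Suc m) ` normalized V (Suc m)"
  then show "a + b \<in> differential V (Suc m) ` normalized V (Suc m)"
    using linear_map_on_add[OF differential_linear] subspace_add[OF subspace_normalized] by (auto simp: image_iff) metis
next
  fix c a assume "a \<in> differential V (Suc m) ` normalized V (Suc m)"
  then show "c *\<^sub>R a \<in> differential V (Suc m) ` normalized V (Suc m)"
    using linear_map_on_scale[OF differential_linear] subspace_scale[OF subspace_normalized] by (auto simp: image_iff) metis
qed

lemma differential_differential:
  assumes "v \<in> normalized V (Suc (Suc m))"
  shows "differential V (Suc m) (differential V (Suc (Suc m)) v) = 0"
  using alternating_bd_alternating_bd[of v m] alternating_bd_normalized[OF assms]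
    alternating_bd_normalized[OF linear_map_on_mem[OF differential_linear assms]] assms normalized_subset by auto

lemma boundaries_subset: "boundaries V m \<subseteq> cycles V m"
proof
  fix x assume "x \<in> boundaries V m"
  then obtain v where v: "v \<in> normalized V (Suc m)" "x = differential V (Suc m) v" by (auto simp: boundaries_def)
  then show "x \<in> cycles V m"
    using linear_map_on_mem[OF differential_linear v(1)] differential_differential
    by (cases m) (auto simp: cycles_def)
qed

lemma subspace_cycles: "subspace (cycles V m)"
proof (cases m)
  case 0
  then show ?thesis using subspace_normalized by (simp add: cycles_def)
next
  case (Suc k)
  show ?thesis
    unfolding subspace_def cycles_def Suc
    using subspace_0[OF subspace_normalized] subspace_add[OF subspace_normalized] subspace_scale[OF subspace_normalized]
      linear_map_on_zero[OF differential_linear subspace_normalized] linear_map_on_add[OF differential_linear]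
      linear_map_on_scale[OF differential_linear]
    by auto
qed

lemma cycles_iff: "v \<in> cycles V m \<longleftrightarrow> v \<in> lev V m \<and> (m > 0 \<longrightarrow> (\<forall>i\<le>m. face V m i v = 0))"
  by (auto simp: cycles_def normalized_def differential_def order.order_iff_strict)

end

section \<open>Weak equivalences of simplicial vector spaces\<close>

context simplicial_vector_space
begin

lemma basepoint_mem: "x \<in> lev V 0 \<Longrightarrow> basepoint V i x \<in> lev V i"
  unfolding basepoint_def by (rule pull_mem[OF const_ordmaps])

lemma pull_basepoint:
  assumes "x \<in> lev V 0" "q \<in> ordmaps l k"
  shows "pull V k l q (basepoint V k x) = basepoint V l x"
proof -
  have "compose {..l} (\<lambda>j\<in>{..k}. 0) q = (\<lambda>j\<in>{..l}. 0)"
    using assms(2) by (auto simp: fun_eq_iff compose_apply ordmaps_apply)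
  then show ?thesis
    unfolding basepoint_def using pull_comp[OF assms(2) const_ordmaps assms(1)] by metis
qed

lemma face_basepoint: "x \<in> lev V 0 \<Longrightarrow> face V (Suc m) j (basepoint V (Suc m) x) = basepoint V m x"
  using pull_basepoint[OF _ coface_ordmaps] by (simp add: face_def)

lemma degeneracy_basepoint:
  "x \<in> lev V 0 \<Longrightarrow> j \<le> m \<Longrightarrow> degeneracy V m j (basepoint V m x) = basepoint V (Suc m) x"
  using pull_basepoint[OF _ codegeneracy_ordmaps] by (simp add: degeneracy_def)

lemma spheres_iff:
  assumes x: "x \<in> lev V 0"
  shows "a \<in> spheres V i x \<longleftrightarrow> a \<in> lev V i \<and> a - basepoint V i x \<in> cycles V i"
proof (cases i)
  case 0
  then show ?thesis
    using basepoint_mem[OF x, of 0] subspace_diff[OF subspace_lev] by (auto simp: spheres_def cycles_iff)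
next
  case (Suc k)
  show ?thesis
    using basepoint_mem[OF x, of i] face_diff[of a k "basepoint V i x"] face_basepoint[OF x, of k]
      subspace_diff[OF subspace_lev, of a i "basepoint V i x"]
    by (auto simp: spheres_def cycles_iff Suc)
qed

lemma boundaries_iff:
  "e \<in> boundaries V i \<longleftrightarrow> (\<exists>y\<in>lev V (Suc i). (\<forall>j\<le>i. face V (Suc i) j y = 0) \<and> face V (Suc i) (Suc i) y = e)"
  (is "?L \<longleftrightarrow> ?R")
proof
  assume ?L
  then obtain y where y: "y \<in> normalized V (Suc i)" "e = (- 1) ^ Suc i *\<^sub>R face V (Suc i) (Suc i) y"
    by (auto simp: boundaries_def differential_def)
  then show ?R
    using subspace_scale[OF subspace_normalized y(1), of "(- 1) ^ Suc i"]
      linear_map_on_scale[OF face_linear, of y i "Suc i" "(- 1) ^ Suc i"]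
    by (intro bexI[of _ "(- 1) ^ Suc i *\<^sub>R y"]) (auto simp: normalized_def less_Suc_eq_le)
next
  assume ?R
  then obtain y where y: "y \<in> normalized V (Suc i)" "face V (Suc i) (Suc i) y = e"
    by (auto simp: normalized_def less_Suc_eq_le)
  then have "differential V (Suc i) y = (- 1) ^ Suc i *\<^sub>R e" by (simp add: differential_def)
  then have "(- 1) ^ Suc i *\<^sub>R e \<in> boundaries V i" using y(1) by (metis boundaries_def imageI)
  from subspace_scale[OF subspace_boundaries this, of "(- 1) ^ Suc i"] show ?L by simp
qed

text \<open>Subtracting the degenerate simplex \<open>s\<^sub>i a\<close> from a homotopy leaves a simplex whose only nonzero face is the last
  one, and this face is \<open>b - a\<close>.\<close>

lemma homotopic_iff:
  assumes x: "x \<in> lev V 0"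
  shows "(a, b) \<in> homotopic V i x \<longleftrightarrow> a \<in> spheres V i x \<and> b \<in> spheres V i x \<and> a - b \<in> boundaries V i"
proof (cases "a \<in> spheres V i x")
  case True
  have a: "a \<in> lev V i" "degeneracy V i i a \<in> lev V (Suc i)"
    using True degeneracy_mem[of i i a] by (auto simp: spheres_def)
  have low: "face V (Suc i) j (degeneracy V i i a) = basepoint V i x" if j: "j < i" for j
  proof -
    obtain k where k: "i = Suc k" using j by (cases i) auto
    have "face V (Suc i) j (degeneracy V i i a) = degeneracy V k k (face V i j a)"
      using face_degeneracy_less[of j i k a] j k a by simp
    also have "face V i j a = basepoint V k x" using True j k by (simp add: spheres_def)
    finally show ?thesis using degeneracy_basepoint[OF x, of k k] k by simp
  qed
  have high: "face V (Suc i) i (degeneracy V i i a) = a" "face V (Suc i) (Suc i) (degeneracy V i i a) = a"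
    using face_degeneracy_id[OF _ _ a(1), of _ i] by auto
  have "(\<exists>h\<in>lev V (Suc i). (\<forall>j<i. face V (Suc i) j h = basepoint V i x) \<and>
        face V (Suc i) i h = a \<and> face V (Suc i) (Suc i) h = b) \<longleftrightarrow> b - a \<in> boundaries V i" (is "?H \<longleftrightarrow> _")
  proof
    assume ?H
    then obtain h where h: "h \<in> lev V (Suc i)" "\<forall>j<i. face V (Suc i) j h = basepoint V i x"
      "face V (Suc i) i h = a" "face V (Suc i) (Suc i) h = b" by blast
    show "b - a \<in> boundaries V i"
      unfolding boundaries_iff
      using h low high face_diff[OF h(1) a(2)] subspace_diff[OF subspace_lev h(1) a(2)]
      by (intro bexI[of _ "h - degeneracy V i i a"]) (auto simp: order.order_iff_strict)
  next
    assume "b - a \<in> boundaries V i"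
    then obtain y where y: "y \<in> lev V (Suc i)" "\<forall>j\<le>i. face V (Suc i) j y = 0" "face V (Suc i) (Suc i) y = b - a"
      unfolding boundaries_iff by blast
    then show ?H
      using low high face_add[OF y(1) a(2)] subspace_add[OF subspace_lev y(1) a(2)]
      by (intro bexI[of _ "y + degeneracy V i i a"]) auto
  qed
  moreover have "b - a \<in> boundaries V i \<longleftrightarrow> a - b \<in> boundaries V i"
    using subspace_neg[OF subspace_boundaries, of "a - b" i] subspace_neg[OF subspace_boundaries, of "b - a" i] by auto
  ultimately show ?thesis by (simp add: homotopic_def)
qed (simp add: homotopic_def)

lemma equiv_homotopic:
  assumes x: "x \<in> lev V 0"
  shows "equiv (spheres V i x) (homotopic V i x)"
proof (rule equivI)
  show "homotopic V i x \<subseteq> spheres V i x \<times> spheres V i x"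
    by (auto simp: homotopic_def)
  show "refl_on (spheres V i x) (homotopic V i x)"
    using subspace_0[OF subspace_boundaries] by (auto simp: refl_on_def homotopic_iff[OF x])
  show "sym (homotopic V i x)"
    using subspace_neg[OF subspace_boundaries] by (auto simp: sym_def homotopic_iff[OF x]) (metis minus_diff_eq)
  show "trans (homotopic V i x)"
    using subspace_add[OF subspace_boundaries] by (auto simp: trans_def homotopic_iff[OF x]) (metis diff_add_cancel add_diff_eq)
qed

text \<open>Subtracting \<open>s\<^sub>i d\<^sub>i y\<close> from \<open>y\<close> moves the nonzero face to the last position.\<close>

lemma boundary_of_middle_face:
  assumes y: "y \<in> lev V (Suc i)" "\<And>j. j < i \<Longrightarrow> face V (Suc i) j y = 0" "face V (Suc i) (Suc i) y = 0"
  shows "face V (Suc i) i y \<in> boundaries V i"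
proof -
  let ?e = "face V (Suc i) i y"
  have e: "?e \<in> lev V i" "degeneracy V i i ?e \<in> lev V (Suc i)"
    using face_mem[OF y(1)] degeneracy_mem[of i i ?e] by auto
  have low: "face V (Suc i) j (degeneracy V i i ?e) = 0" if j: "j < i" for j
  proof -
    obtain k where k: "i = Suc k" using j by (cases i) auto
    have "face V (Suc i) j (degeneracy V i i ?e) = degeneracy V k k (face V i j ?e)"
      using face_degeneracy_less[of j i k ?e] j k e by simp
    also have "face V i j ?e = face V i (i - 1) (face V (Suc i) j y)"
      using face_face[of j i y k] j k y(1) by simp
    finally show ?thesis using y(2)[OF j] face_zero degeneracy_zero[of k k] k by simp
  qed
  have "- ?e \<in> boundaries V i"
    unfolding boundaries_iff
    using y low face_degeneracy_id[OF _ _ e(1), of _ i] face_diff[OF y(1) e(2)] subspace_diff[OF subspace_lev y(1) e(2)]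
    by (intro bexI[of _ "y - degeneracy V i i ?e"]) (auto simp: order.order_iff_strict)
  from subspace_neg[OF subspace_boundaries this] show ?thesis by simp
qed

text \<open>The simplex \<open>s\<^sub>i\<^sub>-\<^sub>1 a + s\<^sub>i b - p\<close>, where \<open>p\<close> is the base point, has \<open>a\<close> and \<open>b\<close> as its outer faces and
  \<open>a + b - p\<close> between them; the middle faces of two simplices that agree in all other faces differ by a boundary.\<close>

lemma mult_homotopy_group:
  assumes x: "x \<in> lev V 0" and i: "i \<ge> 1" and a: "a \<in> spheres V i x" and b: "b \<in> spheres V i x"
  shows "homotopic V i x `` {a} \<otimes>\<^bsub>homotopy_group V i x\<^esub> homotopic V i x `` {b} =
    homotopic V i x `` {a + b - basepoint V i x}" (is "?M = _")
    and "a + b - basepoint V i x \<in> spheres V i x"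
proof -
  obtain k where k: "i = Suc k" using i by (cases i) auto
  let ?p = "basepoint V i x" and ?P = "basepoint V (Suc i) x"
  define w0 where "w0 a b = degeneracy V i k a + degeneracy V i i b - ?P" for a b
  have sp: "a \<in> lev V i \<and> (\<forall>j\<le>i. face V i j a = basepoint V k x)" if "a \<in> spheres V i x" for a
    using that k by (simp add: spheres_def)
  have w0: "w0 a b \<in> lev V (Suc i) \<and> (\<forall>j<k. face V (Suc i) j (w0 a b) = ?p) \<and> face V (Suc i) k (w0 a b) = a \<and>
     face V (Suc i) i (w0 a b) = a + b - ?p \<and> face V (Suc i) (Suc i) (w0 a b) = b"
    if a: "a \<in> spheres V i x" and b: "b \<in> spheres V i x" for a b
  proof -
    have mem: "degeneracy V i k a \<in> lev V (Suc i)" "degeneracy V i i b \<in> lev V (Suc i)" "?P \<in> lev V (Suc i)"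
      "degeneracy V i k a + degeneracy V i i b \<in> lev V (Suc i)"
      using degeneracy_mem[of _ i] sp[OF a] sp[OF b] basepoint_mem[OF x] k subspace_add[OF subspace_lev] by auto
    have "w0 a b \<in> lev V (Suc i)" unfolding w0_def using mem subspace_diff[OF subspace_lev] by blast
    moreover have f: "face V (Suc i) j (w0 a b) =
        face V (Suc i) j (degeneracy V i k a) + face V (Suc i) j (degeneracy V i i b) - ?p" for j
      unfolding w0_def using face_diff[OF mem(4,3)] face_add[OF mem(1,2)] face_basepoint[OF x] by simp
    have dp: "degeneracy V k j (basepoint V k x) = ?p" if "j \<le> k" for j
      using degeneracy_basepoint[OF x that] k by simp
    have "face V (Suc i) j (degeneracy V i i b) = ?p" if "j < i" for j
      using face_degeneracy_less[of j i k b] that sp[OF b] dp k by simp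
    moreover have "face V (Suc i) j (degeneracy V i k a) = ?p" if "j < k" for j
      using face_degeneracy_less[of j k k a] that sp[OF a] dp[of "k - 1"] k by simp
    moreover have "face V (Suc i) (Suc i) (degeneracy V i k a) = ?p"
      using face_degeneracy_greater[of k "Suc i" k a] sp[OF a] dp k by simp
    moreover have "face V (Suc i) k (degeneracy V i k a) = a" "face V (Suc i) i (degeneracy V i k a) = a"
      using face_degeneracy_id[of _ k i a] sp[OF a] k by auto
    moreover have "face V (Suc i) i (degeneracy V i i b) = b" "face V (Suc i) (Suc i) (degeneracy V i i b) = b"
      using face_degeneracy_id[of _ i i b] sp[OF b] by auto
    ultimately show ?thesis unfolding f using k by simp
  qed
  have sphere: "a + b - ?p \<in> spheres V i x" if "a \<in> spheres V i x" "b \<in> spheres V i x" for a b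
  proof -
    have "a + b - ?p \<in> lev V i"
      using sp[OF that(1)] sp[OF that(2)] basepoint_mem[OF x] subspace_add[OF subspace_lev] subspace_diff[OF subspace_lev] by auto
    moreover have "(a - ?p) + (b - ?p) \<in> cycles V i"
      using that subspace_add[OF subspace_cycles] by (auto simp: spheres_iff[OF x])
    ultimately show ?thesis by (simp add: spheres_iff[OF x] algebra_simps)
  qed
  show "a + b - ?p \<in> spheres V i x" using sphere a b by simp
  show "?M = homotopic V i x `` {a + b - ?p}"
  proof (intro equalityI subsetI)
    fix c assume "c \<in> ?M"
    then obtain a' b' w where *: "(a, a') \<in> homotopic V i x" "(b, b') \<in> homotopic V i x" "w \<in> lev V (Suc i)"
      "\<forall>j. Suc j < i \<longrightarrow> face V (Suc i) j w = ?p" "face V (Suc i) k w = a'" "face V (Suc i) (Suc i) w = b'"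
      "(face V (Suc i) i w, c) \<in> homotopic V i x"
      by (auto simp: homotopy_group_def k)
    have sp': "a' \<in> spheres V i x" "b' \<in> spheres V i x" using * by (auto simp: homotopic_def)
    note w = w0[OF sp']
    have "face V (Suc i) i (w - w0 a' b') \<in> boundaries V i"
    proof (rule boundary_of_middle_face)
      show "w - w0 a' b' \<in> lev V (Suc i)" using subspace_diff[OF subspace_lev *(3)] w by simp
      show "face V (Suc i) j (w - w0 a' b') = 0" if "j < i" for j
        using face_diff[OF *(3), of "w0 a' b'"] w * that k by (cases "j = k") auto
      show "face V (Suc i) (Suc i) (w - w0 a' b') = 0" using face_diff[OF *(3), of "w0 a' b'"] w * by auto
    qed
    then have "face V (Suc i) i w - (a' + b' - ?p) \<in> boundaries V i"
      using face_diff[OF *(3), of "w0 a' b'"] w by auto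
    moreover have "a - a' \<in> boundaries V i" "b - b' \<in> boundaries V i"
        "face V (Suc i) i w - c \<in> boundaries V i" "c \<in> spheres V i x"
      using * by (auto simp: homotopic_iff[OF x])
    ultimately have "(a - a') + (b - b') - (face V (Suc i) i w - (a' + b' - ?p)) + (face V (Suc i) i w - c) \<in> boundaries V i"
      by (meson subspace_add subspace_diff subspace_boundaries)
    then show "c \<in> homotopic V i x `` {a + b - ?p}"
      using sphere[OF a b] \<open>c \<in> spheres V i x\<close> by (simp add: homotopic_iff[OF x] algebra_simps)
  next
    fix c assume "c \<in> homotopic V i x `` {a + b - ?p}"
    moreover have "(a, a) \<in> homotopic V i x" "(b, b) \<in> homotopic V i x"
      using a b subspace_0[OF subspace_boundaries] by (auto simp: homotopic_iff[OF x])
    ultimately show "c \<in> ?M"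
      using w0[OF a b] unfolding homotopy_group_def monoid.simps mem_Collect_eq
      by (intro bexI[where x = a] bexI[where x = b] bexI[where x = "w0 a b"]) (auto simp: k)
  qed
qed

end

lemma bij_betw_quotient:
  assumes R: "equiv X R" and S: "equiv Y S" and f: "f \<in> X \<rightarrow> Y"
    and iff: "\<And>a b. a \<in> X \<Longrightarrow> b \<in> X \<Longrightarrow> (f a, f b) \<in> S \<longleftrightarrow> (a, b) \<in> R"
    and surj: "\<And>y. y \<in> Y \<Longrightarrow> \<exists>a\<in>X. (f a, y) \<in> S"
  shows "bij_betw (\<lambda>A. S `` (f ` A)) (X // R) (Y // S)"
    and "\<And>a. a \<in> X \<Longrightarrow> S `` (f ` (R `` {a})) = S `` {f a}"
proof -
  show cls: "S `` (f ` (R `` {a})) = S `` {f a}" if a: "a \<in> X" for a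
  proof -
    have "S `` {f b} = S `` {f a}" if "(a, b) \<in> R" for b
      using that iff[OF a, of b] R equiv_class_eq[OF S, of "f a" "f b"] by (auto simp: equiv_def)
    moreover have "(a, a) \<in> R" using R a by (auto simp: equiv_def refl_on_def)
    ultimately show ?thesis by blast
  qed
  show "bij_betw (\<lambda>A. S `` (f ` A)) (X // R) (Y // S)"
  proof (rule bij_betwI')
    fix A B assume "A \<in> X // R" "B \<in> X // R"
    then obtain a b where ab: "a \<in> X" "b \<in> X" "A = R `` {a}" "B = R `` {b}" by (auto elim!: quotientE)
    show "(S `` (f ` A) = S `` (f ` B)) = (A = B)"
      unfolding ab cls[OF ab(1)] cls[OF ab(2)]
      using eq_equiv_class_iff[OF R ab(1,2)] eq_equiv_class_iff[OF S, of "f a" "f b"] iff[OF ab(1,2)] f ab by auto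
  next
    fix A assume "A \<in> X // R"
    then show "S `` (f ` A) \<in> Y // S"
      using f by (auto elim!: quotientE simp: cls intro!: quotientI)
  next
    fix B assume "B \<in> Y // S"
    then obtain y where y: "y \<in> Y" "B = S `` {y}" by (auto elim!: quotientE)
    then obtain a where a: "a \<in> X" "(f a, y) \<in> S" using surj by blast
    have "B = S `` (f ` (R `` {a}))" using y cls[OF a(1)] equiv_class_eq[OF S a(2)] by simp
    then show "\<exists>A\<in>X // R. B = S `` (f ` A)" using quotientI[OF a(1)] by blast
  qed
qed

lemma simplicial_map_cycles:
  assumes "simplicial_vector_space V" "simplicial_vector_space W" and f: "simplicial_linear_map V W f"
    and z: "z \<in> cycles V i"
  shows "f i z \<in> cycles W i"
proof -
  interpret V: simplicial_vector_space V by fact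
  interpret W: simplicial_vector_space W by fact
  have lin: "linear_map_on (lev V k) (lev W k) (f k)" for k
    using f by (simp add: simplicial_linear_map_def)
  have zl: "z \<in> lev V i" using z by (simp add: V.cycles_iff)
  have "face W i j (f i z) = 0" if "i = Suc k" "j \<le> i" for j k
  proof -
    have "face W i j (f i z) = f k (face V i j z)"
      using f zl coface_ordmaps that(1) by (simp add: simplicial_linear_map_def face_def)
    then show ?thesis
      using z that linear_map_on_zero[OF lin V.subspace_lev] by (simp add: V.cycles_iff)
  qed
  then show ?thesis
    using linear_map_on_mem[OF lin zl] by (cases i) (auto simp: W.cycles_iff)
qed

text \<open>Subtracting the base point turns spheres into cycles and homotopic spheres into cycles that differ by a
  boundary. So the homotopy groups at every base point are copies of the homology of the normalized complex.\<close>

lemma weak_equivalence_if_homology_bij: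
  assumes V: "simplicial_vector_space V" and W: "simplicial_vector_space W" and f: "simplicial_linear_map V W f"
    and inj: "\<And>i z. z \<in> cycles V i \<Longrightarrow> f i z \<in> boundaries W i \<Longrightarrow> z \<in> boundaries V i"
    and surj: "\<And>i w. w \<in> cycles W i \<Longrightarrow> \<exists>z\<in>cycles V i. w - f i z \<in> boundaries W i"
  shows "weak_equivalence V W f"
proof -
  interpret V: simplicial_vector_space V by (rule V)
  interpret W: simplicial_vector_space W by (rule W)
  have lin: "linear_map_on (lev V k) (lev W k) (f k)" for k
    using f by (simp add: simplicial_linear_map_def)
  have nat: "f l (pull V k l q v) = pull W k l q (f k v)" if "q \<in> ordmaps l k" "v \<in> lev V k" for k l q v
    using f that by (simp add: simplicial_linear_map_def)
  have face: "f m (face V (Suc m) j v) = face W (Suc m) j (f (Suc m) v)" if "v \<in> lev V (Suc m)" for m j v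
    using nat[OF coface_ordmaps that] by (simp add: face_def)
  have diff: "f k (a - b) = f k a - f k b" if "a \<in> lev V k" "b \<in> lev V k" for k a b
    using linear_map_on_diff[OF lin V.subspace_lev that] .
  have zero: "f k 0 = 0" for k
    using linear_map_on_zero[OF lin V.subspace_lev] .
  note cyc = simplicial_map_cycles[OF V W f]
  have bd: "f i z \<in> boundaries W i" if z: "z \<in> boundaries V i" for i z
  proof -
    obtain y where y: "y \<in> lev V (Suc i)" "\<forall>j\<le>i. face V (Suc i) j y = 0" "face V (Suc i) (Suc i) y = z"
      using z unfolding V.boundaries_iff by blast
    then show ?thesis
      unfolding W.boundaries_iff
      using face[OF y(1), symmetric] zero linear_map_on_mem[OF lin y(1)] by (intro bexI[of _ "f (Suc i) y"]) auto
  qed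
  have main: "bij_betw (homotopy_map W f i x) (carrier (homotopy_group V i x)) (carrier (homotopy_group W i (f 0 x))) \<and>
      (i \<ge> 1 \<longrightarrow> homotopy_map W f i x \<in> hom (homotopy_group V i x) (homotopy_group W i (f 0 x)))"
    if x: "x \<in> lev V 0" for x i
  proof -
    have fx: "f 0 x \<in> lev W 0" using linear_map_on_mem[OF lin x] .
    have bp: "f i (basepoint V i x) = basepoint W i (f 0 x)"
      unfolding basepoint_def using nat[OF const_ordmaps x] .
    have sph_lev: "a \<in> lev V i" if "a \<in> spheres V i x" for a using that by (simp add: spheres_def)
    have sph: "f i a \<in> spheres W i (f 0 x)" if "a \<in> spheres V i x" for a
      using that cyc[of "a - basepoint V i x" i] diff[of a i "basepoint V i x"] V.basepoint_mem[OF x]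
        linear_map_on_mem[OF lin, of a i] bp
      by (simp add: V.spheres_iff[OF x] W.spheres_iff[OF fx])
    have iff: "(f i a, f i b) \<in> homotopic W i (f 0 x) \<longleftrightarrow> (a, b) \<in> homotopic V i x"
      if ab: "a \<in> spheres V i x" "b \<in> spheres V i x" for a b
    proof -
      have "(a - basepoint V i x) - (b - basepoint V i x) \<in> cycles V i"
        using ab subspace_diff[OF V.subspace_cycles] unfolding V.spheres_iff[OF x] by blast
      then have "a - b \<in> cycles V i" by simp
      then show ?thesis
        using inj[of "a - b" i] bd[of "a - b" i] diff[of a i b] sph_lev ab sph
        by (auto simp: V.homotopic_iff[OF x] W.homotopic_iff[OF fx])
    qed
    have onto: "\<exists>a\<in>spheres V i x. (f i a, y) \<in> homotopic W i (f 0 x)" if y: "y \<in> spheres W i (f 0 x)" for y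
    proof -
      have "y - basepoint W i (f 0 x) \<in> cycles W i" using y by (simp add: W.spheres_iff[OF fx])
      then obtain z where z: "z \<in> cycles V i" "y - basepoint W i (f 0 x) - f i z \<in> boundaries W i"
        using surj by blast
      have zl: "z \<in> lev V i" using z(1) by (simp add: V.cycles_iff)
      have a: "z + basepoint V i x \<in> spheres V i x"
        using z(1) subspace_add[OF V.subspace_lev zl V.basepoint_mem[OF x]] by (simp add: V.spheres_iff[OF x])
      have "f i (z + basepoint V i x) - y \<in> boundaries W i"
        using subspace_neg[OF W.subspace_boundaries z(2)] linear_map_on_add[OF lin zl V.basepoint_mem[OF x]] bp
        by (simp add: algebra_simps)
      then show ?thesis
        using a sph[OF a] y by (auto simp: W.homotopic_iff[OF fx])
    qed
    note bij = bij_betw_quotient[OF V.equiv_homotopic[OF x] W.equiv_homotopic[OF fx] _ iff onto]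
    have fsph: "f i \<in> spheres V i x \<rightarrow> spheres W i (f 0 x)" using sph by auto
    have carriers: "carrier (homotopy_group V i x) = spheres V i x // homotopic V i x"
      "carrier (homotopy_group W i (f 0 x)) = spheres W i (f 0 x) // homotopic W i (f 0 x)"
      by (simp_all add: homotopy_group_def)
    have b: "bij_betw (homotopy_map W f i x) (carrier (homotopy_group V i x)) (carrier (homotopy_group W i (f 0 x)))"
      unfolding homotopy_map_def carriers by (rule bij(1)[OF fsph]) auto
    have "homotopy_map W f i x \<in> hom (homotopy_group V i x) (homotopy_group W i (f 0 x))" if i: "i \<ge> 1"
    proof (rule homI)
      show "homotopy_map W f i x A \<in> carrier (homotopy_group W i (f 0 x))" if "A \<in> carrier (homotopy_group V i x)" for A
        using b that by (auto simp: bij_betw_def)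
      fix A B assume "A \<in> carrier (homotopy_group V i x)" "B \<in> carrier (homotopy_group V i x)"
      then obtain a b where ab: "a \<in> spheres V i x" "b \<in> spheres V i x"
        "A = homotopic V i x `` {a}" "B = homotopic V i x `` {b}" by (auto simp: carriers elim!: quotientE)
      have cls: "homotopy_map W f i x (homotopic V i x `` {a}) = homotopic W i (f 0 x) `` {f i a}"
        if "a \<in> spheres V i x" for a
        unfolding homotopy_map_def by (rule bij(2)[OF fsph]) (use that in auto)
      have "f i (a + b - basepoint V i x) = f i a + f i b - basepoint W i (f 0 x)"
        using diff[of "a + b" i "basepoint V i x"] linear_map_on_add[OF lin, of a i b] sph_lev ab(1,2)
          V.basepoint_mem[OF x] subspace_add[OF V.subspace_lev] bp by auto
      then show "homotopy_map W f i x (A \<otimes>\<^bsub>homotopy_group V i x\<^esub> B) =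
          homotopy_map W f i x A \<otimes>\<^bsub>homotopy_group W i (f 0 x)\<^esub> homotopy_map W f i x B"
        unfolding ab V.mult_homotopy_group(1)[OF x i ab(1,2)] cls[OF ab(1)] cls[OF ab(2)]
          cls[OF V.mult_homotopy_group(2)[OF x i ab(1,2)]] W.mult_homotopy_group(1)[OF fx i sph[OF ab(1)] sph[OF ab(2)]]
        by simp
    qed
    with b show ?thesis by simp
  qed
  then show ?thesis
    unfolding weak_equivalence_def iso_def using V W f by simp
qed

section \<open>The tensor product with a simplex\<close>

lemma sum_fun_apply: "(\<Sum>a\<in>A. f a) x = (\<Sum>a\<in>A. f a x)"
  by (induction A rule: infinite_finite_induct) auto

lemma single_apply: "single u v w = (if w = u then v else 0)"
  by (simp add: single_def)

text \<open>The zero family is kept in the form \<open>0\<close>, to which the lemmas of linear algebra apply.\<close>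

declare single_zero [simp del]

lemma single_zero' [simp]: "single u (0::'a::zero) = 0"
  by (simp add: fun_eq_iff single_apply)

lemma single_add: "single u (v + w) = single u v + single u (w::'a::monoid_add)"
  by (simp add: fun_eq_iff single_apply)

lemma single_scale: "single u (c *\<^sub>R v) = c *\<^sub>R single u (v::'a::real_vector)"
  by (simp add: fun_eq_iff single_apply)

context simplicial_vector_space
begin

abbreviation T :: "nat \<Rightarrow> ((nat \<Rightarrow> nat) \<Rightarrow> 'a) svec" where
  "T k \<equiv> tensor_simplex V k"

lemma T_lev: "x \<in> lev (T k) m \<longleftrightarrow> (\<forall>u\<in>ordmaps m k. x u \<in> lev V m) \<and> (\<forall>u. u \<notin> ordmaps m k \<longrightarrow> x u = 0)"
  by (simp add: tensor_simplex_def)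

lemma T_value_mem: "x \<in> lev (T k) m \<Longrightarrow> x u \<in> lev V m"
  using subspace_0[OF subspace_lev] by (cases "u \<in> ordmaps m k") (auto simp: T_lev)

lemma subspace_T_lev: "subspace (lev (T k) m)"
  unfolding subspace_def
  using subspace_0[OF subspace_lev] subspace_add[OF subspace_lev] subspace_scale[OF subspace_lev] by (auto simp: T_lev)

lemma single_mem: "u \<in> ordmaps m k \<Longrightarrow> v \<in> lev V m \<Longrightarrow> single u v \<in> lev (T k) m"
  using subspace_0[OF subspace_lev] by (auto simp: T_lev single_apply)

lemma T_expand:
  assumes "x \<in> lev (T k) m"
  shows "x = (\<Sum>u\<in>ordmaps m k. single u (x u))"
proof
  fix w
  have "(\<Sum>u\<in>ordmaps m k. single u (x u)) w = (\<Sum>u\<in>ordmaps m k. if u = w then x w else 0)"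
    unfolding sum_fun_apply by (intro sum.cong) (auto simp: single_apply)
  also have "\<dots> = x w"
    using assms by (auto simp: finite_ordmaps T_lev)
  finally show "x w = (\<Sum>u\<in>ordmaps m k. single u (x u)) w" ..
qed

lemma T_linear_mem:
  assumes F: "linear_map_on (lev (T k) m) S F" and U: "subspace U" and x: "x \<in> lev (T k) m"
    and *: "\<And>u. u \<in> ordmaps m k \<Longrightarrow> x u \<noteq> 0 \<Longrightarrow> F (single u (x u)) \<in> U"
  shows "F x \<in> U"
proof -
  have "F x = (\<Sum>u\<in>ordmaps m k. F (single u (x u)))"
    by (subst T_expand[OF x], rule linear_map_on_sum[OF F subspace_T_lev])
      (use x in \<open>auto intro: single_mem T_value_mem\<close>)
  moreover have "F (single u (x u)) \<in> U" if "u \<in> ordmaps m k" for u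
    using *[OF that] linear_map_on_zero[OF F subspace_T_lev] subspace_0[OF U]
    by (cases "x u = 0") (auto simp: single_zero')
  ultimately show ?thesis using subspace_sum[OF U] by metis
qed

lemma T_linear_eq:
  assumes F: "linear_map_on (lev (T k) m) S F" and G: "linear_map_on (lev (T k) m) S' G" and x: "x \<in> lev (T k) m"
    and *: "\<And>u v. u \<in> ordmaps m k \<Longrightarrow> v \<in> lev V m \<Longrightarrow> F (single u v) = G (single u v)"
  shows "F x = G x"
proof -
  have "F x - G x \<in> {0}"
    by (rule T_linear_mem[OF linear_map_on_minus_fun[OF F G] subspace_single_0 x]) (use * T_value_mem[OF x] in auto)
  then show ?thesis by simp
qed

text \<open>The structure maps of \<open>V \<otimes> \<Delta>[k]\<close>, the maps induced by \<open>\<Delta>[l] \<rightarrow> \<Delta>[k]\<close> and the summands of the prism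
  operator are all of this form.\<close>

lemma reindexing_linear:
  assumes g: "\<And>u. u \<in> ordmaps m k \<Longrightarrow> g u \<in> ordmaps l k'" and L: "linear_map_on (lev V m) (lev V l) L"
  shows "linear_map_on (lev (T k) m) (lev (T k') l) (\<lambda>x. \<Sum>u\<in>ordmaps m k. single (g u) (L (x u)))"
  unfolding linear_map_on_def
proof (intro conjI funcsetI ballI allI)
  fix x assume x: "x \<in> lev (T k) m"
  show "(\<Sum>u\<in>ordmaps m k. single (g u) (L (x u))) \<in> lev (T k') l"
    by (intro subspace_sum[OF subspace_T_lev] single_mem g linear_map_on_mem[OF L] T_value_mem[OF x])
  show "(\<Sum>u\<in>ordmaps m k. single (g u) (L ((c *\<^sub>R x) u))) = c *\<^sub>R (\<Sum>u\<in>ordmaps m k. single (g u) (L (x u)))" for c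
    using linear_map_on_scale[OF L T_value_mem[OF x]] by (simp add: scaleR_sum_right single_scale)
  show "(\<Sum>u\<in>ordmaps m k. single (g u) (L ((x + y) u))) =
      (\<Sum>u\<in>ordmaps m k. single (g u) (L (x u))) + (\<Sum>u\<in>ordmaps m k. single (g u) (L (y u)))"
    if y: "y \<in> lev (T k) m" for y
    using linear_map_on_add[OF L T_value_mem[OF x] T_value_mem[OF y]] by (simp add: sum.distrib single_add)
qed

lemma reindexing_single:
  assumes "u \<in> ordmaps m k" "linear_map_on (lev V m) (lev V l) L"
  shows "(\<Sum>w\<in>ordmaps m k. single (g w) (L (single u v w))) = single (g u) (L v)"
  using sum_ordmaps_single[OF assms(1), of "\<lambda>w y. single (g w) (L y)" v]
    linear_map_on_zero[OF assms(2) subspace_lev] by (simp add: single_zero')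

lemma T_pull_eq: "pull (T k) m l q = (\<lambda>x. \<Sum>u\<in>ordmaps m k. single (compose {..l} u q) (pull V m l q (x u)))"
  by (simp add: tensor_simplex_def)

lemma T_pull_linear:
  assumes "q \<in> ordmaps l m"
  shows "linear_map_on (lev (T k) m) (lev (T k) l) (pull (T k) m l q)"
  unfolding T_pull_eq by (rule reindexing_linear[OF compose_ordmaps[OF assms] pull_linear[OF assms]])

lemma simplicial_vector_space_T: "simplicial_vector_space (T k)"
proof
  fix m
  obtain B where B: "finite B" "lev V m = span B" using finite_dim by blast
  let ?B = "\<Union>u\<in>ordmaps m k. single u ` B"
  have "lev (T k) m \<subseteq> span ?B"
  proof
    fix x assume x: "x \<in> lev (T k) m"
    have "linear_map_on (lev V m) UNIV (single u)" for u :: "nat \<Rightarrow> nat"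
      by (auto simp: linear_map_on_def single_add single_scale)
    then have "single u (x u) \<in> span ?B" if "u \<in> ordmaps m k" for u
      by (rule linear_map_on_span_subset[OF _ subspace_lev subspace_span, where B = B])
        (use B T_value_mem[OF x] that span_superset[of B] in \<open>auto intro: span_base\<close>)
    then show "x \<in> span ?B"
      by (subst T_expand[OF x]) (auto intro: span_sum)
  qed
  moreover have "span ?B \<subseteq> lev (T k) m"
    by (rule span_minimal[OF _ subspace_T_lev]) (use B span_superset[of B] in \<open>auto intro: single_mem\<close>)
  ultimately show "\<exists>B. finite B \<and> lev (T k) m = span B"
    using B(1) finite_ordmaps by (intro exI[of _ ?B]) auto
next
  show "linear_map_on (lev (T k) m) (lev (T k) l) (pull (T k) m l q)" if "q \<in> ordmaps l m" for q l m
    using T_pull_linear[OF that] .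
next
  fix x m assume x: "x \<in> lev (T k) m"
  show "pull (T k) m m (ordid m) x = x"
    by (rule T_linear_eq[OF T_pull_linear[OF ordid_ordmaps] _ x, where S' = UNIV])
      (auto simp: tensor_pull_single[OF ordid_ordmaps] compose_ordid_right pull_id linear_map_on_def)
next
  fix p j l q m x assume p: "p \<in> ordmaps j l" and q: "q \<in> ordmaps l m" and x: "x \<in> lev (T k) m"
  show "pull (T k) m j (compose {..j} q p) x = pull (T k) l j p (pull (T k) m l q x)"
    by (rule T_linear_eq[OF T_pull_linear[OF compose_ordmaps[OF p q]]
          linear_map_on_comp[OF T_pull_linear[OF q] T_pull_linear[OF p]] x])
      (simp add: tensor_pull_single[OF p] tensor_pull_single[OF q] tensor_pull_single[OF compose_ordmaps[OF p q]]
        compose_ordmaps[OF q] compose_ordmaps_assoc[OF p] pull_comp[OF p q])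
qed

lemma tensor_map_eq: "tensor_map l q j = (\<lambda>x. \<Sum>u\<in>ordmaps j l. single (compose {..j} q u) ((\<lambda>v. v) (x u)))"
  by (simp add: tensor_map_def fun_eq_iff)

lemma tensor_map_linear:
  assumes "q \<in> ordmaps l k"
  shows "linear_map_on (lev (T l) j) (lev (T k) j) (tensor_map l q j)"
  unfolding tensor_map_eq by (rule reindexing_linear[OF compose_ordmaps[OF _ assms] id_linear])

lemma tensor_map_single:
  assumes "u \<in> ordmaps j l"
  shows "tensor_map l q j (single u v) = single (compose {..j} q u) (v::'a)"
  unfolding tensor_map_eq by (rule reindexing_single[OF assms id_linear])

lemma tensor_map_pull:
  assumes q: "q \<in> ordmaps l k" and p: "p \<in> ordmaps i j" and x: "x \<in> lev (T l) j"
  shows "tensor_map l q i (pull (T l) j i p x) = pull (T k) j i p (tensor_map l q j x)"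
  by (rule T_linear_eq[OF linear_map_on_comp[OF T_pull_linear[OF p] tensor_map_linear[OF q]]
        linear_map_on_comp[OF tensor_map_linear[OF q] T_pull_linear[OF p]] x])
    (simp add: tensor_pull_single[OF p] tensor_map_single compose_ordmaps[OF p] compose_ordmaps[OF _ q]
      compose_ordmaps_assoc[OF p])

lemma T_face_single:
  assumes "u \<in> ordmaps (Suc m) k"
  shows "face (T k) (Suc m) i (single u v) = single (compose {..m} u (coface (Suc m) i)) (face V (Suc m) i v)"
  using tensor_pull_single[OF coface_ordmaps assms] by (simp add: face_def)

lemma T_degeneracy_single:
  assumes "u \<in> ordmaps m k" "j \<le> m"
  shows "degeneracy (T k) m j (single u v) = single (compose {..Suc m} u (codegeneracy m j)) (degeneracy V m j v)"
  using tensor_pull_single[OF codegeneracy_ordmaps[OF assms(2)] assms(1)] by (simp add: degeneracy_def)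

lemma T_bd_single:
  assumes "u \<in> ordmaps (Suc m) k"
  shows "alternating_bd (T k) (Suc m) (single u v) =
    (\<Sum>i\<le>Suc m. (- 1) ^ i *\<^sub>R single (compose {..m} u (coface (Suc m) i)) (face V (Suc m) i v))"
  unfolding alternating_bd_def T_face_single[OF assms] ..

lemmas T_bd_linear = simplicial_vector_space.alternating_bd_linear[OF simplicial_vector_space_T]
lemmas T_bd_bd = simplicial_vector_space.alternating_bd_alternating_bd[OF simplicial_vector_space_T]
lemmas T_bd_degen = simplicial_vector_space.alternating_bd_degen[OF simplicial_vector_space_T]
lemmas T_degen_subset = simplicial_vector_space.degen_subset[OF simplicial_vector_space_T]

text \<open>The degenerate chains of \<open>V \<otimes> \<Delta>[k]\<close> are spanned by the degeneracies of the generators \<open>v\<^sup>u\<close>, so it suffices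
  to treat these.\<close>

lemma degen_T_linear_mem:
  assumes F: "linear_map_on (lev (T k) (Suc m)) S F" and U: "subspace U" and x: "x \<in> degen (T k) (Suc m)"
    and *: "\<And>u v j. u \<in> ordmaps m k \<Longrightarrow> v \<in> lev V m \<Longrightarrow> j \<le> m \<Longrightarrow>
      F (single (compose {..Suc m} u (codegeneracy m j)) (degeneracy V m j v)) \<in> U"
  shows "F x \<in> U"
proof (rule linear_map_on_span_subset[OF F subspace_T_lev U _ _ x[unfolded degen_def]])
  interpret T: simplicial_vector_space "T k" by (rule simplicial_vector_space_T)
  show "{degeneracy (T k) i j y |i j y. Suc m = Suc i \<and> j \<le> i \<and> y \<in> lev (T k) i} \<subseteq> lev (T k) (Suc m)"
    using T.degeneracy_mem by auto
  fix b assume "b \<in> {degeneracy (T k) i j y |i j y. Suc m = Suc i \<and> j \<le> i \<and> y \<in> lev (T k) i}"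
  then obtain j y where b: "b = degeneracy (T k) m j y" "j \<le> m" "y \<in> lev (T k) m" by auto
  show "F b \<in> U"
    unfolding b(1)
    by (rule T_linear_mem[OF linear_map_on_comp[OF T.degeneracy_linear[OF b(2)] F] U b(3)])
      (use b * T_value_mem[OF b(3)] in \<open>simp add: T_degeneracy_single\<close>)
qed

lemma tensor_map_bd:
  assumes q: "q \<in> ordmaps l k" and x: "x \<in> lev (T l) (Suc m)"
  shows "tensor_map l q m (alternating_bd (T l) (Suc m) x) = alternating_bd (T k) (Suc m) (tensor_map l q (Suc m) x)"
proof -
  interpret T: simplicial_vector_space "T l" by (rule simplicial_vector_space_T)
  have "tensor_map l q m (alternating_bd (T l) (Suc m) x) =
      (\<Sum>i\<le>Suc m. tensor_map l q m ((- 1) ^ i *\<^sub>R face (T l) (Suc m) i x))"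
    unfolding alternating_bd_def
    by (rule linear_map_on_sum[OF tensor_map_linear[OF q] subspace_T_lev])
      (use T.face_mem[OF x] in \<open>auto intro: subspace_scale[OF subspace_T_lev]\<close>)
  also have "\<dots> = alternating_bd (T k) (Suc m) (tensor_map l q (Suc m) x)"
    unfolding alternating_bd_def
    using tensor_map_pull[OF q coface_ordmaps x] linear_map_on_scale[OF tensor_map_linear[OF q] T.face_mem[OF x]]
    by (intro sum.cong) (auto simp: face_def)
  finally show ?thesis .
qed

lemma tensor_map_degen:
  assumes q: "q \<in> ordmaps l k" and x: "x \<in> degen (T l) m"
  shows "tensor_map l q m x \<in> degen (T k) m"
proof (cases m)
  case 0
  then show ?thesis
    using x degen_0[of "T l"] linear_map_on_zero[OF tensor_map_linear[OF q, of 0] subspace_T_lev] degen_0[of "T k"] by simp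
next
  case (Suc n)
  have "tensor_map l q (Suc n) (single (compose {..Suc n} u (codegeneracy n j)) (degeneracy V n j v)) \<in> degen (T k) (Suc n)"
    if "u \<in> ordmaps n l" "v \<in> lev V n" "j \<le> n" for u v j
  proof -
    have "tensor_map l q (Suc n) (single (compose {..Suc n} u (codegeneracy n j)) (degeneracy V n j v)) =
        degeneracy (T k) n j (single (compose {..n} q u) v)"
      using that codegeneracy_ordmaps[OF that(3)] q
      by (simp add: tensor_map_single T_degeneracy_single compose_ordmaps[of _ _ n] compose_ordmaps[of _ _ l]
          compose_ordmaps_assoc[OF codegeneracy_ordmaps])
    then show ?thesis
      using degeneracy_in_degen[OF that(3) single_mem[OF compose_ordmaps[OF that(1) q] that(2)]] by simp
  qed
  then show ?thesis
    using degen_T_linear_mem[OF tensor_map_linear[OF q] subspace_degen x[unfolded Suc]] Suc by simp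
qed

text \<open>Chains on simplices that miss a vertex in \<open>A\<close>. For \<open>A = {..k}\<close> this is the boundary of \<open>\<Delta>[k]\<close>, for
  \<open>A = {..<k}\<close> it is the horn consisting of all faces through the last vertex.\<close>

definition missing :: "nat \<Rightarrow> nat set \<Rightarrow> nat \<Rightarrow> ((nat \<Rightarrow> nat) \<Rightarrow> 'a) set" where
  "missing k A m = {x \<in> lev (T k) m. \<forall>u. A \<subseteq> u ` {..m} \<longrightarrow> x u = 0}"

lemma subspace_missing: "subspace (missing k A m)"
  using subspace_T_lev[of k m] unfolding subspace_def missing_def by auto

lemma missing_subset: "missing k A m \<subseteq> lev (T k) m"
  by (auto simp: missing_def)

lemma missing_mono: "A \<subseteq> A' \<Longrightarrow> missing k A m \<subseteq> missing k A' m"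
  by (auto simp: missing_def)

lemma single_missing:
  assumes "u \<in> ordmaps m k" "v \<in> lev V m" "a \<in> A" "a \<notin> u ` {..m}"
  shows "single u v \<in> missing k A m"
  using assms single_mem[OF assms(1,2)] by (auto simp: missing_def single_apply)

lemma missing_linear_mem:
  assumes F: "linear_map_on (lev (T k) m) S F" and U: "subspace U" and x: "x \<in> missing k A m"
    and *: "\<And>u v a. u \<in> ordmaps m k \<Longrightarrow> v \<in> lev V m \<Longrightarrow> a \<in> A \<Longrightarrow> a \<notin> u ` {..m} \<Longrightarrow> F (single u v) \<in> U"
  shows "F x \<in> U"
proof (rule T_linear_mem[OF F U])
  show "x \<in> lev (T k) m" using x by (simp add: missing_def)
  fix u assume u: "u \<in> ordmaps m k" "x u \<noteq> 0"
  then have "\<not> A \<subseteq> u ` {..m}" using x by (auto simp: missing_def)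
  then obtain a where "a \<in> A" "a \<notin> u ` {..m}" by blast
  then show "F (single u (x u)) \<in> U" using * u(1) T_value_mem \<open>x \<in> lev (T k) m\<close> by blast
qed

lemma bd_missing:
  assumes x: "x \<in> missing k A (Suc m)"
  shows "alternating_bd (T k) (Suc m) x \<in> missing k A m"
proof (rule missing_linear_mem[OF T_bd_linear subspace_missing x])
  fix u v a assume u: "u \<in> ordmaps (Suc m) k" "v \<in> lev V (Suc m)" "a \<in> A" "a \<notin> u ` {..Suc m}"
  have "a \<notin> compose {..m} u (coface (Suc m) i) ` {..m}" for i
    using u(4) ordmaps_apply[OF coface_ordmaps] by (auto simp: compose_apply)
  then show "alternating_bd (T k) (Suc m) (single u v) \<in> missing k A m"
    unfolding T_bd_single[OF u(1)]
    by (intro subspace_sum[OF subspace_missing] subspace_scale[OF subspace_missing]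
        single_missing[OF compose_ordmaps[OF coface_ordmaps u(1)] face_mem[OF u(2)] u(3)])
qed

abbreviation last_face :: "nat \<Rightarrow> nat \<Rightarrow> ((nat \<Rightarrow> nat) \<Rightarrow> 'a) \<Rightarrow> (nat \<Rightarrow> nat) \<Rightarrow> 'a" where
  "last_face k m \<equiv> tensor_map k (coface (Suc k) (Suc k)) m"

lemmas last_face_linear = tensor_map_linear[OF coface_ordmaps]
lemmas last_face_bd = tensor_map_bd[OF coface_ordmaps]
lemmas last_face_degen = tensor_map_degen[OF coface_ordmaps]

lemma last_coface_image: "u \<in> ordmaps m k \<Longrightarrow> x \<le> m \<Longrightarrow> compose {..m} (coface (Suc k) (Suc k)) u x = u x"
  using ordmaps_apply[of u m k x] by (simp add: compose_apply coface_apply)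

lemma last_face_missing:
  assumes x: "x \<in> missing k {..k} m"
  shows "last_face k m x \<in> missing (Suc k) {..<Suc k} m"
proof (rule missing_linear_mem[OF last_face_linear subspace_missing x])
  fix u v a assume u: "u \<in> ordmaps m k" "v \<in> lev V m" "a \<in> {..k}" "a \<notin> u ` {..m}"
  show "last_face k m (single u v) \<in> missing (Suc k) {..<Suc k} m"
    unfolding tensor_map_single[OF u(1)]
    by (rule single_missing[OF compose_ordmaps[OF u(1) coface_ordmaps] u(2)])
      (use u in \<open>auto simp: last_coface_image\<close>)
qed

lemma missing_last_vertex:
  assumes u: "u \<in> ordmaps m (Suc k)" and a: "a \<notin> u ` {..m}" "a \<le> Suc k"
  shows "\<exists>u'\<in>ordmaps m k. u = compose {..m} (coface (Suc k) a) u'"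
proof -
  define u' where "u' = (\<lambda>x\<in>{..m}. if u x < a then u x else u x - 1)"
  have ne: "u x \<noteq> a" if "x \<le> m" for x using a that by auto
  have "u' \<in> ordmaps m k"
  proof (rule ordmapsI)
    show "u' x \<le> k" if "x \<le> m" for x
      using ordmaps_apply[OF u that] a(2) that ne[OF that] by (auto simp: u'_def)
    show "u' x \<le> u' y" if "x \<le> y" "y \<le> m" for x y
      using ordmaps_mono[OF u that] that ne by (auto simp: u'_def)
  qed (auto simp: u'_def)
  moreover have "compose {..m} (coface (Suc k) a) u' = u"
  proof (rule ordmaps_eqI[OF compose_ordmaps[OF \<open>u' \<in> ordmaps m k\<close> coface_ordmaps] u])
    show "compose {..m} (coface (Suc k) a) u' x = u x" if "x \<le> m" for x
      using ordmaps_apply[OF u that] a(2) that ne[OF that] by (auto simp: u'_def compose_apply coface_apply)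
  qed
  ultimately show ?thesis by blast
qed

text \<open>A simplex that misses only the last vertex comes from the last face; any other simplex of the boundary lies in
  the horn.\<close>

lemma boundary_decompose:
  assumes x: "x \<in> missing (Suc k) {..Suc k} m"
  shows "\<exists>l\<in>missing (Suc k) {..<Suc k} m. \<exists>c\<in>lev (T k) m. x = l + last_face k m c"
proof -
  have lf: "subspace (last_face k m ` lev (T k) m)"
    by (rule subspace_linear_map_on_image[OF last_face_linear subspace_T_lev])
  have S: "subspace {l + y |l y. l \<in> missing (Suc k) {..<Suc k} m \<and> y \<in> last_face k m ` lev (T k) m}"
    using subspace_sums[OF subspace_missing lf] .
  have "x \<in> {l + y |l y. l \<in> missing (Suc k) {..<Suc k} m \<and> y \<in> last_face k m ` lev (T k) m}"
  proof (rule missing_linear_mem[OF id_linear S x])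
    fix u v a assume u: "u \<in> ordmaps m (Suc k)" "v \<in> lev V m" "a \<in> {..Suc k}" "a \<notin> u ` {..m}"
    show "single u v \<in> {l + y |l y. l \<in> missing (Suc k) {..<Suc k} m \<and> y \<in> last_face k m ` lev (T k) m}"
    proof (cases "a = Suc k")
      case True
      then obtain u' where u': "u' \<in> ordmaps m k" "u = compose {..m} (coface (Suc k) (Suc k)) u'"
        using missing_last_vertex[OF u(1,4)] by auto
      then have "single u v = 0 + last_face k m (single u' v)" by (simp add: tensor_map_single)
      then show ?thesis using subspace_0[OF subspace_missing] single_mem[OF u'(1) u(2)] by blast
    next
      case False
      then have "a \<in> {..<Suc k}" using u(3) by auto
      from single_missing[OF u(1,2) this u(4)] have "single u v \<in> missing (Suc k) {..<Suc k} m" .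
      moreover have "single u v = single u v + last_face k m 0"
        using linear_map_on_zero[OF last_face_linear subspace_T_lev, of k "Suc k" m] by simp
      ultimately show ?thesis using subspace_0[OF subspace_T_lev] by blast
    qed
  qed
  then show ?thesis by auto
qed

text \<open>A left inverse of the inclusion of the last face. It is not a chain map, but it maps the horn to the boundary of
  the last face and preserves degenerate chains, which allows cancelling the inclusion (\<open>last_face_cancel\<close>).\<close>

definition last_restriction :: "nat \<Rightarrow> nat \<Rightarrow> ((nat \<Rightarrow> nat) \<Rightarrow> 'a) \<Rightarrow> (nat \<Rightarrow> nat) \<Rightarrow> 'a" where
  "last_restriction k m x = (\<lambda>u. if u \<in> ordmaps m k then x (compose {..m} (coface (Suc k) (Suc k)) u) else 0)"

lemma last_restriction_linear: "linear_map_on (lev (T (Suc k)) m) (lev (T k) m) (last_restriction k m)"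
proof -
  have "last_restriction k m x \<in> lev (T k) m" if "x \<in> lev (T (Suc k)) m" for x
    using T_value_mem[OF that] by (auto simp: last_restriction_def T_lev)
  then show ?thesis by (auto simp: linear_map_on_def last_restriction_def fun_eq_iff)
qed

lemma last_coface_inj:
  assumes "u \<in> ordmaps m k" "w \<in> ordmaps m k"
    "compose {..m} (coface (Suc k) (Suc k)) u = compose {..m} (coface (Suc k) (Suc k)) w"
  shows "u = w"
  by (rule ordmaps_eqI[OF assms(1,2)]) (metis assms last_coface_image)

lemma last_restriction_single_face:
  assumes "w \<in> ordmaps m k"
  shows "last_restriction k m (single (compose {..m} (coface (Suc k) (Suc k)) w) v) = single w v"
proof
  fix u
  have "compose {..m} (coface (Suc k) (Suc k)) u = compose {..m} (coface (Suc k) (Suc k)) w \<longleftrightarrow> u = w"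
    if "u \<in> ordmaps m k"
    using last_coface_inj[OF that assms] by blast
  then show "last_restriction k m (single (compose {..m} (coface (Suc k) (Suc k)) w) v) u = single w v u"
    using assms by (auto simp only: last_restriction_def single_apply split: if_splits)
qed

lemma last_restriction_single_other:
  assumes "Suc k \<in> u ` {..m}"
  shows "last_restriction k m (single u v) = 0"
proof -
  have "compose {..m} (coface (Suc k) (Suc k)) w \<noteq> u" if "w \<in> ordmaps m k" for w
    using assms ordmaps_apply[OF that] last_coface_image[OF that] by fastforce
  then show ?thesis
    unfolding last_restriction_def by (intro ext) (auto simp only: single_apply zero_fun_apply split: if_splits)
qed

lemma last_restriction_last_face:
  assumes x: "x \<in> lev (T k) m"
  shows "last_restriction k m (last_face k m x) = x"
  by (rule T_linear_eq[OF linear_map_on_comp[OF last_face_linear last_restriction_linear] id_linear x])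
    (simp add: tensor_map_single last_restriction_single_face)

lemma last_restriction_missing:
  assumes "x \<in> missing (Suc k) {..<Suc k} m"
  shows "last_restriction k m x \<in> missing k {..k} m"
proof -
  have "last_restriction k m x u = 0" if "{..k} \<subseteq> u ` {..m}" for u
  proof (cases "u \<in> ordmaps m k")
    case True
    then have "{..<Suc k} \<subseteq> compose {..m} (coface (Suc k) (Suc k)) u ` {..m}"
      using that last_coface_image[OF True] by (auto simp: image_iff subset_iff less_Suc_eq_le)
    then show ?thesis using assms by (auto simp: last_restriction_def missing_def)
  qed (simp add: last_restriction_def)
  then show ?thesis
    using linear_map_on_mem[OF last_restriction_linear] assms by (auto simp: missing_def)
qed

lemma last_restriction_degen:
  assumes x: "x \<in> degen (T (Suc k)) m"
  shows "last_restriction k m x \<in> degen (T k) m"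
proof (cases m)
  case 0
  then have "x = 0" using x degen_0 by auto
  then show ?thesis
    using linear_map_on_zero[OF last_restriction_linear subspace_T_lev] subspace_0[OF subspace_degen] by simp
next
  case (Suc n)
  have "last_restriction k (Suc n) (single (compose {..Suc n} u (codegeneracy n j)) (degeneracy V n j v)) \<in> degen (T k) (Suc n)"
    if u: "u \<in> ordmaps n (Suc k)" "v \<in> lev V n" "j \<le> n" for u v j
  proof (cases "Suc k \<in> u ` {..n}")
    case True
    then obtain x where x: "x \<le> n" "u x = Suc k" by auto
    have "Suc k \<in> compose {..Suc n} u (codegeneracy n j) ` {..Suc n}"
      using x by (intro image_eqI[of _ _ "if x \<le> j then x else Suc x"]) (auto simp: compose_apply codegeneracy_apply)
    then show ?thesis
      using last_restriction_single_other subspace_0[OF subspace_degen] by metis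
  next
    case False
    then obtain u' where u': "u' \<in> ordmaps n k" "u = compose {..n} (coface (Suc k) (Suc k)) u'"
      using missing_last_vertex[OF u(1)] by auto
    have "last_restriction k (Suc n) (single (compose {..Suc n} u (codegeneracy n j)) (degeneracy V n j v)) =
        single (compose {..Suc n} u' (codegeneracy n j)) (degeneracy V n j v)"
      unfolding u'(2) compose_ordmaps_assoc[OF codegeneracy_ordmaps[OF u(3)]]
      by (rule last_restriction_single_face[OF compose_ordmaps[OF codegeneracy_ordmaps[OF u(3)] u'(1)]])
    also have "\<dots> = degeneracy (T k) n j (single u' v)"
      using T_degeneracy_single[OF u'(1) u(3)] by simp
    finally show ?thesis using degeneracy_in_degen[OF u(3) single_mem[OF u'(1) u(2)]] by simp
  qed
  then show ?thesis
    using degen_T_linear_mem[OF last_restriction_linear subspace_degen x[unfolded Suc]] Suc by simp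
qed

end

section \<open>Contracting the simplex onto its last vertex\<close>

text \<open>One summand of the prism over \<open>u : [m] \<rightarrow> [k]\<close>: the vertex \<open>t\<close> is doubled, and everything behind the first copy is
  moved to the last vertex \<open>k\<close>.\<close>

definition cone :: "nat \<Rightarrow> nat \<Rightarrow> nat \<Rightarrow> (nat \<Rightarrow> nat) \<Rightarrow> nat \<Rightarrow> nat" where
  "cone k m t u = (\<lambda>x\<in>{..Suc m}. if x \<le> t then u x else k)"

lemma cone_apply: "cone k m t u x = (if x \<le> Suc m then if x \<le> t then u x else k else undefined)"
  by (simp add: cone_def)

lemma cone_ordmaps:
  assumes "u \<in> ordmaps m k" "t \<le> m"
  shows "cone k m t u \<in> ordmaps (Suc m) k"
  using assms by (intro ordmapsI) (auto simp: cone_apply ordmaps_apply ordmaps_mono)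

lemma cone_coface_less:
  assumes "u \<in> ordmaps (Suc m) k" "i < t" "t \<le> Suc m"
  shows "compose {..Suc m} (cone k (Suc m) t u) (coface (Suc (Suc m)) i) =
    cone k m (t - 1) (compose {..m} u (coface (Suc m) i))"
  using assms by (auto simp: fun_eq_iff compose_apply coface_apply cone_apply)

lemma cone_coface_greater:
  assumes "u \<in> ordmaps (Suc m) k" "Suc t < i" "i \<le> Suc (Suc m)"
  shows "compose {..Suc m} (cone k (Suc m) t u) (coface (Suc (Suc m)) i) =
    cone k m t (compose {..m} u (coface (Suc m) (i - 1)))"
  using assms by (auto simp: fun_eq_iff compose_apply coface_apply cone_apply)

lemma cone_coface_same:
  assumes "t \<le> m"
  shows "compose {..m} (cone k m t u) (coface (Suc m) t) = (\<lambda>x\<in>{..m}. if x < t then u x else k)"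
    and "compose {..m} (cone k m t u) (coface (Suc m) (Suc t)) = (\<lambda>x\<in>{..m}. if x < Suc t then u x else k)"
  using assms by (auto simp: fun_eq_iff compose_apply coface_apply cone_apply)

lemma cone_codegeneracy_le:
  assumes "t \<le> j" "j \<le> m"
  shows "cone k (Suc m) t (compose {..Suc m} u (codegeneracy m j)) =
    compose {..Suc (Suc m)} (cone k m t u) (codegeneracy (Suc m) (Suc j))"
  using assms by (auto simp: fun_eq_iff compose_apply codegeneracy_apply cone_apply)

lemma cone_codegeneracy_greater:
  assumes "j < t" "t \<le> Suc m"
  shows "cone k (Suc m) t (compose {..Suc m} u (codegeneracy m j)) =
    compose {..Suc (Suc m)} (cone k m (t - 1) u) (codegeneracy (Suc m) j)"
  using assms by (auto simp: fun_eq_iff compose_apply codegeneracy_apply cone_apply)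

context simplicial_vector_space
begin

text \<open>The chain homotopy that belongs to the contraction of \<open>\<Delta>[k]\<close> onto its last vertex.\<close>

definition prism :: "nat \<Rightarrow> nat \<Rightarrow> ((nat \<Rightarrow> nat) \<Rightarrow> 'a) \<Rightarrow> (nat \<Rightarrow> nat) \<Rightarrow> 'a" where
  "prism k m x = (\<Sum>t\<le>m. (- 1) ^ t *\<^sub>R (\<Sum>u\<in>ordmaps m k. single (cone k m t u) (degeneracy V m t (x u))))"

lemma prism_linear: "linear_map_on (lev (T k) m) (lev (T k) (Suc m)) (prism k m)"
  unfolding prism_def
  by (intro linear_map_on_sum_fun linear_map_on_scale_fun subspace_T_lev reindexing_linear)
    (auto intro: cone_ordmaps degeneracy_linear)

lemma prism_single:
  assumes "u \<in> ordmaps m k"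
  shows "prism k m (single u v) = (\<Sum>t\<le>m. (- 1) ^ t *\<^sub>R single (cone k m t u) (degeneracy V m t v))"
  unfolding prism_def by (intro sum.cong refl) (auto simp: reindexing_single[OF assms degeneracy_linear])

lemma prism_missing:
  assumes x: "x \<in> missing k {..<k} m"
  shows "prism k m x \<in> missing k {..<k} (Suc m)"
proof (rule missing_linear_mem[OF prism_linear subspace_missing x])
  fix u v a assume u: "u \<in> ordmaps m k" "v \<in> lev V m" "a \<in> {..<k}" "a \<notin> u ` {..m}"
  have "single (cone k m t u) (degeneracy V m t v) \<in> missing k {..<k} (Suc m)" if "t \<le> m" for t
    by (rule single_missing[OF cone_ordmaps[OF u(1) that] degeneracy_mem[OF that u(2)] u(3)])
      (use u that in \<open>auto simp: cone_apply\<close>)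
  then show "prism k m (single u v) \<in> missing k {..<k} (Suc m)"
    unfolding prism_single[OF u(1)]
    by (intro subspace_sum[OF subspace_missing] subspace_scale[OF subspace_missing]) auto
qed

lemma prism_degen:
  assumes x: "x \<in> degen (T k) m"
  shows "prism k m x \<in> degen (T k) (Suc m)"
proof (cases m)
  case 0
  then have "x = 0" using x degen_0 by auto
  then show ?thesis
    using linear_map_on_zero[OF prism_linear subspace_T_lev] subspace_0[OF subspace_degen] by simp
next
  case (Suc n)
  have "single (cone k (Suc n) t (compose {..Suc n} u (codegeneracy n j))) (degeneracy V (Suc n) t (degeneracy V n j v))
      \<in> degen (T k) (Suc (Suc n))"
    if u: "u \<in> ordmaps n k" "v \<in> lev V n" "j \<le> n" and t: "t \<le> Suc n" for u v j t
  proof (cases "t \<le> j")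
    case True
    then have tn: "t \<le> n" "Suc j \<le> Suc n" using u(3) by auto
    have "single (cone k (Suc n) t (compose {..Suc n} u (codegeneracy n j))) (degeneracy V (Suc n) t (degeneracy V n j v)) =
        degeneracy (T k) (Suc n) (Suc j) (single (cone k n t u) (degeneracy V n t v))"
      unfolding T_degeneracy_single[OF cone_ordmaps[OF u(1) tn(1)] tn(2)]
        cone_codegeneracy_le[OF True u(3)] degeneracy_degeneracy[OF True u(3,2)] ..
    then show ?thesis
      using degeneracy_in_degen[OF tn(2) single_mem[OF cone_ordmaps[OF u(1) tn(1)] degeneracy_mem[OF tn(1) u(2)]]] by simp
  next
    case False
    then have jt: "j < t" "j \<le> t - 1" "t - 1 \<le> n" "Suc (t - 1) = t" "j \<le> Suc n" using t u(3) by auto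
    have "single (cone k (Suc n) t (compose {..Suc n} u (codegeneracy n j))) (degeneracy V (Suc n) t (degeneracy V n j v)) =
        degeneracy (T k) (Suc n) j (single (cone k n (t - 1) u) (degeneracy V n (t - 1) v))"
      unfolding T_degeneracy_single[OF cone_ordmaps[OF u(1) jt(3)] jt(5)]
        cone_codegeneracy_greater[OF jt(1) t] degeneracy_degeneracy[OF jt(2,3) u(2)] jt(4) ..
    then show ?thesis
      using degeneracy_in_degen[OF jt(5) single_mem[OF cone_ordmaps[OF u(1) jt(3)] degeneracy_mem[OF jt(3) u(2)]]] by simp
  qed
  then have "prism k (Suc n) (single (compose {..Suc n} u (codegeneracy n j)) (degeneracy V n j v)) \<in> degen (T k) (Suc (Suc n))"
    if "u \<in> ordmaps n k" "v \<in> lev V n" "j \<le> n" for u v j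
    unfolding prism_single[OF compose_ordmaps[OF codegeneracy_ordmaps[OF that(3)] that(1)]]
    using that by (intro subspace_sum[OF subspace_degen] subspace_scale[OF subspace_degen]) auto
  then show ?thesis
    using degen_T_linear_mem[OF prism_linear subspace_degen x[unfolded Suc]] Suc by simp
qed

text \<open>The terms \<open>d\<^sub>i h\<^sub>t\<close> with \<open>i < t\<close> or \<open>i > t + 1\<close> cancel against the prism of the boundary; those with
  \<open>i = t\<close> and \<open>i = t + 1\<close> telescope to the difference of the constant simplex and \<open>u\<close>.\<close>

lemma bd_prism_single:
  assumes u: "u \<in> ordmaps (Suc m) k" and v: "v \<in> lev V (Suc m)"
  shows "alternating_bd (T k) (Suc (Suc m)) (prism k (Suc m) (single u v)) +
      prism k m (alternating_bd (T k) (Suc m) (single u v)) + single u v =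
    single (\<lambda>x\<in>{..Suc m}. k) v"
proof -
  let ?G = "\<lambda>t i. (- 1) ^ (t + i) *\<^sub>R single (compose {..Suc m} (cone k (Suc m) t u) (coface (Suc (Suc m)) i))
      (face V (Suc (Suc m)) i (degeneracy V (Suc m) t v))"
  let ?H = "\<lambda>s i. (- 1) ^ (s + i) *\<^sub>R single (cone k m s (compose {..m} u (coface (Suc m) i)))
      (degeneracy V m s (face V (Suc m) i v))"
  let ?R = "\<lambda>t. single (\<lambda>x\<in>{..Suc m}. if x < t then u x else k) v"
  let ?I = "{..Suc m} \<times> {..Suc (Suc m)}" and ?J = "{..m} \<times> {..Suc m}"
  \<comment> \<open>The pairs in \<open>C\<close> are those whose face undoes the degeneracy of \<open>v\<close>.\<close>
  define A B C where "A = {(t, i). t \<le> Suc m \<and> i < t}"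
    and "B = {(t, i). t \<le> Suc m \<and> Suc t < i \<and> i \<le> Suc (Suc m)}"
    and "C = (\<lambda>t. (t, t)) ` {..Suc m} \<union> (\<lambda>t. (t, Suc t)) ` {..Suc m}"
  define A' B' where "A' = {(s, i). s \<le> m \<and> i \<le> s}" and "B' = {(s, i). s \<le> m \<and> s < i \<and> i \<le> Suc m}"
  have I: "?I = (A \<union> B) \<union> C" "A \<inter> B = {}" "(A \<union> B) \<inter> C = {}"
    unfolding A_def B_def C_def by (auto simp: image_iff)
  have J: "?J = A' \<union> B'" "A' \<inter> B' = {}"
    unfolding A'_def B'_def by auto
  have fin: "finite A" "finite B" "finite C" "finite A'" "finite B'"
    using I(1) J(1) by (metis finite_SigmaI finite_atMost finite_Un)+
  have mem: "single (cone k (Suc m) t u) (degeneracy V (Suc m) t v) \<in> lev (T k) (Suc (Suc m))" if "t \<le> Suc m" for t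
    using single_mem[OF cone_ordmaps[OF u that] degeneracy_mem[OF that v]] .
  have "alternating_bd (T k) (Suc (Suc m)) (prism k (Suc m) (single u v)) =
      (\<Sum>t\<le>Suc m. alternating_bd (T k) (Suc (Suc m)) ((- 1) ^ t *\<^sub>R single (cone k (Suc m) t u) (degeneracy V (Suc m) t v)))"
    unfolding prism_single[OF u]
    by (rule linear_map_on_sum[OF T_bd_linear subspace_T_lev]) (use mem subspace_scale[OF subspace_T_lev] in auto)
  also have "\<dots> = (\<Sum>t\<le>Suc m. \<Sum>i\<le>Suc (Suc m). ?G t i)"
  proof (rule sum.cong[OF refl])
    fix t assume "t \<in> {..Suc m}"
    then have t: "t \<le> Suc m" by simp
    show "alternating_bd (T k) (Suc (Suc m)) ((- 1) ^ t *\<^sub>R single (cone k (Suc m) t u) (degeneracy V (Suc m) t v)) =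
        (\<Sum>i\<le>Suc (Suc m). ?G t i)"
      unfolding linear_map_on_scale[OF T_bd_linear mem[OF t]] T_bd_single[OF cone_ordmaps[OF u t]]
      by (simp add: scaleR_sum_right power_add del: sum.atMost_Suc)
  qed
  also have "\<dots> = (\<Sum>(t, i)\<in>?I. ?G t i)"
    by (rule sum.cartesian_product)
  also have "\<dots> = (\<Sum>(t, i)\<in>A. ?G t i) + (\<Sum>(t, i)\<in>B. ?G t i) + (\<Sum>(t, i)\<in>C. ?G t i)"
    unfolding I(1) sum.union_disjoint[OF finite_UnI[OF fin(1,2)] fin(3) I(3)] sum.union_disjoint[OF fin(1,2) I(2)] ..
  also have "(\<Sum>(t, i)\<in>A. ?G t i) = (\<Sum>(s, i)\<in>A'. - ?H s i)"
  proof (rule sum.reindex_bij_witness[where j = "\<lambda>(t, i). (t - 1, i)" and i = "\<lambda>(s, i). (Suc s, i)"])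
    fix a assume "a \<in> A"
    then obtain t i where a: "a = (t, i)" "t \<le> Suc m" "i < t" by (auto simp: A_def)
    have "(- 1) ^ (t + i) = - ((- 1) ^ (t - 1 + i) :: real)" using a(3) by (cases t) auto
    then show "(case case a of (t, i) \<Rightarrow> (t - 1, i) of (s, i) \<Rightarrow> - ?H s i) = (case a of (t, i) \<Rightarrow> ?G t i)"
      using cone_coface_less[OF u a(3,2)] face_degeneracy_less[OF a(3,2) v] a by simp
  qed (auto simp: A_def A'_def)
  also have "(\<Sum>(t, i)\<in>B. ?G t i) = (\<Sum>(s, i)\<in>B'. - ?H s i)"
  proof (rule sum.reindex_bij_witness[where j = "\<lambda>(t, i). (t, i - 1)" and i = "\<lambda>(s, i). (s, Suc i)"])
    fix a assume "a \<in> B"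
    then obtain t i where a: "a = (t, i)" "t \<le> Suc m" "Suc t < i" "i \<le> Suc (Suc m)" by (auto simp: B_def)
    have "(- 1) ^ (t + i) = - ((- 1) ^ (t + (i - 1)) :: real)" using a(3) by (cases i) auto
    then show "(case case a of (t, i) \<Rightarrow> (t, i - 1) of (s, i) \<Rightarrow> - ?H s i) = (case a of (t, i) \<Rightarrow> ?G t i)"
      using cone_coface_greater[OF u a(3,4)] face_degeneracy_greater[OF a(3,4) v] a by simp
  qed (auto simp: B_def B'_def)
  also have "(\<Sum>(s, i)\<in>A'. - ?H s i) + (\<Sum>(s, i)\<in>B'. - ?H s i) = - (\<Sum>(s, i)\<in>?J. ?H s i)"
    unfolding J(1) sum.union_disjoint[OF fin(4,5) J(2)] by (simp add: sum_negf case_prod_unfold)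
  also have "(\<Sum>(t, i)\<in>C. ?G t i) = (\<Sum>t\<le>Suc m. ?R t) - (\<Sum>t\<le>Suc m. ?R (Suc t))"
  proof -
    have "(\<Sum>(t, i)\<in>C. ?G t i) = (\<Sum>t\<le>Suc m. ?G t t) + (\<Sum>t\<le>Suc m. ?G t (Suc t))"
      unfolding C_def
      by (subst sum.union_disjoint) (auto simp: sum.reindex inj_on_def simp del: sum.atMost_Suc)
    moreover have "?G t t = ?R t" if "t \<in> {..Suc m}" for t
      using that cone_coface_same(1)[of t "Suc m" k u] face_degeneracy_id[of t t "Suc m" v] v by (simp add: mult_2[symmetric])
    moreover have "?G t (Suc t) = - ?R (Suc t)" if "t \<in> {..Suc m}" for t
      using that cone_coface_same(2)[of t "Suc m" k u] face_degeneracy_id[of "Suc t" t "Suc m" v] v by (simp add: mult_2[symmetric])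
    ultimately show ?thesis by (simp add: sum_negf del: sum.atMost_Suc)
  qed
  also have "\<dots> = ?R 0 - ?R (Suc (Suc m))"
    using sum_telescope[of ?R "Suc m"] by (simp add: sum_subtractf del: sum.atMost_Suc)
  also have "?R (Suc (Suc m)) = single u v"
    by (rule arg_cong[where f = "\<lambda>u. single u v"], rule ordmaps_eqI[OF ordmapsI[of _ _ k] u])
      (auto simp: ordmaps_apply[OF u] ordmaps_mono[OF u])
  also have "(\<Sum>(s, i)\<in>?J. ?H s i) = prism k m (alternating_bd (T k) (Suc m) (single u v))"
  proof -
    have cu: "compose {..m} u (coface (Suc m) i) \<in> ordmaps m k" for i
      using compose_ordmaps[OF coface_ordmaps u] .
    have fm: "single (compose {..m} u (coface (Suc m) i)) (face V (Suc m) i v) \<in> lev (T k) m" for i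
      using single_mem[OF cu face_mem[OF v]] .
    have "prism k m (alternating_bd (T k) (Suc m) (single u v)) =
        (\<Sum>i\<le>Suc m. prism k m ((- 1) ^ i *\<^sub>R single (compose {..m} u (coface (Suc m) i)) (face V (Suc m) i v)))"
      unfolding T_bd_single[OF u]
      by (rule linear_map_on_sum[OF prism_linear subspace_T_lev]) (use fm subspace_scale[OF subspace_T_lev] in auto)
    also have "\<dots> = (\<Sum>i\<le>Suc m. \<Sum>s\<le>m. ?H s i)"
      unfolding linear_map_on_scale[OF prism_linear fm] prism_single[OF cu]
      by (simp add: scaleR_sum_right power_add mult.commute del: sum.atMost_Suc)
    also have "\<dots> = (\<Sum>s\<le>m. \<Sum>i\<le>Suc m. ?H s i)"
      by (rule sum.swap)
    also have "\<dots> = (\<Sum>(s, i)\<in>?J. ?H s i)"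
      by (rule sum.cartesian_product)
    finally show ?thesis ..
  qed
  finally have eq: "alternating_bd (T k) (Suc (Suc m)) (prism k (Suc m) (single u v)) =
    - prism k m (alternating_bd (T k) (Suc m) (single u v)) + (?R 0 - single u v)" .
  have "- p + (r - s) + p + s = r" for p r s :: "(nat \<Rightarrow> nat) \<Rightarrow> 'a" by simp
  then show ?thesis unfolding eq by (simp only: not_less0 if_False)
qed

lemma bd_prism:
  assumes x: "x \<in> lev (T k) (Suc m)" and k: "k > 0"
  shows "alternating_bd (T k) (Suc (Suc m)) (prism k (Suc m) x) + prism k m (alternating_bd (T k) (Suc m) x) + x
    \<in> missing k {..<k} (Suc m)"
proof (rule T_linear_mem[OF _ subspace_missing x])
  have "linear_map_on (lev (T k) (Suc m)) UNIV
      (\<lambda>x. alternating_bd (T k) (Suc (Suc m)) (prism k (Suc m) x))"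
    by (rule linear_map_on_subset[OF linear_map_on_comp[OF prism_linear T_bd_linear]]) auto
  moreover have "linear_map_on (lev (T k) (Suc m)) UNIV (\<lambda>x. prism k m (alternating_bd (T k) (Suc m) x))"
    by (rule linear_map_on_subset[OF linear_map_on_comp[OF T_bd_linear prism_linear]]) auto
  ultimately show "linear_map_on (lev (T k) (Suc m)) UNIV
      (\<lambda>x. alternating_bd (T k) (Suc (Suc m)) (prism k (Suc m) x) + prism k m (alternating_bd (T k) (Suc m) x) + x)"
    by (auto simp: linear_map_on_def algebra_simps)
  fix u assume u: "u \<in> ordmaps (Suc m) k"
  have "(\<lambda>x\<in>{..Suc m}. k) \<in> ordmaps (Suc m) k"
    by (intro ordmapsI) auto
  then show "alternating_bd (T k) (Suc (Suc m)) (prism k (Suc m) (single u (x u))) +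
      prism k m (alternating_bd (T k) (Suc m) (single u (x u))) + single u (x u) \<in> missing k {..<k} (Suc m)"
    unfolding bd_prism_single[OF u T_value_mem[OF x]]
    using k by (intro single_missing[where a = 0] T_value_mem[OF x]) auto
qed

text \<open>The contraction onto the last vertex preserves the horn as well as the degenerate chains, so it contracts the
  quotient of \<open>V \<otimes> \<Delta>[k]\<close> by both. The constant simplex at the last vertex lies in the horn because \<open>k > 0\<close>.\<close>

lemma horn_acyclic:
  assumes c: "c \<in> lev (T k) (Suc m)" and k: "k > 0"
    and l: "l \<in> missing k {..<k} m" and d: "d \<in> degen (T k) m"
    and bd: "alternating_bd (T k) (Suc m) c = l + d"
  shows "\<exists>y\<in>lev (T k) (Suc (Suc m)). \<exists>l'\<in>missing k {..<k} (Suc m). \<exists>d'\<in>degen (T k) (Suc m).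
    c = alternating_bd (T k) (Suc (Suc m)) y + l' + d'"
proof -
  let ?y = "prism k (Suc m) c"
  define r where "r = alternating_bd (T k) (Suc (Suc m)) ?y + prism k m (l + d) + c"
  have r: "r \<in> missing k {..<k} (Suc m)" using bd_prism[OF c k] by (simp add: r_def bd)
  have y: "?y \<in> lev (T k) (Suc (Suc m))" using linear_map_on_mem[OF prism_linear c] .
  have "prism k m (l + d) = prism k m l + prism k m d"
    by (rule linear_map_on_add[OF prism_linear]) (use subsetD[OF missing_subset l] subsetD[OF T_degen_subset d] in auto)
  moreover have "alternating_bd (T k) (Suc (Suc m)) (- ?y) = - alternating_bd (T k) (Suc (Suc m)) ?y"
    by (rule linear_map_on_neg[OF T_bd_linear subspace_T_lev y])
  ultimately have "c = alternating_bd (T k) (Suc (Suc m)) (- ?y) + (r - prism k m l) + (- prism k m d)"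
    by (simp add: r_def)
  moreover have "r - prism k m l \<in> missing k {..<k} (Suc m)"
    using subspace_diff[OF subspace_missing r prism_missing[OF l]] .
  moreover have "- prism k m d \<in> degen (T k) (Suc m)"
    using subspace_neg[OF subspace_degen prism_degen[OF d]] .
  moreover have "- ?y \<in> lev (T k) (Suc (Suc m))" using subspace_neg[OF subspace_T_lev y] .
  ultimately show ?thesis by blast
qed

end

section \<open>The shuffle product with a simplex\<close>

text \<open>A \<open>(k, n - k)\<close>-shuffle is a lattice path from \<open>(0, 0)\<close> to \<open>(k, n - k)\<close> with unit steps. It is encoded by the set
  \<open>S\<close> of those times \<open>t < n\<close> at which it steps in the first direction; \<open>hpos\<close> and \<open>vpos\<close> below are its two
  coordinates, as maps \<open>[n] \<rightarrow> [k]\<close> and \<open>[n] \<rightarrow> [n - k]\<close>.\<close>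

definition lattice_paths :: "nat \<Rightarrow> nat \<Rightarrow> nat set set" where
  "lattice_paths n k = {S. S \<subseteq> {..<n} \<and> card S = k}"

definition steps_before :: "nat set \<Rightarrow> nat \<Rightarrow> nat" where
  "steps_before S t = card (S \<inter> {..<t})"

definition hpos :: "nat \<Rightarrow> nat set \<Rightarrow> nat \<Rightarrow> nat" where
  "hpos n S = (\<lambda>t\<in>{..n}. steps_before S t)"

definition vpos :: "nat \<Rightarrow> nat set \<Rightarrow> nat \<Rightarrow> nat" where
  "vpos n S = (\<lambda>t\<in>{..n}. t - steps_before S t)"

text \<open>The sign of a shuffle up to a factor that depends only on \<open>card S\<close>: the number of inversions is
  \<open>\<Sum>S - card S * (card S - 1) / 2\<close>.\<close>

definition path_sign :: "nat set \<Rightarrow> real" where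
  "path_sign S = (- 1) ^ \<Sum>S"

lemma finite_lattice_paths: "finite (lattice_paths n k)"
  unfolding lattice_paths_def by (rule finite_subset[of _ "Pow {..<n}"]) auto

lemma finite_path: "S \<in> lattice_paths n k \<Longrightarrow> finite S"
  unfolding lattice_paths_def by (auto intro: finite_subset)

lemma steps_before_0: "steps_before S 0 = 0"
  by (simp add: steps_before_def)

lemma steps_before_Suc: "steps_before S (Suc t) = steps_before S t + (if t \<in> S then 1 else 0)"
proof -
  have "S \<inter> {..<Suc t} = (if t \<in> S then insert t (S \<inter> {..<t}) else S \<inter> {..<t})"
    by (auto simp: less_Suc_eq)
  then show ?thesis by (simp add: steps_before_def)
qed

lemma steps_before_le: "steps_before S t \<le> t"
  by (induction t) (auto simp: steps_before_0 steps_before_Suc)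

lemma steps_before_mono: "x \<le> y \<Longrightarrow> steps_before S x \<le> steps_before S y"
  by (induction y rule: dec_induct) (auto simp: steps_before_Suc)

lemma steps_not_before_mono: "x \<le> y \<Longrightarrow> x - steps_before S x \<le> y - steps_before S y"
proof (induction y rule: dec_induct)
  case (step y)
  then show ?case using steps_before_le[of S y] by (auto simp: steps_before_Suc)
qed simp

lemma steps_before_all: "S \<subseteq> {..<n} \<Longrightarrow> steps_before S n = card S"
  by (simp add: steps_before_def Int_absorb2)

lemma hpos_ordmaps: "S \<in> lattice_paths n k \<Longrightarrow> hpos n S \<in> ordmaps n k"
  using steps_before_mono[of _ n S] steps_before_all[of S n]
  by (intro ordmapsI) (auto simp: hpos_def lattice_paths_def steps_before_mono)

lemma vpos_ordmaps: "S \<in> lattice_paths n k \<Longrightarrow> n = k + j \<Longrightarrow> vpos n S \<in> ordmaps n j"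
  using steps_not_before_mono[of _ n S] steps_before_all[of S n]
  by (intro ordmapsI) (fastforce simp: vpos_def lattice_paths_def steps_not_before_mono)+

text \<open>At a corner \<open>Suc r\<close>, where exactly one of the steps \<open>r\<close> and \<open>Suc r\<close> belongs to \<open>S\<close>, this exchanges the two
  steps and so replaces the corner by the opposite one, without changing any other vertex of the path.\<close>

definition flip :: "nat \<Rightarrow> nat set \<Rightarrow> nat set" where
  "flip r S = (S - {r, Suc r}) \<union> ({r, Suc r} - S)"

lemma flip_flip: "flip r (flip r S) = S"
  by (auto simp: flip_def)

lemma steps_before_flip:
  assumes "(r \<in> S) \<noteq> (Suc r \<in> S)" "x \<noteq> Suc r"
  shows "steps_before (flip r S) x = steps_before S x"
proof (cases "x \<le> r")
  case True
  then have "flip r S \<inter> {..<x} = S \<inter> {..<x}" by (auto simp: flip_def)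
  then show ?thesis by (simp add: steps_before_def)
next
  case False
  then have x: "Suc (Suc r) \<le> x" using assms(2) by simp
  have "flip r S \<inter> {..<r} = S \<inter> {..<r}" by (auto simp: flip_def)
  then have "steps_before (flip r S) r = steps_before S r" by (simp add: steps_before_def)
  moreover have "r \<in> flip r S \<longleftrightarrow> r \<notin> S" "Suc r \<in> flip r S \<longleftrightarrow> Suc r \<notin> S" by (auto simp: flip_def)
  ultimately have *: "steps_before (flip r S) (Suc (Suc r)) = steps_before S (Suc (Suc r))"
    using assms(1) by (auto simp: steps_before_Suc)
  show ?thesis
    using x
  proof (induction x rule: dec_induct)
    case (step y)
    then have "y \<in> flip r S \<longleftrightarrow> y \<in> S" by (auto simp: flip_def)
    with step show ?case by (simp add: steps_before_Suc)
  qed (rule *)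
qed

lemma flip_lattice_paths:
  assumes S: "S \<in> lattice_paths n k" and c: "(r \<in> S) \<noteq> (Suc r \<in> S)" and r: "Suc r < n"
  shows "flip r S \<in> lattice_paths n k"
proof -
  have sub: "flip r S \<subseteq> {..<n}" "S \<subseteq> {..<n}" using S r by (auto simp: flip_def lattice_paths_def)
  show ?thesis
    using steps_before_flip[OF c, of n] steps_before_all[OF sub(1)] steps_before_all[OF sub(2)] sub S r
    by (simp add: lattice_paths_def)
qed

lemma path_sign_flip:
  assumes "finite S" "(r \<in> S) \<noteq> (Suc r \<in> S)"
  shows "path_sign (flip r S) = - path_sign S"
proof -
  have *: "path_sign (insert (Suc r) R) = - path_sign (insert r R)" if "finite R" "r \<notin> R" "Suc r \<notin> R" for R
    using that by (simp add: path_sign_def)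
  show ?thesis
  proof (cases "r \<in> S")
    case True
    then have "flip r S = insert (Suc r) (S - {r})" "S = insert r (S - {r})" using assms by (auto simp: flip_def)
    then show ?thesis using *[of "S - {r}"] assms True by (metis Diff_iff finite_Diff insertCI)
  next
    case False
    then have "flip r S = insert r (S - {Suc r})" "S = insert (Suc r) (S - {Suc r})" using assms by (auto simp: flip_def)
    then show ?thesis using *[of "S - {Suc r}"] assms False by (metis Diff_iff finite_Diff insertCI minus_minus)
  qed
qed

lemma hpos_flip:
  assumes "(r \<in> S) \<noteq> (Suc r \<in> S)"
  shows "compose {..N} (hpos (Suc N) (flip r S)) (coface (Suc N) (Suc r)) =
      compose {..N} (hpos (Suc N) S) (coface (Suc N) (Suc r))"
    and "compose {..N} (vpos (Suc N) (flip r S)) (coface (Suc N) (Suc r)) =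
      compose {..N} (vpos (Suc N) S) (coface (Suc N) (Suc r))"
proof -
  have "coface (Suc N) (Suc r) x \<noteq> Suc r" if "x \<le> N" for x
    using that by (auto simp: coface_apply)
  then show "compose {..N} (hpos (Suc N) (flip r S)) (coface (Suc N) (Suc r)) =
      compose {..N} (hpos (Suc N) S) (coface (Suc N) (Suc r))"
    "compose {..N} (vpos (Suc N) (flip r S)) (coface (Suc N) (Suc r)) =
      compose {..N} (vpos (Suc N) S) (coface (Suc N) (Suc r))"
    using steps_before_flip[OF assms] by (auto simp: fun_eq_iff compose_apply hpos_def vpos_def)
qed

text \<open>At a straight vertex the first coordinate takes three successive values, and deleting the vertex omits the middle
  one.\<close>

lemma hpos_straight:
  assumes "t \<in> S" "t > 0 \<Longrightarrow> t - 1 \<in> S"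
  shows "steps_before S t \<notin> compose {..N} (hpos (Suc N) S) (coface (Suc N) t) ` {..N}"
proof
  assume "steps_before S t \<in> compose {..N} (hpos (Suc N) S) (coface (Suc N) t) ` {..N}"
  then obtain x where x: "x \<le> N" "steps_before S t = steps_before S (if x < t then x else Suc x)"
    by (auto simp: compose_apply hpos_def coface_apply split: if_splits)
  show False
  proof (cases "x < t")
    case True
    then obtain r where r: "t = Suc r" "x \<le> r" by (cases t) auto
    have "steps_before S x \<le> steps_before S r" using steps_before_mono[OF r(2)] .
    then show False using x True r assms by (simp add: steps_before_Suc)
  next
    case False
    then have "steps_before S (Suc t) \<le> steps_before S (Suc x)" using steps_before_mono by simp
    then show False using x False assms(1) by (simp add: steps_before_Suc)
  qed
qed

lemma vpos_straight:
  assumes "t \<notin> S" "t > 0 \<Longrightarrow> t - 1 \<notin> S"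
  shows "t - steps_before S t \<notin> compose {..N} (vpos (Suc N) S) (coface (Suc N) t) ` {..N}"
proof
  assume "t - steps_before S t \<in> compose {..N} (vpos (Suc N) S) (coface (Suc N) t) ` {..N}"
  then obtain x where x: "x \<le> N"
    "t - steps_before S t = (if x < t then x else Suc x) - steps_before S (if x < t then x else Suc x)"
    by (auto simp: compose_apply vpos_def coface_apply split: if_splits)
  show False
  proof (cases "x < t")
    case True
    then obtain r where r: "t = Suc r" "x \<le> r" by (cases t) auto
    have "x - steps_before S x \<le> r - steps_before S r" using steps_not_before_mono[OF r(2)] .
    moreover have "steps_before S t = steps_before S r" using r assms by (simp add: steps_before_Suc)
    ultimately show False using x True r steps_before_le[of S r] by simp
  next
    case False
    then have "Suc t - steps_before S (Suc t) \<le> Suc x - steps_before S (Suc x)"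
      using steps_not_before_mono by simp
    then show False using x False assms(1) steps_before_le[of S t] by (simp add: steps_before_Suc)
  qed
qed

context simplicial_vector_space
begin

text \<open>The Eilenberg--Zilber shuffle product of \<open>v\<close> with the top simplex of \<open>\<Delta>[k]\<close>.\<close>

definition EZ :: "nat \<Rightarrow> nat \<Rightarrow> 'a \<Rightarrow> (nat \<Rightarrow> nat) \<Rightarrow> 'a" where
  "EZ k j v = (\<Sum>S\<in>lattice_paths (k + j) k.
     path_sign S *\<^sub>R single (hpos (k + j) S) (pull V j (k + j) (vpos (k + j) S) v))"

lemma EZ_linear: "linear_map_on (lev V j) (lev (T k) (k + j)) (EZ k j)"
  unfolding EZ_def
proof (intro linear_map_on_sum_fun linear_map_on_scale_fun subspace_T_lev)
  fix S assume S: "S \<in> lattice_paths (k + j) k"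
  have "linear_map_on (lev V (k + j)) (lev (T k) (k + j)) (single (hpos (k + j) S))"
    using single_mem[OF hpos_ordmaps[OF S]] by (auto simp: linear_map_on_def single_add single_scale)
  then show "linear_map_on (lev V j) (lev (T k) (k + j)) (\<lambda>v. single (hpos (k + j) S) (pull V j (k + j) (vpos (k + j) S) v))"
    by (rule linear_map_on_comp[OF pull_linear[OF vpos_ordmaps[OF S refl]]])
qed

lemmas EZ_mem = linear_map_on_mem[OF EZ_linear]

lemma pull_normalized_zero:
  assumes v: "v \<in> normalized V j" and q: "q \<in> ordmaps l j" and b: "b < j" "b \<notin> q ` {..l}"
  shows "pull V j l q v = 0"
proof -
  obtain i where i: "j = Suc i" using b by (cases j) auto
  obtain q' where q': "q' \<in> ordmaps l i" "q = compose {..l} (coface (Suc i) b) q'"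
    using missing_last_vertex[of q l i b] q b i by auto
  have "pull V j l q v = pull V i l q' (face V j b v)"
    using pull_comp[OF q'(1) coface_ordmaps, of v b] v unfolding q'(2) i by (simp add: face_def normalized_def)
  then show ?thesis using v b pull_zero[OF q'(1)] by (simp add: normalized_def)
qed

text \<open>The Leibniz rule modulo the horn. Deleting a corner of a path yields the same chain as deleting the opposite
  corner of the flipped path, with the opposite sign. Deleting a straight vertex, or the first one, omits a vertex
  in one of the two coordinates: for the first coordinate the result lies in the horn, and for the second one it
  vanishes because \<open>v\<close> is normalized. What remains is the deletion of the end point, which yields the last face of
  \<open>\<Delta>[k]\<close> or the last face of \<open>v\<close>, according to the direction of the last step.\<close>

lemma bd_EZ:
  assumes v: "v \<in> normalized V j" and N: "k + j = Suc N"
  shows "alternating_bd (T k) (Suc N) (EZ k j v) + (if k = 0 then 0 else last_face (k - 1) N (EZ (k - 1) j v))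
     - (if j = 0 then 0 else (- 1) ^ k *\<^sub>R EZ k (j - 1) (differential V j v)) \<in> missing k {..<k} N"
proof -
  let ?P = "lattice_paths (Suc N) k"
  define G where "G t S = path_sign S *\<^sub>R single (compose {..N} (hpos (Suc N) S) (coface (Suc N) t))
     (pull V j N (compose {..N} (vpos (Suc N) S) (coface (Suc N) t)) v)" for t S
  have vl: "v \<in> lev V j" using v normalized_subset by auto
  have hv: "hpos (Suc N) S \<in> ordmaps (Suc N) k" "vpos (Suc N) S \<in> ordmaps (Suc N) j"
    "S \<subseteq> {..<Suc N}" "card S = k" "finite S" if "S \<in> ?P" for S
    using hpos_ordmaps[OF that] vpos_ordmaps[OF that, of j] N that finite_path[OF that] by (auto simp: lattice_paths_def)
  have mem: "single (hpos (Suc N) S) (pull V j (Suc N) (vpos (Suc N) S) v) \<in> lev (T k) (Suc N)" if "S \<in> ?P" for S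
    using single_mem[OF hv(1)[OF that] pull_mem[OF hv(2)[OF that] vl]] .
  have "alternating_bd (T k) (Suc N) (EZ k j v) = (\<Sum>S\<in>?P. alternating_bd (T k) (Suc N)
      (path_sign S *\<^sub>R single (hpos (Suc N) S) (pull V j (Suc N) (vpos (Suc N) S) v)))"
    unfolding EZ_def N
    by (rule linear_map_on_sum[OF T_bd_linear subspace_T_lev]) (use mem subspace_scale[OF subspace_T_lev] in auto)
  also have "\<dots> = (\<Sum>S\<in>?P. \<Sum>t\<le>Suc N. (- 1) ^ t *\<^sub>R G t S)"
  proof (rule sum.cong[OF refl])
    fix S assume S: "S \<in> ?P"
    have "face V (Suc N) t (pull V j (Suc N) (vpos (Suc N) S) v) =
        pull V j N (compose {..N} (vpos (Suc N) S) (coface (Suc N) t)) v" for t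
      using pull_comp[OF coface_ordmaps hv(2)[OF S] vl] by (simp add: face_def)
    then show "alternating_bd (T k) (Suc N)
        (path_sign S *\<^sub>R single (hpos (Suc N) S) (pull V j (Suc N) (vpos (Suc N) S) v)) = (\<Sum>t\<le>Suc N. (- 1) ^ t *\<^sub>R G t S)"
      unfolding linear_map_on_scale[OF T_bd_linear mem[OF S]] T_bd_single[OF hv(1)[OF S]] G_def
      by (simp add: scaleR_sum_right mult.commute del: sum.atMost_Suc)
  qed
  also have "\<dots> = (\<Sum>t\<le>Suc N. (- 1) ^ t *\<^sub>R (\<Sum>S\<in>?P. G t S))"
    by (subst sum.swap) (simp add: scaleR_sum_right del: sum.atMost_Suc)
  finally have bd: "alternating_bd (T k) (Suc N) (EZ k j v) =
      (\<Sum>t\<le>N. (- 1) ^ t *\<^sub>R (\<Sum>S\<in>?P. G t S)) + (- 1) ^ Suc N *\<^sub>R (\<Sum>S\<in>?P. G (Suc N) S)"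
    by simp
  have inner: "(\<Sum>S\<in>?P. G t S) \<in> missing k {..<k} N" if t: "t \<le> N" for t
  proof -
    \<comment> \<open>The paths that have a corner at \<open>t\<close>; their contributions cancel in pairs.\<close>
    define C where "C = {S \<in> ?P. t > 0 \<and> (t - 1 \<in> S) \<noteq> (t \<in> S)}"
    have "(\<Sum>S\<in>C. G t S) = 0"
    proof (cases t)
      case (Suc r)
      have fl: "flip r S \<in> C \<and> G t (flip r S) = - G t S" if "S \<in> C" for S
      proof -
        have S: "S \<in> ?P" "(r \<in> S) \<noteq> (Suc r \<in> S)" using that Suc by (auto simp: C_def)
        have "r \<in> flip r S \<longleftrightarrow> r \<notin> S" "Suc r \<in> flip r S \<longleftrightarrow> Suc r \<notin> S" by (auto simp: flip_def)
        then have "flip r S \<in> C" using flip_lattice_paths[OF S] t S Suc by (auto simp: C_def)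
        then show ?thesis
          using path_sign_flip[OF hv(5)[OF S(1)] S(2)] hpos_flip[OF S(2), of N] Suc by (simp add: G_def)
      qed
      have "(\<Sum>S\<in>C. G t S) = (\<Sum>S\<in>C. - G t S)"
        by (rule sum.reindex_bij_witness[where i = "flip r" and j = "flip r"]) (use fl flip_flip in auto)
      then have "(\<Sum>S\<in>C. G t S) = - (\<Sum>S\<in>C. G t S)" by (simp add: sum_negf)
      then have "(\<Sum>S\<in>C. G t S) + (\<Sum>S\<in>C. G t S) = 0" by (metis add.right_inverse)
      then have "2 *\<^sub>R (\<Sum>S\<in>C. G t S) = 0" by (simp add: scaleR_2)
      then show ?thesis by simp
    qed (simp add: C_def)
    moreover have "G t S \<in> missing k {..<k} N" if S: "S \<in> ?P - C" for S
    proof -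
      have SP: "S \<in> ?P" and straight: "t > 0 \<Longrightarrow> (t - 1 \<in> S) = (t \<in> S)" using S by (auto simp: C_def)
      have h: "compose {..N} (hpos (Suc N) S) (coface (Suc N) t) \<in> ordmaps N k"
        using compose_ordmaps[OF coface_ordmaps hv(1)[OF SP]] .
      have w: "compose {..N} (vpos (Suc N) S) (coface (Suc N) t) \<in> ordmaps N j"
        using compose_ordmaps[OF coface_ordmaps hv(2)[OF SP]] .
      show ?thesis
      proof (cases "t \<in> S")
        case True
        have "steps_before S (Suc t) \<le> k"
          using steps_before_mono[of "Suc t" "Suc N" S] steps_before_all[OF hv(3)[OF SP]] hv(4)[OF SP] t by simp
        then have "steps_before S t \<in> {..<k}" using True by (simp add: steps_before_Suc)
        then show ?thesis
          unfolding G_def using single_missing[OF h pull_mem[OF w vl] _ hpos_straight] True straight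
          by (intro subspace_scale[OF subspace_missing]) auto
      next
        case False
        have "Suc t - steps_before S (Suc t) \<le> Suc N - k"
          using steps_not_before_mono[of "Suc t" "Suc N" S] steps_before_all[OF hv(3)[OF SP]] hv(4)[OF SP] t by simp
        then have "t - steps_before S t < j" using False N steps_before_le[of S t] by (simp add: steps_before_Suc)
        then have "pull V j N (compose {..N} (vpos (Suc N) S) (coface (Suc N) t)) v = 0"
          using pull_normalized_zero[OF v w _ vpos_straight] False straight by auto
        then show ?thesis using subspace_0[OF subspace_missing] by (simp add: G_def)
      qed
    qed
    moreover have "(\<Sum>S\<in>?P. G t S) = (\<Sum>S\<in>?P - C. G t S) + (\<Sum>S\<in>C. G t S)"
      by (rule sum.subset_diff[OF _ finite_lattice_paths]) (auto simp: C_def)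
    ultimately show ?thesis using subspace_sum[OF subspace_missing, of "?P - C" "G t"] by simp
  qed
  have restr: "hpos (Suc N) S x = hpos N S' x \<and> vpos (Suc N) S x = vpos N S' x"
    if "x \<le> N" "S \<inter> {..<N} = S' \<inter> {..<N}" for S S' x
  proof -
    have "S \<inter> {..<x} = S' \<inter> {..<x}" using that by fastforce
    then show ?thesis using that by (simp add: hpos_def vpos_def steps_before_def)
  qed
  have "(\<Sum>S\<in>{S\<in>?P. N \<in> S}. G (Suc N) S) = (if k = 0 then 0 else (- 1) ^ N *\<^sub>R last_face (k - 1) N (EZ (k - 1) j v))"
  proof (cases k)
    case 0
    then have "{S\<in>?P. N \<in> S} = {}" using hv(4,5) by fastforce
    then show ?thesis using 0 by (simp only: sum.empty refl if_True)
  next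
    case (Suc k')
    have N': "k' + j = N" using N Suc by simp
    have mem': "single (hpos N S) (pull V j N (vpos N S) v) \<in> lev (T k') N" if "S \<in> lattice_paths N k'" for S
      using single_mem[OF hpos_ordmaps[OF that] pull_mem[OF vpos_ordmaps[OF that] vl]] N' by simp
    have "(\<Sum>S\<in>{S\<in>?P. N \<in> S}. G (Suc N) S) = (\<Sum>S\<in>lattice_paths N k'. (- 1) ^ N *\<^sub>R path_sign S *\<^sub>R
        last_face k' N (single (hpos N S) (pull V j N (vpos N S) v)))"
    proof (rule sum.reindex_bij_witness[where i = "insert N" and j = "\<lambda>S. S - {N}"])
      fix S assume S: "S \<in> {S\<in>?P. N \<in> S}"
      then have SP: "S \<in> ?P" "N \<in> S" by auto
      show "insert N (S - {N}) = S" using SP by auto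
      show S': "S - {N} \<in> lattice_paths N k'"
        using hv[OF SP(1)] SP(2) Suc by (auto simp: lattice_paths_def less_Suc_eq)
      have eq: "S \<inter> {..<N} = (S - {N}) \<inter> {..<N}" by auto
      have "compose {..N} (hpos (Suc N) S) (coface (Suc N) (Suc N)) = compose {..N} (coface (Suc k') (Suc k')) (hpos N (S - {N}))"
        using restr[OF _ eq] last_coface_image[OF hpos_ordmaps[OF S']] by (auto simp: fun_eq_iff compose_apply coface_apply)
      moreover have "compose {..N} (vpos (Suc N) S) (coface (Suc N) (Suc N)) = vpos N (S - {N})"
        using restr[OF _ eq] by (auto simp: fun_eq_iff compose_apply coface_apply vpos_def)
      moreover have "\<Sum>S = N + \<Sum>(S - {N})"
        using sum.remove[of S N "\<lambda>x. x"] hv(5)[OF SP(1)] SP(2) by simp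
      then have "path_sign S = (- 1) ^ N * path_sign (S - {N})" by (simp add: path_sign_def power_add)
      ultimately show "(- 1) ^ N *\<^sub>R path_sign (S - {N}) *\<^sub>R
          last_face k' N (single (hpos N (S - {N})) (pull V j N (vpos N (S - {N})) v)) = G (Suc N) S"
        by (simp add: G_def tensor_map_single[OF hpos_ordmaps[OF S']])
    next
      fix S assume S: "S \<in> lattice_paths N k'"
      then have "N \<notin> S" by (auto simp: lattice_paths_def)
      then show "insert N S - {N} = S" by auto
      show "insert N S \<in> {S\<in>?P. N \<in> S}"
        using S Suc \<open>N \<notin> S\<close> finite_path[OF S] by (auto simp: lattice_paths_def)
    qed
    also have "\<dots> = (- 1) ^ N *\<^sub>R last_face k' N (EZ k' j v)"
      unfolding EZ_def N' scaleR_sum_right[symmetric]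
      using mem' linear_map_on_scale[OF last_face_linear mem']
      by (subst linear_map_on_sum[OF last_face_linear subspace_T_lev])
        (auto intro: subspace_scale[OF subspace_T_lev])
    finally show ?thesis using Suc by simp
  qed
  moreover have "(\<Sum>S\<in>{S\<in>?P. N \<notin> S}. G (Suc N) S) =
      (if j = 0 then 0 else (- 1) ^ j *\<^sub>R EZ k (j - 1) (differential V j v))"
  proof (cases j)
    case 0
    have "S = {..<Suc N}" if "S \<in> ?P" for S
      using hv[OF that] N 0 by (intro card_subset_eq) auto
    then have "{S\<in>?P. N \<notin> S} = {}" by auto
    then show ?thesis using 0 by (simp only: sum.empty refl if_True)
  next
    case (Suc i)
    have N': "k + i = N" using N Suc by simp
    have P: "{S\<in>?P. N \<notin> S} = lattice_paths N k" by (auto simp: lattice_paths_def less_Suc_eq)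
    have "G (Suc N) S = path_sign S *\<^sub>R single (hpos N S) (pull V i N (vpos N S) (face V j j v))"
      if S: "S \<in> lattice_paths N k" for S
    proof -
      have w: "vpos N S \<in> ordmaps N i" using vpos_ordmaps[OF S N'[symmetric]] .
      have "compose {..N} (hpos (Suc N) S) (coface (Suc N) (Suc N)) = hpos N S"
        using restr[OF _ refl] by (auto simp: fun_eq_iff compose_apply coface_apply hpos_def)
      moreover have "compose {..N} (vpos (Suc N) S) (coface (Suc N) (Suc N)) = compose {..N} (coface (Suc i) (Suc i)) (vpos N S)"
        using restr[OF _ refl] last_coface_image[OF w] by (auto simp: fun_eq_iff compose_apply coface_apply)
      moreover have "pull V j N (compose {..N} (coface (Suc i) (Suc i)) (vpos N S)) v = pull V i N (vpos N S) (face V j j v)"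
        using pull_comp[OF w coface_ordmaps, of v "Suc i"] vl Suc by (simp add: face_def)
      ultimately show ?thesis by (simp add: G_def)
    qed
    then have "(\<Sum>S\<in>{S\<in>?P. N \<notin> S}. G (Suc N) S) = EZ k i (face V j j v)"
      unfolding P EZ_def N' by (intro sum.cong) auto
    moreover have "EZ k i (differential V j v) = (- 1) ^ j *\<^sub>R EZ k i (face V j j v)"
      unfolding differential_def by (rule linear_map_on_scale[OF EZ_linear]) (use face_mem vl Suc in auto)
    ultimately show ?thesis using Suc by simp
  qed
  moreover have "(\<Sum>S\<in>?P. G (Suc N) S) = (\<Sum>S\<in>{S\<in>?P. N \<notin> S}. G (Suc N) S) + (\<Sum>S\<in>{S\<in>?P. N \<in> S}. G (Suc N) S)"
    using sum.subset_diff[OF _ finite_lattice_paths, of "{S\<in>?P. N \<in> S}" "Suc N" k "G (Suc N)"]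
    by (simp add: set_diff_eq) (metis (no_types, lifting))
  moreover have "(- 1) ^ Suc N * (- 1) ^ j = ((- 1) ^ k :: real)"
    unfolding N[symmetric] by (simp add: power_add mult.assoc power_mult_distrib[symmetric])
  moreover have "(- 1) ^ Suc N * (- 1) ^ N = (- 1 :: real)"
    by (simp add: power_mult_distrib[symmetric])
  ultimately have "(- 1) ^ Suc N *\<^sub>R (\<Sum>S\<in>?P. G (Suc N) S) =
      (if j = 0 then 0 else (- 1) ^ k *\<^sub>R EZ k (j - 1) (differential V j v)) -
      (if k = 0 then 0 else last_face (k - 1) N (EZ (k - 1) j v))"
    by (simp only: scaleR_add_right scaleR_scaleR if_distrib[where f = "scaleR _"] scaleR_zero_right
        scaleR_minus_left scaleR_one) (simp split: if_splits)
  then have "alternating_bd (T k) (Suc N) (EZ k j v) + (if k = 0 then 0 else last_face (k - 1) N (EZ (k - 1) j v))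
     - (if j = 0 then 0 else (- 1) ^ k *\<^sub>R EZ k (j - 1) (differential V j v)) = (\<Sum>t\<le>N. (- 1) ^ t *\<^sub>R (\<Sum>S\<in>?P. G t S))"
    unfolding bd by simp
  then show ?thesis
    using subspace_sum[OF subspace_missing, of "{..N}" "\<lambda>t. (- 1) ^ t *\<^sub>R (\<Sum>S\<in>?P. G t S)"] inner
      subspace_scale[OF subspace_missing] by simp
qed

lemma bd_EZ_cycle:
  assumes v: "v \<in> cycles V j"
  shows "\<exists>l\<in>missing (Suc k) {..<Suc k} (k + j).
    alternating_bd (T (Suc k)) (Suc (k + j)) (EZ (Suc k) j v) = l - last_face k (k + j) (EZ k j v)"
proof -
  have "(if j = 0 then 0 else (- 1) ^ Suc k *\<^sub>R EZ (Suc k) (j - 1) (differential V j v)) = 0"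
    using v linear_map_on_zero[OF EZ_linear subspace_lev] by (simp add: cycles_def)
  then have "alternating_bd (T (Suc k)) (Suc (k + j)) (EZ (Suc k) j v) + last_face k (k + j) (EZ k j v)
      \<in> missing (Suc k) {..<Suc k} (k + j)"
    using bd_EZ[of v j "Suc k" "k + j"] v cycles_subset by auto
  then show ?thesis by (metis add_diff_cancel_right')
qed

lemma last_face_boundary:
  assumes x: "x \<in> lev (T k) m"
  shows "last_face k m x \<in> missing (Suc k) {..Suc k} m"
proof (rule T_linear_mem[OF last_face_linear subspace_missing x])
  fix u assume u: "u \<in> ordmaps m k"
  show "last_face k m (single u (x u)) \<in> missing (Suc k) {..Suc k} m"
    unfolding tensor_map_single[OF u]
    by (rule single_missing[OF compose_ordmaps[OF u coface_ordmaps], where a = "Suc k"])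
      (use T_value_mem[OF x] ordmaps_apply[OF u] in \<open>fastforce simp: last_coface_image[OF u]\<close>)+
qed

lemma bd_EZ_normalized:
  assumes v: "v \<in> normalized V (Suc j)"
  shows "\<exists>p\<in>missing k {..k} (k + j).
    alternating_bd (T k) (Suc (k + j)) (EZ k (Suc j) v) = p + (- 1) ^ k *\<^sub>R EZ k j (differential V (Suc j) v)"
proof -
  have vl: "v \<in> lev V (Suc j)" using v normalized_subset by auto
  define l where "l = alternating_bd (T k) (Suc (k + j)) (EZ k (Suc j) v) +
      (if k = 0 then 0 else last_face (k - 1) (k + j) (EZ (k - 1) (Suc j) v)) -
      (- 1) ^ k *\<^sub>R EZ k j (differential V (Suc j) v)"
  have "l \<in> missing k {..<k} (k + j)"
    using bd_EZ[OF v, of k "k + j"] by (simp add: l_def)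
  then have l: "l \<in> missing k {..k} (k + j)" using missing_mono[of "{..<k}" "{..k}"] by fastforce
  have "(if k = 0 then 0 else last_face (k - 1) (k + j) (EZ (k - 1) (Suc j) v)) \<in> missing k {..k} (k + j)"
  proof (cases k)
    case (Suc k')
    show ?thesis using last_face_boundary[of "EZ k' (Suc j) v" k' "k + j"] EZ_mem[OF vl, of k'] Suc by simp
  qed (simp add: subspace_0[OF subspace_missing])
  from subspace_diff[OF subspace_missing l this] show ?thesis
    by (rule bexI[rotated]) (simp add: l_def)
qed

end

section \<open>The shuffle product is an isomorphism on homology\<close>

context simplicial_vector_space
begin

text \<open>The boundaries in degree \<open>m\<close> of the complex of \<open>V \<otimes> \<Delta>[k]\<close> relative to \<open>V \<otimes> \<partial>\<Delta>[k]\<close>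
  and to the degenerate chains.\<close>

definition rel_boundaries :: "nat \<Rightarrow> nat \<Rightarrow> ((nat \<Rightarrow> nat) \<Rightarrow> 'a) set" where
  "rel_boundaries k m = {a + b + c |a b c.
     a \<in> alternating_bd (T k) (Suc m) ` lev (T k) (Suc m) \<and> b \<in> missing k {..k} m \<and> c \<in> degen (T k) m}"

lemma subspace_rel_boundaries: "subspace (rel_boundaries k m)"
  unfolding rel_boundaries_def
  by (intro subspace_sum3 subspace_missing subspace_degen subspace_linear_map_on_image[OF T_bd_linear] subspace_T_lev)

lemma rel_boundariesI:
  assumes "y \<in> lev (T k) (Suc m)" "p \<in> missing k {..k} m" "d \<in> degen (T k) m"
    "x = alternating_bd (T k) (Suc m) y + p + d"
  shows "x \<in> rel_boundaries k m"
  using assms unfolding rel_boundaries_def by blast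

lemma rel_boundariesE:
  assumes "x \<in> rel_boundaries k m"
  obtains y p d where "y \<in> lev (T k) (Suc m)" "p \<in> missing k {..k} m" "d \<in> degen (T k) m"
    "x = alternating_bd (T k) (Suc m) y + p + d"
  using assms unfolding rel_boundaries_def by blast

lemma horn_boundary: "x \<in> missing (Suc k) {..<Suc k} m \<Longrightarrow> x \<in> missing (Suc k) {..Suc k} m"
  using missing_mono[of "{..<Suc k}" "{..Suc k}"] by fastforce

lemma missing_small:
  assumes x: "x \<in> lev (T k) m" and m: "m < k"
  shows "x \<in> missing k {..k} m"
proof -
  have "\<not> {..k} \<subseteq> u ` {..m}" for u :: "nat \<Rightarrow> nat"
  proof
    assume "{..k} \<subseteq> u ` {..m}"
    then have "card {..k} \<le> card (u ` {..m})" by (intro card_mono) auto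
    also have "\<dots> \<le> card {..m}" by (rule card_image_le) simp
    finally show False using m by simp
  qed
  then show ?thesis using x by (simp add: missing_def)
qed

lemma last_face_cancel:
  assumes c: "c \<in> lev (T k) m" and l: "l \<in> missing (Suc k) {..<Suc k} m" and d: "d \<in> degen (T (Suc k)) m"
    and eq: "last_face k m c = l + d"
  shows "\<exists>p\<in>missing k {..k} m. \<exists>d'\<in>degen (T k) m. c = p + d'"
proof -
  have "c = last_restriction k m (l + d)" using last_restriction_last_face[OF c] eq by simp
  also have "\<dots> = last_restriction k m l + last_restriction k m d"
    by (rule linear_map_on_add[OF last_restriction_linear])
      (use subsetD[OF missing_subset l] subsetD[OF T_degen_subset d] in auto)
  finally show ?thesis using last_restriction_missing[OF l] last_restriction_degen[OF d] by blast
qed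

text \<open>The following lemmas identify \<open>V \<otimes> \<Delta>[0]\<close> with \<open>V\<close>, for the base of the induction on \<open>k\<close>.\<close>

abbreviation point :: "nat \<Rightarrow> nat \<Rightarrow> nat" where
  "point m \<equiv> (\<lambda>x\<in>{..m}. 0)"

lemma EZ_0:
  assumes "v \<in> lev V j"
  shows "EZ 0 j v = single (point j) v"
proof -
  have "lattice_paths j 0 = {{}}" by (auto simp: lattice_paths_def dest: finite_subset)
  moreover have "hpos j {} = point j" "vpos j {} = ordid j"
    by (auto simp: hpos_def vpos_def ordid_def steps_before_def)
  ultimately show ?thesis using assms by (simp add: EZ_def path_sign_def pull_id)
qed

lemma T_0_expand:
  assumes "x \<in> lev (T 0) m"
  shows "x = single (point m) (x (point m))"
proof
  show "x u = single (point m) (x (point m)) u" for u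
    using assms ordmaps_0_const[of u m] by (auto simp: single_apply T_lev)
qed

lemma missing_0:
  assumes "x \<in> missing 0 {..0} m"
  shows "x = 0"
proof
  fix u
  show "x u = 0 u"
  proof (cases "u \<in> ordmaps m 0")
    case True
    then have "{..0} \<subseteq> u ` {..m}" using ordmaps_apply[OF True, of 0] by (auto simp: image_iff)
    then show ?thesis using assms by (simp add: missing_def)
  qed (use assms in \<open>auto simp: missing_def T_lev\<close>)
qed

lemma point_linear: "linear_map_on (lev V m) (lev (T 0) m) (single (point m))"
  using single_mem[OF const_ordmaps] by (auto simp: linear_map_on_def single_add single_scale)

lemma point_bd:
  assumes "v \<in> lev V (Suc m)"
  shows "alternating_bd (T 0) (Suc m) (single (point (Suc m)) v) = single (point m) (alternating_bd V (Suc m) v)"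
proof -
  have "compose {..m} (point (Suc m)) (coface (Suc m) i) = point m" for i
    by (auto simp: fun_eq_iff compose_apply coface_apply)
  then have "alternating_bd (T 0) (Suc m) (single (point (Suc m)) v) =
      (\<Sum>i\<le>Suc m. single (point m) ((- 1) ^ i *\<^sub>R face V (Suc m) i v))"
    unfolding T_bd_single[OF const_ordmaps] by (simp add: single_scale)
  also have "\<dots> = single (point m) (alternating_bd V (Suc m) v)"
    unfolding alternating_bd_def
    by (rule linear_map_on_sum[OF point_linear subspace_lev, symmetric])
      (use face_mem[OF assms] subspace_scale[OF subspace_lev] in auto)
  finally show ?thesis .
qed

lemma point_degeneracy:
  assumes "j \<le> m"
  shows "degeneracy (T 0) m j (single (point m) v) = single (point (Suc m)) (degeneracy V m j v)"
proof -
  have "compose {..Suc m} (point m) (codegeneracy m j) = point (Suc m)"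
    using assms by (auto simp: fun_eq_iff compose_apply codegeneracy_apply)
  then show ?thesis using T_degeneracy_single[OF const_ordmaps assms] by simp
qed

lemma point_degen:
  assumes "v \<in> degen V m"
  shows "single (point m) v \<in> degen (T 0) m"
proof (rule linear_map_on_span_subset[OF point_linear subspace_lev subspace_degen _ _ assms[unfolded degen_def]])
  show "{degeneracy V k j y |k j y. m = Suc k \<and> j \<le> k \<and> y \<in> lev V k} \<subseteq> lev V m"
    using degeneracy_mem by auto
  fix b assume "b \<in> {degeneracy V k j y |k j y. m = Suc k \<and> j \<le> k \<and> y \<in> lev V k}"
  then show "single (point m) b \<in> degen (T 0) m"
    using degeneracy_in_degen[OF _ single_mem[OF const_ordmaps]] by (auto simp: point_degeneracy[symmetric])
qed

lemma degen_T_0_value: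
  assumes "x \<in> degen (T 0) m"
  shows "x (point m) \<in> degen V m"
proof (cases m)
  case 0
  then have "x = 0" using assms degen_0 by auto
  then show ?thesis using subspace_0[OF subspace_degen] by simp
next
  case (Suc n)
  have lin: "linear_map_on (lev (T 0) (Suc n)) UNIV (\<lambda>x. x (point (Suc n)))"
    by (auto simp: linear_map_on_def)
  show ?thesis
    unfolding Suc
  proof (rule degen_T_linear_mem[OF lin subspace_degen assms[unfolded Suc]])
    fix u v j assume "v \<in> lev V n" "j \<le> n"
    then show "single (compose {..Suc n} u (codegeneracy n j)) (degeneracy V n j v) (point (Suc n)) \<in> degen V (Suc n)"
      using degeneracy_in_degen subspace_0[OF subspace_degen] by (auto simp: single_apply)
  qed
qed

text \<open>For \<open>k = 0\<close> a chain is made normalized by splitting off a degenerate one. In the step from \<open>k\<close> to \<open>k + 1\<close>, let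
  \<open>c'\<close> be the part of the boundary of \<open>c\<close> on the last face. It is a relative cycle again, so by induction it is
  homologous to some \<open>EZ k j v\<close>. The boundary of \<open>EZ (k + 1) j v\<close> on the last face is \<open>- EZ k j v\<close>. Therefore
  \<open>c + EZ (k + 1) j v\<close> can be corrected by a chain on the last face so that its boundary lies in the horn, up to degenerate chains,
  and then \<open>horn_acyclic\<close> applies.\<close>

lemma EZ_surjective:
  assumes "c \<in> lev (T k) (k + j)"
    and "\<And>N. k + j = Suc N \<Longrightarrow> \<exists>p\<in>missing k {..k} N. \<exists>d\<in>degen (T k) N. alternating_bd (T k) (Suc N) c = p + d"
  shows "\<exists>v\<in>cycles V j. c - EZ k j v \<in> rel_boundaries k (k + j)"
  using assms
proof (induction k arbitrary: c)
  case 0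
  define w where "w = c (point j)"
  have c: "c = single (point j) w" using T_0_expand 0(1) by (simp add: w_def)
  have w: "w \<in> lev V j" using T_value_mem 0(1) by (simp add: w_def)
  obtain z where z: "z \<in> normalized V j" "w - z \<in> degen V j" using normalized_complement[OF w] by blast
  have zl: "z \<in> lev V j" using z(1) normalized_subset by auto
  have "z \<in> cycles V j"
  proof (cases j)
    case (Suc N)
    have "0 + j = Suc N" using Suc by simp
    then obtain p d where p: "p \<in> missing 0 {..0} N" and d: "d \<in> degen (T 0) N" "alternating_bd (T 0) (Suc N) c = p + d"
      using 0(2) by blast
    have d: "d \<in> degen (T 0) N" "alternating_bd (T 0) (Suc N) c = d"
      using d missing_0[OF p] by (simp_all only: add_0)
    have "alternating_bd V (Suc N) w = d (point N)"
      using point_bd[of w N] w unfolding d(2)[symmetric] c Suc by (simp add: single_apply)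
    then have "alternating_bd V (Suc N) w \<in> degen V N" using degen_T_0_value[OF d(1)] by simp
    moreover have "alternating_bd V (Suc N) (w - z) \<in> degen V N"
      using alternating_bd_degen z(2) Suc by simp
    moreover have "alternating_bd V (Suc N) (w - z) = alternating_bd V (Suc N) w - alternating_bd V (Suc N) z"
      using linear_map_on_diff[OF alternating_bd_linear subspace_lev] w zl Suc by simp
    ultimately have "alternating_bd V (Suc N) z \<in> degen V N"
      using subspace_diff[OF subspace_degen] by (metis diff_diff_eq2 add_diff_cancel_left')
    moreover have eq: "alternating_bd V (Suc N) z = differential V (Suc N) z"
      using alternating_bd_normalized z(1) Suc by simp
    moreover have "differential V (Suc N) z \<in> normalized V N"
      using linear_map_on_mem[OF differential_linear] z(1) Suc by simp
    ultimately have "differential V (Suc N) z = 0" using normalized_degen_zero by simp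
    then show ?thesis using z(1) Suc by (simp add: cycles_def)
  qed (use z in \<open>simp add: cycles_def\<close>)
  moreover have "c - EZ 0 j z = single (point j) (w - z)"
    unfolding EZ_0[OF zl] c using linear_map_on_diff[OF point_linear subspace_lev w zl] by simp
  then have "c - EZ 0 j z \<in> rel_boundaries 0 (0 + j)"
    using rel_boundariesI[OF subspace_0[OF subspace_T_lev] subspace_0[OF subspace_missing] point_degen[OF z(2)]]
      linear_map_on_zero[OF T_bd_linear subspace_T_lev] by simp
  ultimately show ?case by blast
next
  case (Suc k)
  let ?m = "k + j"
  have c: "c \<in> lev (T (Suc k)) (Suc ?m)" using Suc.prems(1) by simp
  obtain p d where p: "p \<in> missing (Suc k) {..Suc k} ?m" and d: "d \<in> degen (T (Suc k)) ?m"
    and bd: "alternating_bd (T (Suc k)) (Suc ?m) c = p + d"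
    using Suc.prems(2)[OF add_Suc] by blast
  obtain l c' where l: "l \<in> missing (Suc k) {..<Suc k} ?m" and c': "c' \<in> lev (T k) ?m"
    and pe: "p = l + last_face k ?m c'"
    using boundary_decompose[OF p] by blast
  have lf: "last_face k ?m c' \<in> lev (T (Suc k)) ?m" using linear_map_on_mem[OF last_face_linear c'] .
  have ll: "l \<in> lev (T (Suc k)) ?m" using subsetD[OF missing_subset l] .
  have dl: "d \<in> lev (T (Suc k)) ?m" using subsetD[OF T_degen_subset d] .
  have "\<exists>v\<in>cycles V j. c' - EZ k j v \<in> rel_boundaries k ?m"
  proof (rule Suc.IH[OF c'])
    fix N assume N: "k + j = Suc N"
    have "0 = alternating_bd (T (Suc k)) (Suc N) (l + last_face k ?m c' + d)"
      using T_bd_bd[of c "Suc k" N] c bd pe N by simp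
    also have "\<dots> = alternating_bd (T (Suc k)) (Suc N) l + last_face k N (alternating_bd (T k) (Suc N) c') +
        alternating_bd (T (Suc k)) (Suc N) d"
      using linear_map_on_add[OF T_bd_linear] ll lf dl subspace_add[OF subspace_T_lev ll lf]
        last_face_bd[of c' k N] c' N by simp
    finally have eq: "last_face k N (alternating_bd (T k) (Suc N) c') =
        - alternating_bd (T (Suc k)) (Suc N) l + - alternating_bd (T (Suc k)) (Suc N) d"
      by (simp add: eq_neg_iff_add_eq_0 algebra_simps)
    show "\<exists>p\<in>missing k {..k} N. \<exists>d\<in>degen (T k) N. alternating_bd (T k) (Suc N) c' = p + d"
      by (rule last_face_cancel[OF linear_map_on_mem[OF T_bd_linear c'[unfolded N]]
            subspace_neg[OF subspace_missing bd_missing[OF l[unfolded N]]]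
            subspace_neg[OF subspace_degen T_bd_degen[OF d[unfolded N]]] eq])
  qed
  then obtain v where v: "v \<in> cycles V j" "c' - EZ k j v \<in> rel_boundaries k ?m" by blast
  then obtain y p' d' where y: "y \<in> lev (T k) (Suc ?m)" and p': "p' \<in> missing k {..k} ?m"
    and d': "d' \<in> degen (T k) ?m" and ce: "c' - EZ k j v = alternating_bd (T k) (Suc ?m) y + p' + d'"
    by (elim rel_boundariesE)
  obtain l0 where l0: "l0 \<in> missing (Suc k) {..<Suc k} ?m"
    and bdEZ: "alternating_bd (T (Suc k)) (Suc ?m) (EZ (Suc k) j v) = l0 - last_face k ?m (EZ k j v)"
    using bd_EZ_cycle[OF v(1)] by blast
  have vl: "v \<in> lev V j" using v(1) by (simp add: cycles_iff)
  have E: "EZ (Suc k) j v \<in> lev (T (Suc k)) (Suc ?m)" using EZ_mem[OF vl, of "Suc k"] by simp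
  have ly: "last_face k (Suc ?m) y \<in> lev (T (Suc k)) (Suc ?m)" using linear_map_on_mem[OF last_face_linear y] .
  \<comment> \<open>The last term removes the boundary by which \<open>c'\<close> and \<open>EZ k j v\<close> differ on the last face.\<close>
  define c1 where "c1 = c + EZ (Suc k) j v - last_face k (Suc ?m) y"
  have c1: "c1 \<in> lev (T (Suc k)) (Suc ?m)"
    unfolding c1_def using subspace_diff[OF subspace_T_lev subspace_add[OF subspace_T_lev c E] ly] .
  have mems: "EZ k j v \<in> lev (T k) ?m" "alternating_bd (T k) (Suc ?m) y \<in> lev (T k) ?m" "p' \<in> lev (T k) ?m" "d' \<in> lev (T k) ?m"
    using EZ_mem[OF vl] linear_map_on_mem[OF T_bd_linear y] subsetD[OF missing_subset p'] subsetD[OF T_degen_subset d'] by auto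
  have "c' = EZ k j v + alternating_bd (T k) (Suc ?m) y + p' + d'" using ce by (simp add: algebra_simps)
  then have lfc: "last_face k ?m c' = last_face k ?m (EZ k j v) + last_face k ?m (alternating_bd (T k) (Suc ?m) y) +
      last_face k ?m p' + last_face k ?m d'"
    using linear_map_on_add[OF last_face_linear] mems subspace_add[OF subspace_T_lev] by simp
  have "alternating_bd (T (Suc k)) (Suc ?m) c1 = (p + d) + (l0 - last_face k ?m (EZ k j v)) -
      last_face k ?m (alternating_bd (T k) (Suc ?m) y)"
    unfolding c1_def linear_map_on_diff[OF T_bd_linear subspace_T_lev subspace_add[OF subspace_T_lev c E] ly]
      linear_map_on_add[OF T_bd_linear c E] bd bdEZ last_face_bd[OF y] ..
  also have "\<dots> = (l + l0 + last_face k ?m p') + (d + last_face k ?m d')"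
    unfolding pe lfc by (simp add: algebra_simps)
  finally have "alternating_bd (T (Suc k)) (Suc ?m) c1 = (l + l0 + last_face k ?m p') + (d + last_face k ?m d')" .
  moreover have "l + l0 + last_face k ?m p' \<in> missing (Suc k) {..<Suc k} ?m"
    using subspace_add[OF subspace_missing subspace_add[OF subspace_missing l l0] last_face_missing[OF p']] .
  moreover have "d + last_face k ?m d' \<in> degen (T (Suc k)) ?m"
    using subspace_add[OF subspace_degen d last_face_degen[OF d']] .
  ultimately obtain y2 l' d'' where y2: "y2 \<in> lev (T (Suc k)) (Suc (Suc ?m))"
    and l': "l' \<in> missing (Suc k) {..<Suc k} (Suc ?m)" and d'': "d'' \<in> degen (T (Suc k)) (Suc ?m)"
    and c1e: "c1 = alternating_bd (T (Suc k)) (Suc (Suc ?m)) y2 + l' + d''"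
    using horn_acyclic[OF c1] by blast
  have "EZ (Suc k) j (- v) = - EZ (Suc k) j v"
    by (rule linear_map_on_neg[OF EZ_linear subspace_lev vl])
  then have "c - EZ (Suc k) j (- v) = alternating_bd (T (Suc k)) (Suc (Suc ?m)) y2 + (l' + last_face k (Suc ?m) y) + d''"
    using c1e by (simp add: c1_def algebra_simps)
  moreover have "l' + last_face k (Suc ?m) y \<in> missing (Suc k) {..Suc k} (Suc ?m)"
    using subspace_add[OF subspace_missing horn_boundary[OF l'] last_face_boundary[OF y]] .
  ultimately have "c - EZ (Suc k) j (- v) \<in> rel_boundaries (Suc k) (Suc k + j)"
    using rel_boundariesI[OF y2 _ d''] by simp
  then show ?case using subspace_neg[OF subspace_cycles v(1)] by blast
qed

text \<open>Taking the boundary of a relative bounding relation for \<open>EZ (k + 1) j v\<close> and restricting it to the last face gives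
  one for \<open>EZ k j v\<close>. For \<open>k = 0\<close> the normalized part of the bounding chain has boundary \<open>v\<close>, since normalized
  and degenerate chains are independent.\<close>

lemma EZ_injective:
  assumes "v \<in> cycles V j" and "EZ k j v \<in> rel_boundaries k (k + j)"
  shows "v \<in> boundaries V j"
  using assms(2)
proof (induction k)
  case 0
  then obtain y d where y: "y \<in> lev (T 0) (Suc j)" and d: "d \<in> degen (T 0) j"
    and eq: "EZ 0 j v = alternating_bd (T 0) (Suc j) y + d"
    using missing_0 by (elim rel_boundariesE) auto
  have vn: "v \<in> normalized V j" "v \<in> lev V j" using assms(1) cycles_subset normalized_subset by auto
  define w where "w = y (point (Suc j))"
  have w: "w \<in> lev V (Suc j)" using T_value_mem[OF y] by (simp add: w_def)
  have "single (point j) v = single (point j) (alternating_bd V (Suc j) w) + d"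
    using eq T_0_expand[OF y] point_bd[OF w] EZ_0[OF vn(2)] by (simp add: w_def)
  then have v: "v = alternating_bd V (Suc j) w + d (point j)"
    by (metis plus_fun_apply single_apply)
  obtain z where z: "z \<in> normalized V (Suc j)" "w - z \<in> degen V (Suc j)" using normalized_complement[OF w] by blast
  have zl: "z \<in> lev V (Suc j)" using z(1) normalized_subset by auto
  have dz: "alternating_bd V (Suc j) z = differential V (Suc j) z" using alternating_bd_normalized[OF z(1)] .
  have "v - differential V (Suc j) z = alternating_bd V (Suc j) (w - z) + d (point j)"
    unfolding v linear_map_on_diff[OF alternating_bd_linear subspace_lev w zl] dz by simp
  then have "v - differential V (Suc j) z \<in> degen V j"
    using subspace_add[OF subspace_degen alternating_bd_degen[OF z(2)] degen_T_0_value[OF d]] by simp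
  moreover have "v - differential V (Suc j) z \<in> normalized V j"
    using subspace_diff[OF subspace_normalized vn(1) linear_map_on_mem[OF differential_linear z(1)]] .
  ultimately have "v = differential V (Suc j) z" using normalized_degen_zero by fastforce
  then show ?case using z(1) by (auto simp: boundaries_def)
next
  case (Suc k)
  let ?m = "k + j"
  obtain y p d where y: "y \<in> lev (T (Suc k)) (Suc (Suc ?m))" and p: "p \<in> missing (Suc k) {..Suc k} (Suc ?m)"
    and d: "d \<in> degen (T (Suc k)) (Suc ?m)"
    and eq: "EZ (Suc k) j v = alternating_bd (T (Suc k)) (Suc (Suc ?m)) y + p + d"
    using Suc.prems by (elim rel_boundariesE) simp
  obtain l c where l: "l \<in> missing (Suc k) {..<Suc k} (Suc ?m)" and c: "c \<in> lev (T k) (Suc ?m)"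
    and pe: "p = l + last_face k (Suc ?m) c"
    using boundary_decompose[OF p] by blast
  obtain l0 where l0: "l0 \<in> missing (Suc k) {..<Suc k} ?m"
    and bdEZ: "alternating_bd (T (Suc k)) (Suc ?m) (EZ (Suc k) j v) = l0 - last_face k ?m (EZ k j v)"
    using bd_EZ_cycle[OF assms(1)] by blast
  have mems: "alternating_bd (T (Suc k)) (Suc (Suc ?m)) y \<in> lev (T (Suc k)) (Suc ?m)"
    "l \<in> lev (T (Suc k)) (Suc ?m)" "last_face k (Suc ?m) c \<in> lev (T (Suc k)) (Suc ?m)" "d \<in> lev (T (Suc k)) (Suc ?m)"
    using linear_map_on_mem[OF T_bd_linear y] subsetD[OF missing_subset l] linear_map_on_mem[OF last_face_linear c]
      subsetD[OF T_degen_subset d] by auto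
  have vl: "v \<in> lev V j" using assms(1) by (simp add: cycles_iff)
  have "l0 - last_face k ?m (EZ k j v) = alternating_bd (T (Suc k)) (Suc ?m) l +
      last_face k ?m (alternating_bd (T k) (Suc ?m) c) + alternating_bd (T (Suc k)) (Suc ?m) d"
    unfolding bdEZ[symmetric] eq pe
    using linear_map_on_add[OF T_bd_linear] mems subspace_add[OF subspace_T_lev] T_bd_bd[OF y] last_face_bd[OF c]
    by (simp add: add.assoc)
  moreover have "last_face k ?m (EZ k j v + alternating_bd (T k) (Suc ?m) c) =
      last_face k ?m (EZ k j v) + last_face k ?m (alternating_bd (T k) (Suc ?m) c)"
    using linear_map_on_add[OF last_face_linear EZ_mem[OF vl] linear_map_on_mem[OF T_bd_linear c]] .
  ultimately have eq2: "last_face k ?m (EZ k j v + alternating_bd (T k) (Suc ?m) c) =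
      (l0 - alternating_bd (T (Suc k)) (Suc ?m) l) + - alternating_bd (T (Suc k)) (Suc ?m) d"
    by (simp add: algebra_simps)
  obtain p' d' where p': "p' \<in> missing k {..k} ?m" and d': "d' \<in> degen (T k) ?m"
    and e: "EZ k j v + alternating_bd (T k) (Suc ?m) c = p' + d'"
    using last_face_cancel[OF subspace_add[OF subspace_T_lev EZ_mem[OF vl] linear_map_on_mem[OF T_bd_linear c]]
        subspace_diff[OF subspace_missing l0 bd_missing[OF l]] subspace_neg[OF subspace_degen T_bd_degen[OF d]] eq2] by blast
  have "EZ k j v = alternating_bd (T k) (Suc ?m) (- c) + p' + d'"
    using e linear_map_on_neg[OF T_bd_linear subspace_T_lev c] by (simp add: algebra_simps)
  then show ?case
    using Suc.IH rel_boundariesI[OF subspace_neg[OF subspace_T_lev c] p' d'] by blast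
qed

end

section \<open>Simplices of the dual as cocycles\<close>

definition top_value :: "nat \<Rightarrow> 'a::real_vector dual \<Rightarrow> ((nat \<Rightarrow> nat) \<Rightarrow> 'a) \<Rightarrow> real" where
  "top_value n f x = f n x (ordid n)"

lemma top_value_add: "top_value n (f + g) x = top_value n f x + top_value n g x"
  and top_value_diff: "top_value n (f - g) x = top_value n f x - top_value n g x"
  and top_value_scale: "top_value n (r *\<^sub>R f) x = r * top_value n f x"
  and top_value_zero: "top_value n 0 x = 0"
  by (simp_all add: top_value_def)

context simplicial_vector_space
begin

definition cocycle :: "nat \<Rightarrow> nat \<Rightarrow> (((nat \<Rightarrow> nat) \<Rightarrow> 'a) \<Rightarrow> real) \<Rightarrow> bool" where
  "cocycle n m \<phi> \<longleftrightarrow> linear_map_on (lev (T m) n) UNIV \<phi> \<and> (\<forall>x\<in>degen (T m) n. \<phi> x = 0) \<and>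
     (\<forall>x\<in>lev (T m) (Suc n). \<phi> (alternating_bd (T m) (Suc n) x) = 0)"

text \<open>For a cocycle \<open>\<phi>\<close>, the only simplicial map to \<open>B\<^sup>n\<real>\<close> that takes the values \<open>\<phi>\<close> at the identity of \<open>[n]\<close>: by naturality its
  value at \<open>\<sigma>\<close> is read off after pulling back along \<open>\<sigma>\<close>.\<close>

definition of_cocycle :: "nat \<Rightarrow> nat \<Rightarrow> (((nat \<Rightarrow> nat) \<Rightarrow> 'a) \<Rightarrow> real) \<Rightarrow> 'a dual" where
  "of_cocycle n m \<phi> = (\<lambda>j x. if x \<in> lev (T m) j
     then (\<lambda>\<sigma>. if \<sigma> \<in> ordmaps n j then \<phi> (pull (T m) j n \<sigma> x) else 0) else 0)"

lemma ndual_iff: "f \<in> lev (ndual n V) m \<longleftrightarrow> simplicial_linear_map (T m) (EM n) f \<and> (\<forall>j x. x \<notin> lev (T m) j \<longrightarrow> f j x = 0)"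
  by (simp add: ndual_def)

lemma EM_lev: "c \<in> lev (EM n) m \<longleftrightarrow> (\<forall>\<sigma>. \<sigma> \<notin> ordmaps n m \<longrightarrow> c \<sigma> = 0) \<and>
    (\<forall>\<sigma>\<in>ordmaps n m. degenerate m n \<sigma> \<longrightarrow> c \<sigma> = 0) \<and>
    (\<forall>\<sigma>\<in>ordmaps (Suc n) m. (\<Sum>i\<le>Suc n. (- 1) ^ i * c (compose {..n} \<sigma> (coface (Suc n) i))) = 0)"
  unfolding EM_def svec.simps mem_Collect_eq ..

lemma ndual_linear: "f \<in> lev (ndual n V) m \<Longrightarrow> linear_map_on (lev (T m) j) (lev (EM n) j) (f j)"
  by (simp add: ndual_iff simplicial_linear_map_def)

lemma ndual_outside: "f \<in> lev (ndual n V) m \<Longrightarrow> x \<notin> lev (T m) j \<Longrightarrow> f j x = 0"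
  by (simp add: ndual_iff)

lemma ndual_pull:
  assumes "f \<in> lev (ndual n V) m" "q \<in> ordmaps l k" "x \<in> lev (T m) k" "\<sigma> \<in> ordmaps n l"
  shows "f l (pull (T m) k l q x) \<sigma> = f k x (compose {..n} q \<sigma>)"
  using assms by (simp add: ndual_iff simplicial_linear_map_def EM_def)

lemma ndual_value:
  assumes f: "f \<in> lev (ndual n V) m" and x: "x \<in> lev (T m) j" and \<sigma>: "\<sigma> \<in> ordmaps n j"
  shows "f j x \<sigma> = top_value n f (pull (T m) j n \<sigma> x)"
  using ndual_pull[OF f \<sigma> x ordid_ordmaps] by (simp add: top_value_def compose_ordid_right[OF \<sigma>])

lemma ndual_value_outside:
  assumes f: "f \<in> lev (ndual n V) m" and \<sigma>: "\<sigma> \<notin> ordmaps n j"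
  shows "f j x \<sigma> = 0"
proof (cases "x \<in> lev (T m) j")
  case True
  then show ?thesis using linear_map_on_mem[OF ndual_linear[OF f] True] \<sigma> unfolding EM_lev by blast
qed (simp add: ndual_outside[OF f])

lemma of_cocycle_top_value:
  assumes f: "f \<in> lev (ndual n V) m"
  shows "f = of_cocycle n m (top_value n f)"
  by (intro ext) (simp add: of_cocycle_def ndual_outside[OF f] ndual_value[OF f] ndual_value_outside[OF f])

lemma top_value_linear:
  assumes f: "f \<in> lev (ndual n V) m"
  shows "linear_map_on (lev (T m) n) UNIV (top_value n f)"
  using linear_map_on_add[OF ndual_linear[OF f]] linear_map_on_scale[OF ndual_linear[OF f]]
  by (simp add: linear_map_on_def top_value_def)

lemma ndual_eqI:
  assumes f: "f \<in> lev (ndual n V) m" and g: "g \<in> lev (ndual n V) m"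
    and eq: "\<And>u v. u \<in> ordmaps n m \<Longrightarrow> v \<in> lev V n \<Longrightarrow> top_value n f (single u v) = top_value n g (single u v)"
  shows "f = g"
proof -
  interpret Tm: simplicial_vector_space "T m" by (rule simplicial_vector_space_T)
  have "top_value n f x = top_value n g x" if "x \<in> lev (T m) n" for x
    by (rule T_linear_eq[OF top_value_linear[OF f] top_value_linear[OF g] that eq])
  then have "of_cocycle n m (top_value n f) = of_cocycle n m (top_value n g)"
    by (intro ext) (simp add: of_cocycle_def Tm.pull_mem)
  then show ?thesis using of_cocycle_top_value[OF f] of_cocycle_top_value[OF g] by simp
qed

text \<open>A degenerate chain \<open>s\<^sub>j y\<close> is evaluated by applying the cochain \<open>f y\<close> to the degenerate simplex \<open>s\<^sub>j\<close>; the
  boundary of \<open>x\<close> is evaluated by applying the coboundary of the cocycle \<open>f x\<close> to the identity of \<open>[n + 1]\<close>.\<close>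

lemma cocycle_top_value:
  assumes f: "f \<in> lev (ndual n V) m"
  shows "cocycle n m (top_value n f)"
  unfolding cocycle_def
proof (intro conjI ballI)
  interpret Tm: simplicial_vector_space "T m" by (rule simplicial_vector_space_T)
  note lin = top_value_linear[OF f]
  show "linear_map_on (lev (T m) n) UNIV (top_value n f)" by (rule lin)
  fix x assume x: "x \<in> degen (T m) n"
  have "top_value n f x \<in> {0}"
  proof (rule linear_map_on_span_subset[OF lin subspace_T_lev subspace_single_0 _ _ x[unfolded degen_def]])
    show "{degeneracy (T m) k j y |k j y. n = Suc k \<and> j \<le> k \<and> y \<in> lev (T m) k} \<subseteq> lev (T m) n"
      using Tm.degeneracy_mem by auto
    fix b assume "b \<in> {degeneracy (T m) k j y |k j y. n = Suc k \<and> j \<le> k \<and> y \<in> lev (T m) k}"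
    then obtain k j y where b: "b = degeneracy (T m) k j y" "n = Suc k" "j \<le> k" "y \<in> lev (T m) k" by blast
    have c: "codegeneracy k j \<in> ordmaps n k" using codegeneracy_ordmaps[OF b(3)] b(2) by simp
    have "degenerate k n (codegeneracy k j)"
      unfolding degenerate_def using compose_ordid_left[OF c] b(2,3) ordid_ordmaps[of k] by metis
    moreover have "f k y \<in> lev (EM n) k" using linear_map_on_mem[OF ndual_linear[OF f] b(4)] .
    ultimately have "f k y (codegeneracy k j) = 0" using c unfolding EM_lev by blast
    then show "top_value n f b \<in> {0}" using ndual_value[OF f b(4) c] b(1,2) by (simp add: degeneracy_def)
  qed
  then show "top_value n f x = 0" by simp
next
  interpret Tm: simplicial_vector_space "T m" by (rule simplicial_vector_space_T)
  note lin = top_value_linear[OF f]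
  fix x assume x: "x \<in> lev (T m) (Suc n)"
  have "f (Suc n) x \<in> lev (EM n) (Suc n)" using linear_map_on_mem[OF ndual_linear[OF f] x] .
  then have "(\<Sum>i\<le>Suc n. (- 1) ^ i * f (Suc n) x (compose {..n} (ordid (Suc n)) (coface (Suc n) i))) = 0"
    using ordid_ordmaps unfolding EM_lev by blast
  moreover have "f (Suc n) x (compose {..n} (ordid (Suc n)) (coface (Suc n) i)) = top_value n f (face (T m) (Suc n) i x)" for i
    unfolding compose_ordid_left[OF coface_ordmaps] using ndual_value[OF f x coface_ordmaps] by (simp add: face_def)
  moreover have "top_value n f (alternating_bd (T m) (Suc n) x) = (\<Sum>i\<le>Suc n. (- 1) ^ i * top_value n f (face (T m) (Suc n) i x))"
    unfolding alternating_bd_def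
    using linear_map_on_scale[OF lin Tm.face_mem[OF x]] Tm.face_mem[OF x] subspace_scale[OF subspace_T_lev]
    by (subst linear_map_on_sum[OF lin subspace_T_lev]) auto
  ultimately show "top_value n f (alternating_bd (T m) (Suc n) x) = 0" by simp
qed

text \<open>The conditions that define \<open>B\<^sup>n\<real>\<close> at a simplex \<open>\<sigma>\<close> are those that define a cocycle, for the chain pulled back
  along \<open>\<sigma>\<close>.\<close>

lemma of_cocycle_mem:
  assumes \<phi>: "cocycle n m \<phi>"
  shows "of_cocycle n m \<phi> \<in> lev (ndual n V) m"
proof -
  interpret Tm: simplicial_vector_space "T m" by (rule simplicial_vector_space_T)
  have lin: "linear_map_on (lev (T m) n) UNIV \<phi>" using \<phi> by (simp add: cocycle_def)
  have EM: "of_cocycle n m \<phi> j x \<in> lev (EM n) j" if x: "x \<in> lev (T m) j" for j x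
    unfolding EM_lev
  proof (intro conjI allI ballI impI)
    show "of_cocycle n m \<phi> j x \<sigma> = 0" if "\<sigma> \<notin> ordmaps n j" for \<sigma>
      using that by (simp add: of_cocycle_def)
    show "of_cocycle n m \<phi> j x \<sigma> = 0" if \<sigma>: "\<sigma> \<in> ordmaps n j" "degenerate j n \<sigma>" for \<sigma>
    proof -
      obtain k i \<tau> where k: "n = Suc k" "i \<le> k" "\<tau> \<in> ordmaps k j" "\<sigma> = compose {..n} \<tau> (codegeneracy k i)"
        using \<sigma>(2) unfolding degenerate_def by blast
      have "pull (T m) j n \<sigma> x = degeneracy (T m) k i (pull (T m) j k \<tau> x)"
        using Tm.pull_comp[OF codegeneracy_ordmaps[OF k(2)] k(3) x] k by (simp add: degeneracy_def)
      then have "pull (T m) j n \<sigma> x \<in> degen (T m) n"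
        using degeneracy_in_degen[OF k(2) Tm.pull_mem[OF k(3) x]] k(1) by simp
      then show ?thesis using \<phi> \<sigma> x by (simp add: of_cocycle_def cocycle_def)
    qed
    fix \<sigma> assume \<sigma>: "\<sigma> \<in> ordmaps (Suc n) j"
    define y where "y = pull (T m) j (Suc n) \<sigma> x"
    have y: "y \<in> lev (T m) (Suc n)" using Tm.pull_mem[OF \<sigma> x] by (simp add: y_def)
    have "of_cocycle n m \<phi> j x (compose {..n} \<sigma> (coface (Suc n) i)) = \<phi> (face (T m) (Suc n) i y)" for i
      using x compose_ordmaps[OF coface_ordmaps \<sigma>] Tm.pull_comp[OF coface_ordmaps \<sigma> x]
      by (simp add: of_cocycle_def y_def face_def)
    then have "(\<Sum>i\<le>Suc n. (- 1) ^ i * of_cocycle n m \<phi> j x (compose {..n} \<sigma> (coface (Suc n) i))) =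
        (\<Sum>i\<le>Suc n. \<phi> ((- 1) ^ i *\<^sub>R face (T m) (Suc n) i y))"
      using linear_map_on_scale[OF lin Tm.face_mem[OF y]] by simp
    also have "\<dots> = \<phi> (alternating_bd (T m) (Suc n) y)"
      unfolding alternating_bd_def
      using Tm.face_mem[OF y] subspace_scale[OF subspace_T_lev]
      by (subst linear_map_on_sum[OF lin subspace_T_lev]) auto
    also have "\<dots> = 0" using \<phi> y by (simp add: cocycle_def)
    finally show "(\<Sum>i\<le>Suc n. (- 1) ^ i * of_cocycle n m \<phi> j x (compose {..n} \<sigma> (coface (Suc n) i))) = 0" .
  qed
  have add: "of_cocycle n m \<phi> j (x + y) = of_cocycle n m \<phi> j x + of_cocycle n m \<phi> j y"
    if "x \<in> lev (T m) j" "y \<in> lev (T m) j" for j x y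
    using that subspace_add[OF subspace_T_lev that] linear_map_on_add[OF Tm.pull_linear that]
      linear_map_on_add[OF lin Tm.pull_mem Tm.pull_mem]
    by (intro ext) (simp add: of_cocycle_def)
  have scale: "of_cocycle n m \<phi> j (c *\<^sub>R x) = c *\<^sub>R of_cocycle n m \<phi> j x" if "x \<in> lev (T m) j" for j x c
    using that subspace_scale[OF subspace_T_lev that] linear_map_on_scale[OF Tm.pull_linear that]
      linear_map_on_scale[OF lin Tm.pull_mem]
    by (intro ext) (simp add: of_cocycle_def)
  have nat: "of_cocycle n m \<phi> l (pull (T m) k l q x) = pull (EM n) k l q (of_cocycle n m \<phi> k x)"
    if q: "q \<in> ordmaps l k" and x: "x \<in> lev (T m) k" for k l q x
    using x Tm.pull_mem[OF q x] Tm.pull_comp[OF _ q x] compose_ordmaps[OF _ q]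
    by (intro ext) (simp add: of_cocycle_def EM_def)
  show ?thesis
    unfolding ndual_iff simplicial_linear_map_def linear_map_on_def
    using EM add scale nat by (auto simp: of_cocycle_def[of n m \<phi>])
qed

lemma top_value_of_cocycle:
  assumes "x \<in> lev (T m) n"
  shows "top_value n (of_cocycle n m \<phi>) x = \<phi> x"
  using assms simplicial_vector_space.pull_id[OF simplicial_vector_space_T assms]
  by (simp add: top_value_def of_cocycle_def ordid_ordmaps)

lemma subspace_ndual: "subspace (lev (ndual n V) m)"
proof -
  have sub: "f + r *\<^sub>R g \<in> lev (ndual n V) m" if f: "f \<in> lev (ndual n V) m" and g: "g \<in> lev (ndual n V) m" for f g r
  proof -
    let ?\<phi> = "\<lambda>x. top_value n f x + r * top_value n g x"
    have "f + r *\<^sub>R g = of_cocycle n m ?\<phi>"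
      unfolding of_cocycle_def
      by (intro ext) (simp add: ndual_outside[OF f] ndual_value[OF f] ndual_value_outside[OF f]
          ndual_outside[OF g] ndual_value[OF g] ndual_value_outside[OF g])
    moreover have "cocycle n m ?\<phi>"
      using cocycle_top_value[OF f] cocycle_top_value[OF g]
      by (auto simp: cocycle_def linear_map_on_def algebra_simps)
    ultimately show ?thesis using of_cocycle_mem by metis
  qed
  show ?thesis
    unfolding subspace_def using sub[of _ _ 1] sub[OF zero_in_ndual] zero_in_ndual by auto
qed

lemma ndual_pull_eq:
  "pull (ndual n V) m l q f = (\<lambda>j x. if x \<in> lev (T l) j then f j (tensor_map l q j x) else 0)"
  by (simp add: ndual_def)

lemma top_value_pull:
  assumes "x \<in> lev (T l) n"
  shows "top_value n (pull (ndual n V) m l q f) x = top_value n f (tensor_map l q n x)"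
  using assms by (simp add: top_value_def ndual_pull_eq)

lemma top_value_pull_single:
  assumes "u \<in> ordmaps n l" "v \<in> lev V n"
  shows "top_value n (pull (ndual n V) m l q f) (single u v) = top_value n f (single (compose {..n} q u) v)"
  using top_value_pull[OF single_mem[OF assms]] tensor_map_single[OF assms(1)] by simp

lemma ndual_pull_mem:
  assumes f: "f \<in> lev (ndual n V) m" and q: "q \<in> ordmaps l m"
  shows "pull (ndual n V) m l q f \<in> lev (ndual n V) l"
proof -
  let ?\<phi> = "\<lambda>x. top_value n f (tensor_map l q n x)"
  have "cocycle n l ?\<phi>"
    unfolding cocycle_def
    using linear_map_on_comp[OF tensor_map_linear[OF q] top_value_linear[OF f]] tensor_map_degen[OF q]
      tensor_map_bd[OF q] linear_map_on_mem[OF tensor_map_linear[OF q]] cocycle_top_value[OF f]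
    by (auto simp: cocycle_def)
  moreover have "pull (ndual n V) m l q f = of_cocycle n l ?\<phi>"
    unfolding ndual_pull_eq of_cocycle_def
    using linear_map_on_mem[OF tensor_map_linear[OF q]] tensor_map_pull[OF q]
    by (intro ext) (simp add: ndual_value[OF f] ndual_value_outside[OF f])
  ultimately show ?thesis using of_cocycle_mem by metis
qed

lemma simplicial_vector_space_ndual: "simplicial_vector_space (ndual n V)"
proof
  fix m
  obtain B where B: "finite B" "lev (T m) n = span B"
    using simplicial_vector_space.finite_dim[OF simplicial_vector_space_T] by blast
  let ?\<Phi> = "\<lambda>f b. if b \<in> B then top_value n f b else 0"
  show "\<exists>B. finite B \<and> lev (ndual n V) m = span B"
  proof (rule finite_basis_of_embedding[OF subspace_ndual _ B(1), where \<Phi> = ?\<Phi>])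
    show "linear_map_on (lev (ndual n V) m) UNIV ?\<Phi>"
      by (auto simp: linear_map_on_def fun_eq_iff top_value_add top_value_scale)
    fix f assume f: "f \<in> lev (ndual n V) m" and 0: "?\<Phi> f = 0"
    have fB: "top_value n f b = 0" if "b \<in> B" for b
      using fun_cong[OF 0, of b] that by simp
    have "top_value n f x \<in> {0}" if "x \<in> lev (T m) n" for x
      by (rule linear_map_on_span_subset[OF top_value_linear[OF f] subspace_T_lev subspace_single_0, where B = B])
        (use B that span_superset[of B] fB in auto)
    then show "f = 0" using ndual_eqI[OF f zero_in_ndual] single_mem by (simp add: top_value_zero)
  qed auto
next
  show "linear_map_on (lev (ndual n V) m) (lev (ndual n V) l) (pull (ndual n V) m l q)" if "q \<in> ordmaps l m" for q l m
    using ndual_pull_mem[OF _ that] by (auto simp: linear_map_on_def ndual_pull_eq fun_eq_iff)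
next
  fix f m assume f: "f \<in> lev (ndual n V) m"
  show "pull (ndual n V) m m (ordid m) f = f"
    by (rule ndual_eqI[OF ndual_pull_mem[OF f ordid_ordmaps] f])
      (simp add: top_value_pull_single compose_ordid_left)
next
  fix p j l q m f assume p: "p \<in> ordmaps j l" and q: "q \<in> ordmaps l m" and f: "f \<in> lev (ndual n V) m"
  show "pull (ndual n V) m j (compose {..j} q p) f = pull (ndual n V) l j p (pull (ndual n V) m l q f)"
    by (rule ndual_eqI[OF ndual_pull_mem[OF f compose_ordmaps[OF p q]] ndual_pull_mem[OF ndual_pull_mem[OF f q] p]])
      (simp add: top_value_pull_single compose_ordmaps[OF _ p] compose_ordmaps_assoc)
qed

text \<open>A simplex that misses the vertex \<open>a\<close> factors through the \<open>a\<close>-th coface, and restriction along this coface is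
  the \<open>a\<close>-th face map of the dual.\<close>

lemma faces_zero_iff:
  assumes f: "f \<in> lev (ndual n V) (Suc i)" and A: "A \<subseteq> {..Suc i}"
  shows "(\<forall>a\<in>A. face (ndual n V) (Suc i) a f = 0) \<longleftrightarrow> (\<forall>x\<in>missing (Suc i) A n. top_value n f x = 0)"
proof (intro iffI ballI)
  fix x assume faces: "\<forall>a\<in>A. face (ndual n V) (Suc i) a f = 0" and x: "x \<in> missing (Suc i) A n"
  have "top_value n f x \<in> {0}"
  proof (rule missing_linear_mem[OF top_value_linear[OF f] subspace_single_0 x])
    fix u v a assume u: "u \<in> ordmaps n (Suc i)" "v \<in> lev V n" "a \<in> A" "a \<notin> u ` {..n}"
    then obtain u' where u': "u' \<in> ordmaps n i" "u = compose {..n} (coface (Suc i) a) u'"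
      using missing_last_vertex[OF u(1,4)] A by auto
    have "top_value n f (single u v) = top_value n (face (ndual n V) (Suc i) a f) (single u' v)"
      unfolding u'(2) face_def using top_value_pull_single[OF u'(1) u(2)] by simp
    then show "top_value n f (single u v) \<in> {0}" using faces u(3) by (simp add: top_value_zero)
  qed
  then show "top_value n f x = 0" by simp
next
  fix a assume zero: "\<forall>x\<in>missing (Suc i) A n. top_value n f x = 0" and a: "a \<in> A"
  have fm: "face (ndual n V) (Suc i) a f \<in> lev (ndual n V) i"
    unfolding face_def using ndual_pull_mem[OF f coface_ordmaps] by simp
  show "face (ndual n V) (Suc i) a f = 0"
  proof (rule ndual_eqI[OF fm zero_in_ndual])
    fix u v assume u: "u \<in> ordmaps n i" "v \<in> lev V n"
    have "a \<notin> compose {..n} (coface (Suc i) a) u ` {..n}"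
      using ordmaps_apply[OF u(1)] by (auto simp: compose_apply coface_apply)
    from single_missing[OF compose_ordmaps[OF u(1) coface_ordmaps] u(2) a this] zero
    have "top_value n f (single (compose {..n} (coface (Suc i) a) u) v) = 0" by blast
    then show "top_value n (face (ndual n V) (Suc i) a f) (single u v) = top_value n 0 (single u v)"
      unfolding face_def using top_value_pull_single[OF u] by (simp add: top_value_zero)
  qed
qed

lemma cycles_ndual_iff:
  assumes f: "f \<in> lev (ndual n V) i"
  shows "f \<in> cycles (ndual n V) i \<longleftrightarrow> (\<forall>x\<in>missing i {..i} n. top_value n f x = 0)"
proof (cases i)
  case 0
  have "top_value n f 0 = 0"
    using linear_map_on_zero[OF top_value_linear[OF f] subspace_T_lev] .
  then show ?thesis
    using f missing_0[of _ n] 0 simplicial_vector_space.cycles_iff[OF simplicial_vector_space_ndual, of f n i] by auto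
next
  case (Suc k)
  then show ?thesis
    using f faces_zero_iff[of f n k "{..Suc k}"]
      simplicial_vector_space.cycles_iff[OF simplicial_vector_space_ndual, of f n i] by auto
qed

section \<open>The left induced map\<close>

lemma npairing_value:
  assumes f: "f \<in> lev (ndual n V) l" and v: "v \<in> lev V l" and \<sigma>: "\<sigma> \<in> ordmaps n l"
  shows "npairing l f v \<sigma> = top_value n f (single \<sigma> (pull V l n \<sigma> v))"
  unfolding npairing_def ndual_value[OF f single_mem[OF ordid_ordmaps v] \<sigma>]
    tensor_pull_single[OF \<sigma> ordid_ordmaps] compose_ordid_left[OF \<sigma>] ..

text \<open>The cocycle that belongs to the simplicial map \<open>left_induced n V k v\<close>.\<close>

definition pairing_functional :: "nat \<Rightarrow> nat \<Rightarrow> 'a \<Rightarrow> ((nat \<Rightarrow> nat) \<Rightarrow> 'a dual) \<Rightarrow> real" where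
  "pairing_functional n k v x = (\<Sum>q\<in>ordmaps n k. top_value n (x q) (single (ordid n) (pull V k n q v)))"

lemma pairing_functional_linear: "linear_map_on S UNIV (pairing_functional n k v)"
  by (simp add: linear_map_on_def pairing_functional_def top_value_add top_value_scale sum.distrib sum_distrib_left)

lemma pairing_functional_single:
  assumes "q \<in> ordmaps n k"
  shows "pairing_functional n k v (single q f) = top_value n f (single (ordid n) (pull V k n q v))"
  unfolding pairing_functional_def
  by (rule sum_ordmaps_single[OF assms, of "\<lambda>q f. top_value n f (single (ordid n) (pull V k n q v))"])
    (simp add: top_value_zero)

lemma left_induced_eq_of_cocycle:
  assumes v: "v \<in> lev V k"
  shows "left_induced n V k v = simplicial_vector_space.of_cocycle (ndual n V) n k (pairing_functional n k v)"
proof -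
  interpret D: simplicial_vector_space "ndual n V" by (rule simplicial_vector_space_ndual)
  show ?thesis
  proof (intro ext)
    fix l x \<sigma>
    show "left_induced n V k v l x \<sigma> = D.of_cocycle n k (pairing_functional n k v) l x \<sigma>"
    proof (cases "x \<in> lev (D.T k) l \<and> \<sigma> \<in> ordmaps n l")
      case True
      then have x: "x \<in> lev (D.T k) l" and \<sigma>: "\<sigma> \<in> ordmaps n l" by auto
      interpret DT: simplicial_vector_space "D.T k" by (rule D.simplicial_vector_space_T)
      have lin: "linear_map_on (lev (D.T k) l) UNIV (\<lambda>x. \<Sum>q\<in>ordmaps l k. npairing l (x q) (pull V k l q v) \<sigma>)"
        by (simp add: linear_map_on_def npairing_def sum.distrib sum_distrib_left)
      have "(\<Sum>q\<in>ordmaps l k. npairing l (x q) (pull V k l q v) \<sigma>) = pairing_functional n k v (pull (D.T k) l n \<sigma> x)"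
      proof (rule D.T_linear_eq[OF lin linear_map_on_comp[OF DT.pull_linear[OF \<sigma>] pairing_functional_linear] x])
        fix q f assume q: "q \<in> ordmaps l k" and f: "f \<in> lev (ndual n V) l"
        have "(\<Sum>p\<in>ordmaps l k. npairing l (single q f p) (pull V k l p v) \<sigma>) = npairing l f (pull V k l q v) \<sigma>"
          by (rule sum_ordmaps_single[OF q, of "\<lambda>p f. npairing l f (pull V k l p v) \<sigma>"]) (simp add: npairing_def)
        also have "\<dots> = top_value n f (single \<sigma> (pull V k n (compose {..n} q \<sigma>) v))"
          unfolding npairing_value[OF f pull_mem[OF q v] \<sigma>] pull_comp[OF \<sigma> q v] ..
        also have "\<dots> = top_value n (pull (ndual n V) l n \<sigma> f) (single (ordid n) (pull V k n (compose {..n} q \<sigma>) v))"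
          using top_value_pull_single[OF ordid_ordmaps pull_mem[OF compose_ordmaps[OF \<sigma> q] v]]
          by (simp add: compose_ordid_right[OF \<sigma>])
        also have "\<dots> = pairing_functional n k v (pull (D.T k) l n \<sigma> (single q f))"
          unfolding D.tensor_pull_single[OF \<sigma> q] pairing_functional_single[OF compose_ordmaps[OF \<sigma> q]] ..
        finally show "(\<Sum>p\<in>ordmaps l k. npairing l (single q f p) (pull V k l p v) \<sigma>) =
          pairing_functional n k v (pull (D.T k) l n \<sigma> (single q f))" .
      qed
      then show ?thesis
        using x \<sigma> by (simp add: left_induced_def D.of_cocycle_def sum_fun_apply)
    next
      case False
      have "npairing l (x q) w \<sigma> = 0" if "x \<in> lev (D.T k) l" for q w
        unfolding npairing_def by (rule ndual_value_outside[OF D.T_value_mem[OF that]]) (use False that in blast)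
      then have "left_induced n V k v l x \<sigma> = 0"
        by (cases "x \<in> lev (D.T k) l") (simp_all add: left_induced_def sum_fun_apply)
      moreover have "D.of_cocycle n k (pairing_functional n k v) l x \<sigma> = 0"
        using False by (cases "x \<in> lev (D.T k) l") (simp_all add: D.of_cocycle_def)
      ultimately show ?thesis by simp
    qed
  qed
qed

text \<open>On a generator pulled back along \<open>p : [n] \<rightarrow> [l]\<close>, the functional is the value of \<open>f\<close> on the pullback along \<open>p\<close> of
  the generator at the identity of \<open>[l]\<close>. For a codegeneracy \<open>p\<close> this is the value of the cocycle \<open>f\<close> on a degenerate
  chain, and the alternating sum over all cofaces \<open>p\<close> is its value on a boundary.\<close>

lemma cocycle_pairing_functional:
  assumes v: "v \<in> lev V k"
  shows "simplicial_vector_space.cocycle (ndual n V) n k (pairing_functional n k v)"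
proof -
  interpret D: simplicial_vector_space "ndual n V" by (rule simplicial_vector_space_ndual)
  have key: "pairing_functional n k v (single (compose {..n} q p) (pull (ndual n V) l n p f)) =
      top_value n f (single p (pull V l n p (pull V k l q v)))"
    if p: "p \<in> ordmaps n l" and q: "q \<in> ordmaps l k" for p q l f
    unfolding pairing_functional_single[OF compose_ordmaps[OF p q]] pull_comp[OF p q v]
    using top_value_pull_single[OF ordid_ordmaps pull_mem[OF p pull_mem[OF q v]]]
    by (simp add: compose_ordid_right[OF p])
  show ?thesis
    unfolding D.cocycle_def
  proof (intro conjI ballI)
    show "linear_map_on (lev (D.T k) n) UNIV (pairing_functional n k v)" by (rule pairing_functional_linear)
    fix x assume x: "x \<in> degen (D.T k) n"
    show "pairing_functional n k v x = 0"
    proof (cases n)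
      case 0
      then have "x = 0" using x degen_0 by auto
      then show ?thesis
        using linear_map_on_zero[OF pairing_functional_linear subspace_UNIV] by simp
    next
      case (Suc m)
      \<comment> \<open>Only the degree is rewritten; \<open>n\<close> also determines the dual.\<close>
      have x': "x \<in> degen (D.T k) (Suc m)"
        by (rule subst[OF Suc, where P = "\<lambda>i. x \<in> degen (D.T k) i", OF x])
      have "pairing_functional n k v x \<in> {0}"
      proof (rule D.degen_T_linear_mem[OF pairing_functional_linear subspace_single_0 x'])
        fix q f j assume q: "q \<in> ordmaps m k" and f: "f \<in> lev (ndual n V) m" and j: "j \<le> m"
        have s: "codegeneracy m j \<in> ordmaps n m" using codegeneracy_ordmaps[OF j] Suc by simp
        have w: "pull V k m q v \<in> lev V m" using pull_mem[OF q v] .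
        have "single (codegeneracy m j) (pull V m n (codegeneracy m j) (pull V k m q v)) =
            degeneracy (T m) m j (single (ordid m) (pull V k m q v))"
          unfolding T_degeneracy_single[OF ordid_ordmaps j] using compose_ordid_left[OF s] Suc by (simp add: degeneracy_def)
        then have "single (codegeneracy m j) (pull V m n (codegeneracy m j) (pull V k m q v)) \<in> degen (T m) n"
          using degeneracy_in_degen[OF j single_mem[OF ordid_ordmaps w]] Suc by simp
        then have "top_value n f (single (codegeneracy m j) (pull V m n (codegeneracy m j) (pull V k m q v))) = 0"
          using cocycle_top_value[OF f] by (simp add: cocycle_def)
        then show "pairing_functional n k v (single (compose {..Suc m} q (codegeneracy m j)) (degeneracy (ndual n V) m j f)) \<in> {0}"
          unfolding degeneracy_def Suc[symmetric] key[OF s q] by simp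
      qed
      then show ?thesis by simp
    qed
  next
    fix x assume x: "x \<in> lev (D.T k) (Suc n)"
    have "pairing_functional n k v (alternating_bd (D.T k) (Suc n) x) \<in> {0}"
    proof (rule D.T_linear_mem[OF linear_map_on_comp[OF D.T_bd_linear pairing_functional_linear] subspace_single_0 x])
      fix q assume q: "q \<in> ordmaps (Suc n) k"
      let ?f = "x q" and ?w = "pull V k (Suc n) q v"
      have f: "?f \<in> lev (ndual n V) (Suc n)" using D.T_value_mem[OF x] .
      have w: "?w \<in> lev V (Suc n)" using pull_mem[OF q v] .
      have mem: "single (coface (Suc n) i) (face V (Suc n) i ?w) \<in> lev (T (Suc n)) n" for i
        using single_mem[OF coface_ordmaps face_mem[OF w]] .
      have "pairing_functional n k v (alternating_bd (D.T k) (Suc n) (single q ?f)) =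
          (\<Sum>i\<le>Suc n. (- 1) ^ i * pairing_functional n k v (single (compose {..n} q (coface (Suc n) i)) (face (ndual n V) (Suc n) i ?f)))"
        unfolding D.T_bd_single[OF q]
        using linear_map_on_scale[OF pairing_functional_linear[of UNIV]]
        by (subst linear_map_on_sum[OF pairing_functional_linear subspace_UNIV]) auto
      also have "\<dots> = (\<Sum>i\<le>Suc n. top_value n ?f ((- 1) ^ i *\<^sub>R single (coface (Suc n) i) (face V (Suc n) i ?w)))"
        using key[OF coface_ordmaps q] linear_map_on_scale[OF top_value_linear[OF f] mem] by (simp add: face_def)
      also have "\<dots> = top_value n ?f (\<Sum>i\<le>Suc n. (- 1) ^ i *\<^sub>R single (coface (Suc n) i) (face V (Suc n) i ?w))"
        by (rule linear_map_on_sum[OF top_value_linear[OF f] subspace_T_lev, symmetric])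
          (use mem subspace_scale[OF subspace_T_lev] in auto)
      also have "\<dots> = top_value n ?f (alternating_bd (T (Suc n)) (Suc n) (single (ordid (Suc n)) ?w))"
        unfolding T_bd_single[OF ordid_ordmaps] compose_ordid_left[OF coface_ordmaps] ..
      also have "\<dots> = 0"
        using cocycle_top_value[OF f] single_mem[OF ordid_ordmaps w] by (simp add: cocycle_def)
      finally show "pairing_functional n k v (alternating_bd (D.T k) (Suc n) (single q ?f)) \<in> {0}" by simp
    qed
    then show "pairing_functional n k v (alternating_bd (D.T k) (Suc n) x) = 0" by simp
  qed
qed

lemma left_induced_mem:
  assumes "v \<in> lev V k"
  shows "left_induced n V k v \<in> lev (ndual n (ndual n V)) k"
  unfolding left_induced_eq_of_cocycle[OF assms]
  by (rule simplicial_vector_space.of_cocycle_mem[OF simplicial_vector_space_ndual cocycle_pairing_functional[OF assms]])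

lemma top_value_left_induced:
  assumes v: "v \<in> lev V k" and q: "q \<in> ordmaps n k" and f: "f \<in> lev (ndual n V) n"
  shows "top_value n (left_induced n V k v) (single q f) = top_value n f (single (ordid n) (pull V k n q v))"
proof -
  interpret D: simplicial_vector_space "ndual n V" by (rule simplicial_vector_space_ndual)
  show ?thesis
    unfolding left_induced_eq_of_cocycle[OF v] D.top_value_of_cocycle[OF D.single_mem[OF q f]]
      pairing_functional_single[OF q] ..
qed

lemma simplicial_linear_map_left_induced: "simplicial_linear_map V (ndual n (ndual n V)) (left_induced n V)"
proof -
  interpret D: simplicial_vector_space "ndual n V" by (rule simplicial_vector_space_ndual)
  interpret DD: simplicial_vector_space "ndual n (ndual n V)" by (rule D.simplicial_vector_space_ndual)
  have lin: "linear_map_on (lev V n) UNIV (\<lambda>w. top_value n f (single (ordid n) w))" if "f \<in> lev (ndual n V) n" for f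
    using linear_map_on_add[OF top_value_linear[OF that]] linear_map_on_scale[OF top_value_linear[OF that]]
      single_mem[OF ordid_ordmaps] by (auto simp: linear_map_on_def single_add single_scale)
  show ?thesis
    unfolding simplicial_linear_map_def linear_map_on_def
  proof (intro conjI allI ballI funcsetI)
    fix k v assume v: "v \<in> lev V k"
    show "left_induced n V k v \<in> lev (ndual n (ndual n V)) k" by (rule left_induced_mem[OF v])
    show "left_induced n V k (c *\<^sub>R v) = c *\<^sub>R left_induced n V k v" for c
      by (rule D.ndual_eqI[OF left_induced_mem subspace_scale[OF D.subspace_ndual left_induced_mem]])
        (use v subspace_scale[OF subspace_lev v, of c] in \<open>simp_all add: top_value_scale top_value_left_induced
          linear_map_on_scale[OF pull_linear] linear_map_on_scale[OF lin] pull_mem\<close>)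
    show "left_induced n V k (v + w) = left_induced n V k v + left_induced n V k w" if w: "w \<in> lev V k" for w
      by (rule D.ndual_eqI[OF left_induced_mem subspace_add[OF D.subspace_ndual left_induced_mem left_induced_mem]])
        (use v w subspace_add[OF subspace_lev v w] in \<open>simp_all add: top_value_add top_value_left_induced
          linear_map_on_add[OF pull_linear] linear_map_on_add[OF lin] pull_mem\<close>)
    fix l q assume q: "q \<in> ordmaps l k"
    show "left_induced n V l (pull V k l q v) = pull (ndual n (ndual n V)) k l q (left_induced n V k v)"
      by (rule D.ndual_eqI[OF left_induced_mem[OF pull_mem[OF q v]] DD.pull_mem[OF q left_induced_mem[OF v]]])
        (simp add: D.top_value_pull_single top_value_left_induced pull_mem[OF q v] v compose_ordmaps[OF _ q]
          pull_comp[OF _ q v])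
  qed
qed

lemma lattice_paths_complement:
  assumes S: "S \<in> lattice_paths (i + j) i"
  shows "{..<i + j} - S \<in> lattice_paths (j + i) j"
    and "hpos (j + i) ({..<i + j} - S) = vpos (i + j) S" and "vpos (j + i) ({..<i + j} - S) = hpos (i + j) S"
    and "path_sign ({..<i + j} - S) = path_sign {..<i + j} * path_sign S"
proof -
  have sub: "S \<subseteq> {..<i + j}" "card S = i" "finite S" using S finite_path[OF S] by (auto simp: lattice_paths_def)
  then show "{..<i + j} - S \<in> lattice_paths (j + i) j"
    by (auto simp: lattice_paths_def card_Diff_subset add.commute)
  have st: "steps_before ({..<i + j} - S) t = t - steps_before S t" if "t \<le> i + j" for t
  proof -
    have "({..<i + j} - S) \<inter> {..<t} = {..<t} - S \<inter> {..<t}" using that by auto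
    then show ?thesis by (simp add: steps_before_def card_Diff_subset)
  qed
  show "hpos (j + i) ({..<i + j} - S) = vpos (i + j) S" "vpos (j + i) ({..<i + j} - S) = hpos (i + j) S"
    using steps_before_le[of S] by (auto simp: hpos_def vpos_def fun_eq_iff st add.commute)
  have "\<Sum>{..<i + j} = \<Sum>({..<i + j} - S) + \<Sum>S"
    using sum.subset_diff[OF sub(1), of "\<lambda>x. x"] by simp
  then show "path_sign ({..<i + j} - S) = path_sign {..<i + j} * path_sign S"
    by (simp add: path_sign_def power_add)
qed

text \<open>Exchanging the two factors of the pairing replaces every lattice path by its complement, which interchanges the
  two coordinates and multiplies all signs by the same factor.\<close>

lemma left_induced_EZ:
  assumes v: "v \<in> lev V j" and f: "f \<in> lev (ndual n V) i" and n: "n = i + j"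
  shows "top_value n (left_induced n V j v) (simplicial_vector_space.EZ (ndual n V) j i f) =
    path_sign {..<n} * top_value n f (EZ i j v)"
proof -
  interpret D: simplicial_vector_space "ndual n V" by (rule simplicial_vector_space_ndual)
  let ?P = "lattice_paths (i + j) i" and ?Q = "lattice_paths (j + i) j"
  have n': "n = j + i" using n by simp
  have hv: "hpos n S \<in> ordmaps n i \<and> vpos n S \<in> ordmaps n j" if "S \<in> ?P" for S
    using hpos_ordmaps[OF that] vpos_ordmaps[OF that refl] n by simp
  have hv': "hpos n R \<in> ordmaps n j \<and> vpos n R \<in> ordmaps n i" if "R \<in> ?Q" for R
    using hpos_ordmaps[OF that] vpos_ordmaps[OF that refl] n' by simp
  note lin = D.top_value_linear[OF left_induced_mem[OF v]]
  have m1: "single (hpos n S) (pull V j n (vpos n S) v) \<in> lev (T i) n" if "S \<in> ?P" for S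
    using single_mem pull_mem[OF _ v] hv[OF that] by auto
  have m2: "single (hpos n R) (pull (ndual n V) i n (vpos n R) f) \<in> lev (D.T j) n" if "R \<in> ?Q" for R
    using D.single_mem D.pull_mem[OF _ f] hv'[OF that] by auto
  have val: "top_value n (left_induced n V j v) (single (hpos n R) (pull (ndual n V) i n (vpos n R) f)) =
      top_value n f (single (vpos n R) (pull V j n (hpos n R) v))" if "R \<in> ?Q" for R
    using hv'[OF that] top_value_left_induced[OF v _ D.pull_mem[OF _ f]]
      top_value_pull_single[OF ordid_ordmaps pull_mem[OF _ v]] compose_ordid_right by simp
  have "top_value n (left_induced n V j v) (D.EZ j i f) =
      (\<Sum>R\<in>?Q. path_sign R * top_value n (left_induced n V j v) (single (hpos n R) (pull (ndual n V) i n (vpos n R) f)))"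
    unfolding D.EZ_def n'[symmetric]
    using linear_map_on_scale[OF lin m2] m2 subspace_scale[OF D.subspace_T_lev] n'
    by (subst linear_map_on_sum[OF lin D.subspace_T_lev]) auto
  also have "\<dots> = (\<Sum>R\<in>?Q. path_sign R * top_value n f (single (vpos n R) (pull V j n (hpos n R) v)))"
    using val by simp
  also have "\<dots> = (\<Sum>S\<in>?P. path_sign {..<n} * (path_sign S * top_value n f (single (hpos n S) (pull V j n (vpos n S) v))))"
  proof (rule sum.reindex_bij_witness[where i = "\<lambda>S. {..<n} - S" and j = "\<lambda>R. {..<n} - R"])
    fix R assume R: "R \<in> ?Q"
    then show "{..<n} - ({..<n} - R) = R" unfolding n' by (auto simp: lattice_paths_def)
    show S: "{..<n} - R \<in> ?P" using lattice_paths_complement(1)[OF R] n' by simp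
    have "{..<n} - ({..<n} - R) = R" using R unfolding n' by (auto simp: lattice_paths_def)
    then show "path_sign {..<n} * (path_sign ({..<n} - R) * top_value n f
        (single (hpos n ({..<n} - R)) (pull V j n (vpos n ({..<n} - R)) v))) =
        path_sign R * top_value n f (single (vpos n R) (pull V j n (hpos n R) v))"
      using lattice_paths_complement[OF S] n n' by (simp add: add.commute)
  next
    fix S assume S: "S \<in> ?P"
    then show "{..<n} - ({..<n} - S) = S" unfolding n by (auto simp: lattice_paths_def)
    show "{..<n} - S \<in> ?Q" using lattice_paths_complement(1)[OF S] n by simp
  qed
  also have "\<dots> = path_sign {..<n} * top_value n f (EZ i j v)"
    unfolding EZ_def n[symmetric] sum_distrib_left[symmetric]
    using linear_map_on_scale[OF top_value_linear[OF f] m1] m1 subspace_scale[OF subspace_T_lev] n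
    by (subst linear_map_on_sum[OF top_value_linear[OF f] subspace_T_lev]) auto
  finally show ?thesis .
qed

end

section \<open>Duality on homology\<close>

context simplicial_vector_space
begin

lemma top_value_rel_boundaries:
  assumes f: "f \<in> cycles (ndual n V) i" and x: "x \<in> rel_boundaries i n"
  shows "top_value n f x = 0"
proof -
  have fl: "f \<in> lev (ndual n V) i"
    using f simplicial_vector_space.cycles_iff[OF simplicial_vector_space_ndual] by blast
  obtain y p d where y: "y \<in> lev (T i) (Suc n)" and p: "p \<in> missing i {..i} n" and d: "d \<in> degen (T i) n"
    and xe: "x = alternating_bd (T i) (Suc n) y + p + d"
    using x by (elim rel_boundariesE)
  have b: "alternating_bd (T i) (Suc n) y \<in> lev (T i) n" using linear_map_on_mem[OF T_bd_linear y] .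
  note pl = subsetD[OF missing_subset p] and dl = subsetD[OF T_degen_subset d]
  have "top_value n f x = top_value n f (alternating_bd (T i) (Suc n) y) + top_value n f p + top_value n f d"
    unfolding xe using linear_map_on_add[OF top_value_linear[OF fl]] b pl dl subspace_add[OF subspace_T_lev b pl] by simp
  then show ?thesis
    using cocycle_top_value[OF fl] y d p f[unfolded cycles_ndual_iff[OF fl]] by (simp add: cocycle_def)
qed

text \<open>Write \<open>f\<close> as the last face of a cocycle \<open>g\<close> that vanishes on the horn. Then \<open>g\<close> vanishes on the boundary of
  \<open>EZ (i + 1) j v\<close>, which is \<open>- EZ i j v\<close> on the last face up to the horn.\<close>

lemma pairing_boundary_left:
  assumes f: "f \<in> boundaries (ndual n V) i" and v: "v \<in> cycles V j" and n: "n = i + j"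
  shows "top_value n f (EZ i j v) = 0"
proof -
  interpret D: simplicial_vector_space "ndual n V" by (rule simplicial_vector_space_ndual)
  obtain g where g: "g \<in> lev (ndual n V) (Suc i)" "\<forall>a\<le>i. face (ndual n V) (Suc i) a g = 0"
    "face (ndual n V) (Suc i) (Suc i) g = f"
    using f unfolding D.boundaries_iff by blast
  have horn: "top_value n g x = 0" if "x \<in> missing (Suc i) {..<Suc i} n" for x
  proof -
    have "{..<Suc i} \<subseteq> {..Suc i}" by auto
    from faces_zero_iff[OF g(1) this] show ?thesis using g(2) that by auto
  qed
  have vl: "v \<in> lev V j" using v by (simp add: cycles_iff)
  have E: "EZ i j v \<in> lev (T i) n" "EZ (Suc i) j v \<in> lev (T (Suc i)) (Suc n)"
    using EZ_mem[OF vl, of i] EZ_mem[OF vl, of "Suc i"] n by simp_all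
  have lE: "last_face i n (EZ i j v) \<in> lev (T (Suc i)) n" using linear_map_on_mem[OF last_face_linear E(1)] .
  obtain l where l: "l \<in> missing (Suc i) {..<Suc i} n"
    "alternating_bd (T (Suc i)) (Suc n) (EZ (Suc i) j v) = l - last_face i n (EZ i j v)"
    using bd_EZ_cycle[OF v, of i] n by auto
  have "0 = top_value n g (l - last_face i n (EZ i j v))"
    using cocycle_top_value[OF g(1)] E(2) unfolding l(2)[symmetric] by (simp add: cocycle_def)
  also have "\<dots> = - top_value n g (last_face i n (EZ i j v))"
    using linear_map_on_diff[OF top_value_linear[OF g(1)] subspace_T_lev subsetD[OF missing_subset l(1)] lE]
      horn[OF l(1)] by simp
  also have "top_value n g (last_face i n (EZ i j v)) = top_value n f (EZ i j v)"
    unfolding g(3)[symmetric] face_def using top_value_pull[OF E(1), of "Suc i"] by simp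
  finally show ?thesis by simp
qed

text \<open>If \<open>v\<close> is the differential of \<open>w\<close>, then \<open>EZ i j v\<close> is, up to sign, the relative boundary of \<open>EZ i (j + 1) w\<close>.\<close>

lemma pairing_boundary_right:
  assumes f: "f \<in> cycles (ndual n V) i" and v: "v \<in> boundaries V j" and n: "n = i + j"
  shows "top_value n f (EZ i j v) = 0"
proof -
  have fl: "f \<in> lev (ndual n V) i"
    using f simplicial_vector_space.cycles_iff[OF simplicial_vector_space_ndual] by blast
  obtain w where w: "w \<in> normalized V (Suc j)" "v = differential V (Suc j) w"
    using v by (auto simp: boundaries_def)
  have "v \<in> cycles V j" using v boundaries_subset by blast
  then have vl: "v \<in> lev V j" by (simp add: cycles_iff)
  have E: "EZ i j v \<in> lev (T i) n" using EZ_mem[OF vl, of i] n by simp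
  have W: "EZ i (Suc j) w \<in> lev (T i) (Suc n)" using EZ_mem[of w "Suc j" i] w(1) normalized_subset n by auto
  obtain p where p: "p \<in> missing i {..i} n"
    "alternating_bd (T i) (Suc n) (EZ i (Suc j) w) = p + (- 1) ^ i *\<^sub>R EZ i j v"
    using bd_EZ_normalized[OF w(1), of i] w(2) n by auto
  have "(- 1) ^ i *\<^sub>R EZ i j v \<in> rel_boundaries i n"
    by (rule rel_boundariesI[OF W subspace_neg[OF subspace_missing p(1)] subspace_0[OF subspace_degen]])
      (simp add: p(2))
  from subspace_scale[OF subspace_rel_boundaries this, of "(- 1) ^ i"]
  have "EZ i j v \<in> rel_boundaries i n" by simp
  then show ?thesis by (rule top_value_rel_boundaries[OF f])
qed

text \<open>The cocycle \<open>f\<close> is regarded as a functional on the chains of the last face of \<open>\<Delta>[i + 1]\<close>, to be extended by zero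
  over the horn, the degenerate chains and the boundaries. The extension exists if \<open>f\<close> vanishes on every \<open>c\<close> whose
  image in \<open>\<Delta>[i + 1]\<close> is a sum of such chains. In that case the bounding chain \<open>y\<close> is a relative cycle of
  \<open>\<Delta>[i + 1]\<close>, hence by surjectivity of the shuffle product homologous to some \<open>EZ (i + 1) j v\<close>. Comparing the
  boundaries on the last face shows that \<open>c\<close> is homologous to \<open>- EZ i j v\<close>, where \<open>f\<close> vanishes by
  orthogonality.\<close>

lemma boundary_if_orthogonal_left:
  assumes f: "f \<in> cycles (ndual n V) i"
    and orth: "\<And>j v. n = i + j \<Longrightarrow> v \<in> cycles V j \<Longrightarrow> top_value n f (EZ i j v) = 0"
  shows "f \<in> boundaries (ndual n V) i"
proof -
  interpret D: simplicial_vector_space "ndual n V" by (rule simplicial_vector_space_ndual)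
  have fl: "f \<in> lev (ndual n V) i" using f D.cycles_iff by blast
  let ?S = "Suc i"
  \<comment> \<open>The chains on which the extension of \<open>f\<close> is to vanish.\<close>
  define U where "U = {a + b + c |a b c. a \<in> alternating_bd (T ?S) (Suc n) ` lev (T ?S) (Suc n) \<and>
     b \<in> missing ?S {..<?S} n \<and> c \<in> degen (T ?S) n}"
  have U: "subspace U"
    unfolding U_def
    by (intro subspace_sum3 subspace_missing subspace_degen subspace_linear_map_on_image[OF T_bd_linear] subspace_T_lev)
  have zero: "0 \<in> alternating_bd (T ?S) (Suc n) ` lev (T ?S) (Suc n)" "0 \<in> missing ?S {..<?S} n" "0 \<in> degen (T ?S) n"
    using subspace_0[OF subspace_linear_map_on_image[OF T_bd_linear subspace_T_lev]]
      subspace_0[OF subspace_missing] subspace_0[OF subspace_degen] by auto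
  have U_sub: "a \<in> U" if "a \<in> alternating_bd (T ?S) (Suc n) ` lev (T ?S) (Suc n) \<or> a \<in> missing ?S {..<?S} n \<or> a \<in> degen (T ?S) n" for a
  proof -
    have "a = a + 0 + 0" "a = 0 + a + 0" "a = 0 + 0 + a" by simp_all
    then show ?thesis using that zero unfolding U_def by blast
  qed
  have compat: "top_value n f c = 0" if c: "c \<in> lev (T i) n" and cU: "last_face i n c \<in> U" for c
  proof (cases "n < i")
    case True
    then show ?thesis using missing_small[OF c True] f[unfolded cycles_ndual_iff[OF fl]] by blast
  next
    case False
    then obtain j where n: "n = i + j" using le_Suc_ex not_less by blast
    obtain y l d where y: "y \<in> lev (T ?S) (Suc n)" and l: "l \<in> missing ?S {..<?S} n" and d: "d \<in> degen (T ?S) n"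
      and ce: "last_face i n c = alternating_bd (T ?S) (Suc n) y + l + d"
      using cU unfolding U_def by blast
    have "\<exists>v\<in>cycles V j. y - EZ ?S j v \<in> rel_boundaries ?S (?S + j)"
    proof (rule EZ_surjective)
      show "y \<in> lev (T ?S) (?S + j)" using y n by simp
      fix N assume "?S + j = Suc N"
      then have N: "N = n" using n by simp
      have "alternating_bd (T ?S) (Suc n) y = (last_face i n c - l) + - d" unfolding ce by simp
      then show "\<exists>p\<in>missing ?S {..?S} N. \<exists>d\<in>degen (T ?S) N. alternating_bd (T ?S) (Suc N) y = p + d"
        unfolding N using subspace_diff[OF subspace_missing last_face_boundary[OF c] horn_boundary[OF l]]
          subspace_neg[OF subspace_degen d] by blast
    qed
    then obtain v where v: "v \<in> cycles V j" "y - EZ ?S j v \<in> rel_boundaries ?S (Suc n)" using n by auto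
    obtain y2 p2 d2 where y2: "y2 \<in> lev (T ?S) (Suc (Suc n))" and p2: "p2 \<in> missing ?S {..?S} (Suc n)"
      and d2: "d2 \<in> degen (T ?S) (Suc n)" and e: "y - EZ ?S j v = alternating_bd (T ?S) (Suc (Suc n)) y2 + p2 + d2"
      using v(2) by (elim rel_boundariesE)
    obtain l2 c2 where l2: "l2 \<in> missing ?S {..<?S} (Suc n)" and c2: "c2 \<in> lev (T i) (Suc n)"
      and pe: "p2 = l2 + last_face i (Suc n) c2"
      using boundary_decompose[OF p2] by blast
    obtain l0 where l0: "l0 \<in> missing ?S {..<?S} n"
      "alternating_bd (T ?S) (Suc n) (EZ ?S j v) = l0 - last_face i n (EZ i j v)"
      using bd_EZ_cycle[OF v(1), of i] n by auto
    have vl: "v \<in> lev V j" using v(1) by (simp add: cycles_iff)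
    have E: "EZ i j v \<in> lev (T i) n" "EZ ?S j v \<in> lev (T ?S) (Suc n)"
      using EZ_mem[OF vl, of i] EZ_mem[OF vl, of ?S] n by simp_all
    have b2: "alternating_bd (T i) (Suc n) c2 \<in> lev (T i) n" using linear_map_on_mem[OF T_bd_linear c2] .
    have mems: "alternating_bd (T ?S) (Suc (Suc n)) y2 \<in> lev (T ?S) (Suc n)" "l2 \<in> lev (T ?S) (Suc n)"
      "last_face i (Suc n) c2 \<in> lev (T ?S) (Suc n)" "d2 \<in> lev (T ?S) (Suc n)"
      using linear_map_on_mem[OF T_bd_linear y2] subsetD[OF missing_subset l2] linear_map_on_mem[OF last_face_linear c2]
        subsetD[OF T_degen_subset d2] by auto
    have "y = EZ ?S j v + (alternating_bd (T ?S) (Suc (Suc n)) y2 + (l2 + (last_face i (Suc n) c2 + d2)))"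
      using e pe by (simp add: algebra_simps)
    then have "alternating_bd (T ?S) (Suc n) y = (l0 - last_face i n (EZ i j v)) +
        (alternating_bd (T ?S) (Suc n) l2 + (last_face i n (alternating_bd (T i) (Suc n) c2) + alternating_bd (T ?S) (Suc n) d2))"
      using linear_map_on_add[OF T_bd_linear] mems E subspace_add[OF subspace_T_lev] T_bd_bd[OF y2] last_face_bd[OF c2] l0(2)
      by simp
    then have "last_face i n c + last_face i n (EZ i j v) - last_face i n (alternating_bd (T i) (Suc n) c2) =
        (l0 + alternating_bd (T ?S) (Suc n) l2 + l) + (alternating_bd (T ?S) (Suc n) d2 + d)"
      unfolding ce by simp
    moreover have "last_face i n (c + EZ i j v - alternating_bd (T i) (Suc n) c2) =
        last_face i n c + last_face i n (EZ i j v) - last_face i n (alternating_bd (T i) (Suc n) c2)"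
      using linear_map_on_diff[OF last_face_linear subspace_T_lev subspace_add[OF subspace_T_lev c E(1)] b2]
        linear_map_on_add[OF last_face_linear c E(1)] by simp
    ultimately have eq: "last_face i n (c + EZ i j v - alternating_bd (T i) (Suc n) c2) =
        (l0 + alternating_bd (T ?S) (Suc n) l2 + l) + (alternating_bd (T ?S) (Suc n) d2 + d)" by simp
    obtain p3 d3 where p3: "p3 \<in> missing i {..i} n" and d3: "d3 \<in> degen (T i) n"
      and e3: "c + EZ i j v - alternating_bd (T i) (Suc n) c2 = p3 + d3"
      using last_face_cancel[OF subspace_diff[OF subspace_T_lev subspace_add[OF subspace_T_lev c E(1)] b2]
          subspace_add[OF subspace_missing subspace_add[OF subspace_missing l0(1) bd_missing[OF l2]] l]
          subspace_add[OF subspace_degen T_bd_degen[OF d2] d] eq] by blast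
    have "c + EZ i j v \<in> rel_boundaries i n"
      by (rule rel_boundariesI[OF c2 p3 d3]) (use e3 in \<open>simp add: algebra_simps\<close>)
    then have "top_value n f (c + EZ i j v) = 0" by (rule top_value_rel_boundaries[OF f])
    then show ?thesis
      using linear_map_on_add[OF top_value_linear[OF fl] c E(1)] orth[OF n v(1)] by simp
  qed
  have "linear_map_on (lev (T i) n) UNIV (last_face i n)"
    by (rule linear_map_on_subset[OF last_face_linear]) auto
  from functional_extension[OF subspace_T_lev U this top_value_linear[OF fl] compat]
  obtain g where g: "linear g" "\<forall>x\<in>U. g x = 0" "\<forall>c\<in>lev (T i) n. g (last_face i n c) = top_value n f c" by blast
  define G where "G = of_cocycle n ?S g"
  have "cocycle n ?S g"
    unfolding cocycle_def using g(1,2) U_sub by (auto simp: linear_map_on_def linear_add linear_scale)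
  then have G: "G \<in> lev (ndual n V) ?S" unfolding G_def by (rule of_cocycle_mem)
  have val: "top_value n G x = g x" if "x \<in> lev (T ?S) n" for x
    unfolding G_def by (rule top_value_of_cocycle[OF that])
  have "{..<?S} \<subseteq> {..?S}" by auto
  moreover have "\<forall>x\<in>missing ?S {..<?S} n. top_value n G x = 0"
    using val g(2) U_sub subsetD[OF missing_subset] by metis
  ultimately have "\<forall>a\<in>{..<?S}. face (ndual n V) ?S a G = 0"
    using faces_zero_iff[OF G] by blast
  moreover have "face (ndual n V) ?S ?S G = f"
  proof (rule ndual_eqI[OF D.face_mem[OF G] fl])
    fix u v assume u: "u \<in> ordmaps n i" "v \<in> lev V n"
    have m: "single u v \<in> lev (T i) n" using single_mem[OF u] .
    show "top_value n (face (ndual n V) ?S ?S G) (single u v) = top_value n f (single u v)"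
      unfolding face_def using top_value_pull[OF m, of ?S] val[OF linear_map_on_mem[OF last_face_linear m]] g(3) m by simp
  qed
  ultimately show ?thesis
    unfolding D.boundaries_iff using G by (intro bexI[of _ G]) auto
qed

text \<open>If \<open>v\<close> does not bound, then \<open>EZ i j v\<close> is not a relative boundary, since the shuffle product is injective on
  homology. A functional that separates it from the relative boundaries is a cycle of the dual.\<close>

lemma boundary_if_orthogonal_right:
  assumes v: "v \<in> cycles V j" and n: "n = i + j"
    and orth: "\<And>f. f \<in> cycles (ndual n V) i \<Longrightarrow> top_value n f (EZ i j v) = 0"
  shows "v \<in> boundaries V j"
proof (rule ccontr)
  assume "v \<notin> boundaries V j"
  then have "EZ i j v \<notin> rel_boundaries i n" using EZ_injective[OF v, of i] n by blast
  then obtain g where g: "linear g" "\<forall>x\<in>rel_boundaries i n. g x = (0::real)" "g (EZ i j v) = 1"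
    using separating_functional[OF subspace_rel_boundaries] by blast
  have rel: "alternating_bd (T i) (Suc n) y + p + d \<in> rel_boundaries i n"
    if "y \<in> lev (T i) (Suc n)" "p \<in> missing i {..i} n" "d \<in> degen (T i) n" for y p d
    using rel_boundariesI[OF that refl] .
  note zero = subspace_0[OF subspace_T_lev] subspace_0[OF subspace_missing] subspace_0[OF subspace_degen]
  have bd0: "alternating_bd (T i) (Suc n) 0 = 0" using linear_map_on_zero[OF T_bd_linear subspace_T_lev] .
  have "cocycle n i g"
    unfolding cocycle_def
    using g(1,2) rel[OF zero(1,2)] rel[OF _ zero(2,3)] bd0 by (auto simp: linear_map_on_def linear_add linear_scale)
  then have G: "of_cocycle n i g \<in> lev (ndual n V) i" by (rule of_cocycle_mem)
  have "top_value n (of_cocycle n i g) x = 0" if "x \<in> missing i {..i} n" for x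
    using top_value_of_cocycle[OF subsetD[OF missing_subset that]] rel[OF zero(1) that zero(3)] bd0 g(2) by simp
  then have "of_cocycle n i g \<in> cycles (ndual n V) i" using cycles_ndual_iff[OF G] by blast
  from orth[OF this] show False
    using top_value_of_cocycle[of "EZ i j v" i n g] EZ_mem[of v j i] v n g(3) by (simp add: cycles_iff)
qed

text \<open>If the image of \<open>z\<close> bounds, then it is orthogonal to the cycles of the dual; by the symmetry of the pairing so is
  \<open>z\<close> itself.\<close>

lemma left_induced_homology_injective:
  assumes z: "z \<in> cycles V j" and j: "j \<le> n" and b: "left_induced n V j z \<in> boundaries (ndual n (ndual n V)) j"
  shows "z \<in> boundaries V j"
proof -
  interpret D: simplicial_vector_space "ndual n V" by (rule simplicial_vector_space_ndual)
  obtain i where n: "n = i + j" using j by (metis add.commute le_Suc_ex)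
  have zl: "z \<in> lev V j" using z by (simp add: cycles_iff)
  show ?thesis
  proof (rule boundary_if_orthogonal_right[OF z n])
    fix f assume f: "f \<in> cycles (ndual n V) i"
    have "top_value n (left_induced n V j z) (D.EZ j i f) = 0"
      by (rule D.pairing_boundary_left[OF b f]) (simp add: n)
    then show "top_value n f (EZ i j z) = 0"
      using left_induced_EZ[OF zl _ n, of f] f by (simp add: D.cycles_iff path_sign_def)
  qed
qed

text \<open>Pairing with \<open>w\<close> is a functional on the cycles of the dual. It vanishes on those cycles that are orthogonal to all
  cycles of \<open>V\<close>, because they bound. As the cycles of \<open>V\<close> are finite-dimensional, the functional is the pairing
  with one of them, and the difference of \<open>w\<close> and the image of this cycle is orthogonal to the cycles of the dual and
  hence bounds. In degrees
  above \<open>n\<close> orthogonality is void, and \<open>w\<close> itself bounds.\<close>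

lemma left_induced_homology_surjective:
  assumes w: "w \<in> cycles (ndual n (ndual n V)) j"
  shows "\<exists>z\<in>cycles V j. w - left_induced n V j z \<in> boundaries (ndual n (ndual n V)) j"
proof -
  interpret D: simplicial_vector_space "ndual n V" by (rule simplicial_vector_space_ndual)
  interpret DD: simplicial_vector_space "ndual n (ndual n V)" by (rule D.simplicial_vector_space_ndual)
  have wl: "w \<in> lev (ndual n (ndual n V)) j" using w by (simp add: DD.cycles_iff)
  have "\<exists>z\<in>cycles V j. \<forall>i f. n = j + i \<longrightarrow> f \<in> cycles (ndual n V) i \<longrightarrow>
      top_value n (left_induced n V j z) (D.EZ j i f) = top_value n w (D.EZ j i f)"
  proof (cases "j \<le> n")
    case False
    then show ?thesis using subspace_0[OF subspace_cycles] by auto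
  next
    case True
    then obtain i where n: "n = i + j" by (metis add.commute le_Suc_ex)
    then have n': "n = j + i" by simp
    obtain B0 where B0: "finite B0" "lev V j = span B0" using finite_dim by blast
    obtain B where B: "finite B" "cycles V j = span B"
      using finite_basis_of_subspace[OF subspace_cycles _ B0(1), of j] B0(2) cycles_subset normalized_subset by blast
    have Bl: "b \<in> cycles V j" "b \<in> lev V j" if "b \<in> B" for b
      using that span_superset[of B] B(2) by (auto simp: cycles_iff)
    let ?e = "\<lambda>b f. top_value n f (EZ i j b)"
    have lin_e: "linear_map_on (cycles (ndual n V) i) UNIV (?e b)" for b
      by (simp add: linear_map_on_def top_value_add top_value_scale)
    have fl: "f \<in> lev (ndual n V) i" if "f \<in> cycles (ndual n V) i" for f
      using that by (simp add: D.cycles_iff)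
    have lin_v: "linear_map_on (lev V j) UNIV (\<lambda>v. ?e v f)" if "f \<in> cycles (ndual n V) i" for f
      by (rule linear_map_on_comp[OF EZ_linear]) (use top_value_linear[OF fl[OF that]] n in simp)
    have lin_w: "linear_map_on (cycles (ndual n V) i) UNIV (\<lambda>f. top_value n w (D.EZ j i f))"
    proof (rule linear_map_on_subset)
      show "linear_map_on (lev (ndual n V) i) UNIV (\<lambda>f. top_value n w (D.EZ j i f))"
        by (rule linear_map_on_comp[OF D.EZ_linear]) (use D.top_value_linear[OF wl] n' in simp)
    qed (use fl in auto)
    have "\<exists>c. \<forall>f\<in>cycles (ndual n V) i. top_value n w (D.EZ j i f) = (\<Sum>b\<in>B. c b * ?e b f)"
    proof (rule functional_in_span_of_functionals[OF B(1) D.subspace_cycles lin_w lin_e])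
      fix f assume f: "f \<in> cycles (ndual n V) i" and orth: "\<forall>b\<in>B. ?e b f = 0"
      have "?e v f \<in> {0}" if "v \<in> cycles V j" for v
        by (rule linear_map_on_span_subset[OF lin_v[OF f] subspace_lev subspace_single_0 _ _ that[unfolded B(2)]])
          (use Bl orth in auto)
      then have "f \<in> boundaries (ndual n V) i"
        using n by (intro boundary_if_orthogonal_left[OF f]) auto
      then show "top_value n w (D.EZ j i f) = 0" by (rule D.pairing_boundary_right[OF w _ n'])
    qed
    then obtain c where c: "\<And>f. f \<in> cycles (ndual n V) i \<Longrightarrow> top_value n w (D.EZ j i f) = (\<Sum>b\<in>B. c b * ?e b f)" by blast
    define z0 where "z0 = (\<Sum>b\<in>B. c b *\<^sub>R b)"
    \<comment> \<open>The global sign compensates the one in \<open>left_induced_EZ\<close>.\<close>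
    define z where "z = path_sign {..<n} *\<^sub>R z0"
    have z0: "z0 \<in> cycles V j"
      unfolding z0_def using Bl by (intro subspace_sum[OF subspace_cycles] subspace_scale[OF subspace_cycles])
    have z: "z \<in> cycles V j" unfolding z_def using subspace_scale[OF subspace_cycles z0] .
    have "top_value n (left_induced n V j z) (D.EZ j i f) = top_value n w (D.EZ j i f)" if f: "f \<in> cycles (ndual n V) i" for f
    proof -
      have "?e z0 f = (\<Sum>b\<in>B. ?e (c b *\<^sub>R b) f)"
        unfolding z0_def using Bl subspace_scale[OF subspace_lev] by (intro linear_map_on_sum[OF lin_v[OF f] subspace_lev]) auto
      also have "\<dots> = (\<Sum>b\<in>B. c b * ?e b f)"
        using linear_map_on_scale[OF lin_v[OF f]] Bl by simp
      finally have e: "?e z0 f = top_value n w (D.EZ j i f)" using c[OF f] by simp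
      have "top_value n (left_induced n V j z) (D.EZ j i f) = path_sign {..<n} * ?e z f"
        using left_induced_EZ[OF _ fl[OF f] n] z by (simp add: cycles_iff)
      also have "\<dots> = path_sign {..<n} * path_sign {..<n} * ?e z0 f"
        unfolding z_def using linear_map_on_scale[OF lin_v[OF f]] z0 by (simp add: cycles_iff)
      also have "path_sign {..<n} * path_sign {..<n} = 1"
        by (simp add: path_sign_def power_mult_distrib[symmetric])
      finally show ?thesis using e by simp
    qed
    then show ?thesis using z n' by auto
  qed
  then obtain z where z: "z \<in> cycles V j" and eq: "\<And>i f. n = j + i \<Longrightarrow> f \<in> cycles (ndual n V) i \<Longrightarrow>
      top_value n (left_induced n V j z) (D.EZ j i f) = top_value n w (D.EZ j i f)" by blast
  have "left_induced n V j z \<in> cycles (ndual n (ndual n V)) j"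
    by (rule simplicial_map_cycles[OF simplicial_vector_space_axioms DD.simplicial_vector_space_axioms
          simplicial_linear_map_left_induced z])
  from subspace_diff[OF DD.subspace_cycles w this]
  have "w - left_induced n V j z \<in> boundaries (ndual n (ndual n V)) j"
  proof (rule D.boundary_if_orthogonal_left)
    fix i f assume "n = j + i" "f \<in> cycles (ndual n V) i"
    from eq[OF this] show "top_value n (w - left_induced n V j z) (D.EZ j i f) = 0"
      unfolding top_value_diff by linarith
  qed
  then show ?thesis using z by blast
qed

lemma cycle_is_boundary_above_type:
  assumes "at_most_type n V" "n < m" "z \<in> cycles V m"
  shows "z \<in> boundaries V m"
proof -
  let ?R = "{(y, z). y \<in> cycles V m \<and> z \<in> cycles V m \<and> y - z \<in> boundaries V m}"
  have "?R `` {z} \<in> homology V m" unfolding homology_def by (rule quotientI[OF assms(3)])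
  then have "?R `` {z} = boundaries V m" using assms(1,2) by (simp add: at_most_type_def)
  moreover have "z \<in> ?R `` {z}" using assms(3) subspace_0[OF subspace_boundaries] by simp
  ultimately show ?thesis by simp
qed

end

theorem theorem4p20:
  fixes n :: nat and V :: "'a::real_vector svec"
  assumes "simplicial_vector_space V"
    and "at_most_type n V"
  shows "weak_equivalence V (ndual n (ndual n V)) (left_induced n V)"
proof -
  interpret V: simplicial_vector_space V by (rule assms(1))
  show ?thesis
  proof (rule weak_equivalence_if_homology_bij[OF assms(1)
        simplicial_vector_space.simplicial_vector_space_ndual[OF V.simplicial_vector_space_ndual]
        V.simplicial_linear_map_left_induced])
    show "z \<in> boundaries V i" if "z \<in> cycles V i" "left_induced n V i z \<in> boundaries (ndual n (ndual n V)) i" for i z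
      using V.left_induced_homology_injective[OF that(1) _ that(2)] V.cycle_is_boundary_above_type[OF assms(2) _ that(1)]
      by (cases "i \<le> n") auto
    show "\<exists>z\<in>cycles V i. w - left_induced n V i z \<in> boundaries (ndual n (ndual n V)) i"
      if "w \<in> cycles (ndual n (ndual n V)) i" for i w
      by (rule V.left_induced_homology_surjective[OF that])
  qed
qed

end
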